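(* Let $M=M(\iota)$ and $N=N(\iota)$ be increasing sequences with $M/N\to\beta\in(0,1)$. For each $\iota$ let $\bm V\in\mathbb{C}^{M\times N}$ be a random matrix with $\bm V\bm V^*=\bm I_M$ (almost surely), with columns $\bm v_1,\dots,\bm v_N\in\mathbb{C}^M$. Suppose there is a constant $C>0$ such that for every integer $k\ge1$, $$\limsup_{\iota\to\infty}N^{k/2-C}\max_{i,j\in[N]}\mathbb{E}\big[|\langle\bm v_i,\bm v_j\rangle-\mathbf 1\{i=j\}\beta|^k\big]=0.$$ Let $\bm A\in\mathbb{R}^{N\times N}$ be a random diagonal matrix, independent of $\bm V$, whose diagonal entries are i.i.d. with $A_{ii}\sim\mathsf{Ber}(\alpha)$ for some $\alpha\in(0,1)$. Then the empirical spectral distribution of $\bm A\bm V^*\bm V\bm A$ converges in probability to $\mathsf{MANOVA}(\alpha,\beta)$.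
   Context: $\mathsf{Ber}(\alpha)$ is the law of a $\{0,1\}$-valued variable equal to $1$ with probability $\alpha$. $\langle \bm v_i,\bm v_j\rangle=\bm v_i^*\bm v_j$. For $\alpha,\beta\in(0,1)$, $\mathsf{MANOVA}(\alpha,\beta)$ is the probability measure on $\mathbb{R}$ $$d\mu(x)=\frac{\sqrt{(r_+-x)(x-r_-)}}{2\pi x(1-x)}\mathbf 1_{[r_-,r_+]}(x)\,dx+(1-\min\{\alpha,\beta\})\delta_0+\max\{\alpha+\beta-1,0\}\delta_1,$$ where $r_\pm=r_\pm(\alpha,\beta)=\big(\sqrt{\alpha(1-\beta)}\pm\sqrt{\beta(1-\alpha)}\big)^2$ and $\delta_c$ is the Dirac mass at $c$. The empirical spectral distribution (e.s.d.) of a Hermitian $N\times N$ matrix with eigenvalues $\lambda_1,\dots,\lambda_N$ is $\frac1N\sum_i\delta_{\lambda_i}$. Random probability measures $\mu_\iota$ converge in probability to a deterministic $\mu$ if for every continuous compactly supported $f:\mathbb{R}\to\mathbb{R}$, $\int f\,d\mu_\iota\to\int f\,d\mu$ in probability. *)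

theory Defs
  imports "HOL-Probability.Probability" "Jordan_Normal_Form.Schur_Decomposition"
begin

definition Vmat :: "nat \<Rightarrow> nat \<Rightarrow> (nat \<Rightarrow> nat \<Rightarrow> complex) \<Rightarrow> complex mat" where
  "Vmat m n v = mat m n (\<lambda>(i,j). v i j)"

definition Dmat :: "nat \<Rightarrow> (nat \<Rightarrow> real) \<Rightarrow> complex mat" where
  "Dmat n a = mat n n (\<lambda>(i,j). if i = j then complex_of_real (a i) else 0)"

definition col_inner :: "nat \<Rightarrow> (nat \<Rightarrow> nat \<Rightarrow> complex) \<Rightarrow> nat \<Rightarrow> nat \<Rightarrow> complex" where
  "col_inner m v i j = (\<Sum>l<m. cnj (v l i) * v l j)"

(* Integral of f against the empirical spectral distribution (1/N) sum_i delta_{lambda_i}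
   of an N x N Hermitian matrix H; eigenvalues counted with algebraic multiplicity
   (the roots of the characteristic polynomial); they are real since H is Hermitian. *)
definition esd_integral :: "complex mat \<Rightarrow> (real \<Rightarrow> real) \<Rightarrow> real" where
  "esd_integral H f =
     (\<Sum>z\<in>{z. poly (char_poly H) z = 0}. real (Polynomial.order z (char_poly H)) * f (Re z)) / real (dim_row H)"

definition manova_rminus :: "real \<Rightarrow> real \<Rightarrow> real" where
  "manova_rminus a b = (sqrt (a * (1 - b)) - sqrt (b * (1 - a)))\<^sup>2"

definition manova_rplus :: "real \<Rightarrow> real \<Rightarrow> real" where
  "manova_rplus a b = (sqrt (a * (1 - b)) + sqrt (b * (1 - a)))\<^sup>2"

definition manova_integral :: "real \<Rightarrow> real \<Rightarrow> (real \<Rightarrow> real) \<Rightarrow> real" where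
  "manova_integral a b f =
     (LBINT x=manova_rminus a b..manova_rplus a b.
        f x * sqrt ((manova_rplus a b - x) * (x - manova_rminus a b)) / (2 * pi * x * (1 - x)))
     + (1 - min a b) * f 0 + max (a + b - 1) 0 * f 1"

end

theory Submission
  imports Defs
begin

text \<open>Write \<open>H = V\<^sup>* V\<close>, which is a projection, and \<open>X = (H - \<beta>) (A - \<alpha>)\<close>. The entries of \<open>H - \<beta>\<close> are of order
  \<open>N\<^bsup>-1/2\<^esup>\<close> and those of \<open>A - \<alpha>\<close> are centered and independent of \<open>H\<close>, so a second moment computation shows that
  \<open>tr (X\<^sup>k) / N\<close> tends to \<open>0\<close> in mean square for every \<open>k \<ge> 1\<close>. Since \<open>A\<close> and \<open>H\<close> are projections, \<open>(A - \<alpha>)\<^sup>2\<close> and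
  \<open>(H - \<beta>)\<^sup>2\<close> are affine in \<open>A\<close> and \<open>H\<close>; hence \<open>tr (A X\<^sup>k A) / N\<close> tends to \<open>0\<close> as well. But \<open>A X\<^sup>k A = q\<^sub>k (A H A) A\<close> for
  polynomials \<open>q\<^sub>k\<close> of degree \<open>k\<close> with a constant-coefficient three-term recursion, so the integral of \<open>q\<^sub>k\<close> against the
  empirical spectral distribution tends to \<open>(1 - \<alpha>) q\<^sub>k 0\<close>. The MANOVA law has the same integrals: in the angular
  variable \<open>q\<^sub>k\<close> becomes a combination of Chebyshev polynomials and the density a sum of two Poisson kernels. As the \<open>q\<^sub>k\<close>
  span all polynomials and the spectrum lies in \<open>[0, 1]\<close>, the Weierstrass theorem concludes.\<close>

section \<open>Traces and spectra of complex matrices\<close>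

text \<open>The two shifts do different work. Shifting \<open>A\<close> gives its diagonal mean
  zero, so in the expanded square of a trace every term with an index of multiplicity one has
  expectation 0. Shifting \<open>H\<close> makes its diagonal as small as its off-diagonal entries.
  The surviving terms use at most k of the 2k possible values, so there are O(N^k) of them, each of
  size O(N^(1-k)). Hence E |tr X^k|^2 = O(N), against N^2 from the normalisation. The factor N lost
  in comparison with N^(-k) pays for the factor N^C in the moment hypothesis, and the normalisation
  can afford it. The value (1 - \<alpha>) q_k(0) comes from the kernel of \<open>A\<close>: it
  contributes N - tr A zero eigenvalues to the spectrum of AHA, whereas the trace of q_k(AHA) A does
  not see it. On the side of the law, the absolutely continuous part cancels the contribution of the
  atom at 1 and changes the weight of q_k(0) from 1 - min(\<alpha>, \<beta>) to 1 - \<alpha>. Thus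
  neither moments nor a Stieltjes transform of the law have to be computed.\<close>

definition mtrace :: "'a::comm_monoid_add mat \<Rightarrow> 'a" where
  "mtrace A = (\<Sum>i<dim_row A. A $$ (i, i))"

lemma mtrace_mult_commute:
  fixes A B :: "'a::comm_semiring_0 mat"
  assumes A: "A \<in> carrier_mat n m" and B: "B \<in> carrier_mat m n"
  shows "mtrace (A * B) = mtrace (B * A)"
proof -
  have "mtrace (A * B) = (\<Sum>i<n. \<Sum>j<m. A $$ (i, j) * B $$ (j, i))"
    using A B by (simp add: mtrace_def scalar_prod_def lessThan_atLeast0)
  also have "\<dots> = (\<Sum>j<m. \<Sum>i<n. A $$ (i, j) * B $$ (j, i))"
    by (rule sum.swap)
  also have "\<dots> = mtrace (B * A)"
    using A B by (simp add: mtrace_def scalar_prod_def lessThan_atLeast0 mult.commute)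
  finally show ?thesis .
qed

lemma mtrace_add:
  assumes "A \<in> carrier_mat n n" "B \<in> carrier_mat n n"
  shows "mtrace (A + B) = mtrace A + mtrace B"
  using assms by (simp add: mtrace_def sum.distrib)

lemma mtrace_minus:
  fixes A B :: "'a::ab_group_add mat"
  assumes "A \<in> carrier_mat n n" "B \<in> carrier_mat n n"
  shows "mtrace (A - B) = mtrace A - mtrace B"
  using assms by (simp add: mtrace_def sum_subtractf)

lemma mtrace_smult:
  fixes A :: "'a::semiring_0 mat"
  assumes "A \<in> carrier_mat n n"
  shows "mtrace (c \<cdot>\<^sub>m A) = c * mtrace A"
  using assms by (simp add: mtrace_def sum_distrib_left)

lemma mtrace_one: "mtrace (1\<^sub>m n) = of_nat n"
  by (simp add: mtrace_def)

lemma pow_mat_commute: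
  fixes A :: "'a::semiring_1 mat"
  assumes A: "A \<in> carrier_mat n n"
  shows "A ^\<^sub>m k * A = A * A ^\<^sub>m k"
proof (induction k)
  case (Suc k)
  have "A ^\<^sub>m Suc k * A = A * A ^\<^sub>m k * A" using Suc by simp
  then show ?case using A by (simp add: assoc_mult_mat[of _ n n _ n _ n])
qed (use A in simp)

text \<open>The diagonal claim rests on the triangular one: in the sum for entry (i, i), terms with
  \<open>l < i\<close> vanish because the power is triangular, those with \<open>l > i\<close>
  because \<open>B\<close> is.\<close>

lemma upper_triangular_pow:
  fixes B :: "'a::comm_semiring_1 mat"
  assumes B: "B \<in> carrier_mat n n" and ut: "upper_triangular B"
  shows "(\<forall>i<n. \<forall>j<i. (B ^\<^sub>m k) $$ (i, j) = 0) \<and> (\<forall>i<n. (B ^\<^sub>m k) $$ (i, i) = (B $$ (i, i)) ^ k)"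
proof (induction k)
  case 0
  then show ?case using B by auto
next
  case (Suc k)
  have c: "B ^\<^sub>m k \<in> carrier_mat n n" using B by simp
  have e: "(B ^\<^sub>m Suc k) $$ (i, j) = (\<Sum>l<n. (B ^\<^sub>m k) $$ (i, l) * B $$ (l, j))"
    if "i < n" "j < n" for i j
    using B c that by (simp add: scalar_prod_def lessThan_atLeast0)
  have z: "B $$ (i, j) = 0" if "i < n" "j < i" for i j
    using ut B that by auto
  have "(B ^\<^sub>m Suc k) $$ (i, j) = 0" if "i < n" "j < i" for i j
  proof -
    have "(\<Sum>l<n. (B ^\<^sub>m k) $$ (i, l) * B $$ (l, j)) = 0"
    proof (rule sum.neutral, rule ballI)
      fix l assume l: "l \<in> {..<n}"
      show "(B ^\<^sub>m k) $$ (i, l) * B $$ (l, j) = 0"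
        using Suc z[of l j] l that by (cases "l < i") auto
    qed
    then show ?thesis using e[of i j] that by simp
  qed
  moreover have "(B ^\<^sub>m Suc k) $$ (i, i) = (B $$ (i, i)) ^ Suc k" if "i < n" for i
  proof -
    have "(\<Sum>l<n. (B ^\<^sub>m k) $$ (i, l) * B $$ (l, i)) = (\<Sum>l\<in>{i}. (B ^\<^sub>m k) $$ (i, l) * B $$ (l, i))"
    proof (rule sum.mono_neutral_right)
      show "\<forall>l\<in>{..<n} - {i}. (B ^\<^sub>m k) $$ (i, l) * B $$ (l, i) = 0"
      proof
        fix l assume l: "l \<in> {..<n} - {i}"
        show "(B ^\<^sub>m k) $$ (i, l) * B $$ (l, i) = 0"
          using Suc z[of l i] l that by (cases "l < i") auto
      qed
    qed (use that in auto)
    then show ?thesis using e[of i i] that Suc by (simp add: mult.commute)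
  qed
  ultimately show ?case by blast
qed

text \<open>Schur triangularisation reduces this to diagonals: the trace is invariant under
  similarity, and \<open>upper_triangular_pow\<close> reads off the diagonal of a power.\<close>

lemma mtrace_pow_eigenvalues:
  fixes A :: "complex mat"
  assumes A: "A \<in> carrier_mat n n" and es: "char_poly A = (\<Prod>e\<leftarrow>es. [:- e, 1:])"
  shows "mtrace (A ^\<^sub>m k) = (\<Sum>e\<leftarrow>es. e ^ k)"
proof -
  obtain B P Q where "schur_decomposition A es = (B, P, Q)"
    by (cases "schur_decomposition A es") auto
  from schur_decomposition[OF A es this]
  have sim: "similar_mat_wit A B P Q" and ut: "upper_triangular B" and d: "diag_mat B = es"
    by auto
  from similar_mat_witD2[OF A sim]
  have B: "B \<in> carrier_mat n n" and P: "P \<in> carrier_mat n n" and Q: "Q \<in> carrier_mat n n"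
    and QP: "Q * P = 1\<^sub>m n" by auto
  have Bk: "B ^\<^sub>m k \<in> carrier_mat n n" using B by simp
  have "A ^\<^sub>m k = P * B ^\<^sub>m k * Q"
    by (rule similar_mat_wit_pow_id[OF sim])
  then have "mtrace (A ^\<^sub>m k) = mtrace (Q * (P * B ^\<^sub>m k))"
    using mtrace_mult_commute[of "P * B ^\<^sub>m k" n n Q] P Bk Q by simp
  also have "Q * (P * B ^\<^sub>m k) = B ^\<^sub>m k"
    using assoc_mult_mat[OF Q P Bk, symmetric] QP left_mult_one_mat[OF Bk] by simp
  also have "mtrace (B ^\<^sub>m k) = (\<Sum>i<n. (B $$ (i, i)) ^ k)"
    using upper_triangular_pow[OF B ut, of k] B by (simp add: mtrace_def)
  also have "\<dots> = (\<Sum>e\<leftarrow>es. e ^ k)"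
    using B unfolding d[symmetric] diag_mat_def
    by (simp add: sum_list_sum_nth lessThan_atLeast0)
  finally show ?thesis .
qed

lemma order_prod_linear_factors:
  fixes es :: "'a::idom list"
  shows "Polynomial.order z (\<Prod>e\<leftarrow>es. [:- e, 1:]) = count_list es z"
proof (induction es)
  case (Cons e es)
  have "(\<Prod>e\<leftarrow>es. [:- e, 1:]) \<noteq> 0" by auto
  moreover have "Polynomial.order z [:- e, 1:] = (if e = z then 1 else 0)"
    using order_power_n_n[of z 1] by (auto intro!: order_0I)
  ultimately show ?case
    using Cons by (simp add: order_mult del: mult_pCons_left)
qed simp

lemma sum_list_map_eq_sum_count_list:
  fixes g :: "'b \<Rightarrow> 'a::comm_semiring_1"
  shows "(\<Sum>e\<leftarrow>es. g e) = (\<Sum>z\<in>set es. of_nat (count_list es z) * g z)"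
proof -
  have "(\<Sum>e\<leftarrow>es. g e) = (\<Sum>z\<in>S. of_nat (count_list es z) * g z)"
    if "finite S" "set es \<subseteq> S" for S
    using that(2)
  proof (induction es)
    case (Cons e es)
    have "(\<Sum>z\<in>S. of_nat (count_list (e # es) z) * g z)
        = (\<Sum>z\<in>S. (if z = e then g z else 0) + of_nat (count_list es z) * g z)"
      by (rule sum.cong) (auto simp: algebra_simps)
    also have "\<dots> = g e + (\<Sum>z\<in>S. of_nat (count_list es z) * g z)"
      using Cons that(1) by (simp add: sum.distrib)
    finally show ?case using Cons by simp
  qed simp
  then show ?thesis by simp
qed

text \<open>Trades roots with orders for a list with repetitions, so that traces of powers and
  spectral integrals become sums over the same list.\<close>

lemma esd_integral_eigenvalues:
  assumes es: "char_poly A = (\<Prod>e\<leftarrow>es. [:- e, 1:])"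
  shows "esd_integral A f = (\<Sum>e\<leftarrow>es. f (Re e)) / real (dim_row A)"
proof -
  have "poly (\<Prod>e\<leftarrow>es. [:- e, 1:]) z = 0 \<longleftrightarrow> z \<in> set es" for z
    by (induction es) auto
  then have "{z. poly (char_poly A) z = 0} = set es" by (auto simp: es)
  then show ?thesis
    unfolding esd_integral_def es order_prod_linear_factors
    by (simp add: sum_list_map_eq_sum_count_list)
qed

lemma mat_adjoint_index:
  assumes "i < dim_col A" "j < dim_row A"
  shows "mat_adjoint A $$ (i, j) = conjugate (A $$ (j, i))"
  using assms by (simp add: mat_adjoint_def mat_of_rows_index)

lemma mat_adjoint_carrier:
  "A \<in> carrier_mat n m \<Longrightarrow> mat_adjoint A \<in> carrier_mat m n"
  by (simp add: mat_adjoint_def mat_of_rows_def carrier_matD)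

text \<open>Pairing the eigenvalue equation with \<open>v\<close> gives \<mu> |v|^2 = |E
  v|^2.\<close>

lemma mat_adjoint_mult_eigenvalue_nonneg:
  fixes E :: "complex mat"
  assumes E: "E \<in> carrier_mat m n" and v: "v \<in> carrier_vec n" "v \<noteq> 0\<^sub>v n"
    and ev: "(mat_adjoint E * E) *\<^sub>v v = \<mu> \<cdot>\<^sub>v v"
  shows "\<exists>r\<ge>0. \<mu> = complex_of_real r"
proof -
  define nv where "nv = (\<Sum>i<n. (cmod (v $ i))\<^sup>2)"
  define w where "w = E *\<^sub>v v"
  have w: "w \<in> carrier_vec m" using E v by (simp add: w_def)
  have adj: "mat_adjoint E \<in> carrier_mat n m" by (rule mat_adjoint_carrier[OF E])
  have "nv > 0"
  proof -
    obtain i where "i < n" "v $ i \<noteq> 0" using v by (metis carrier_vecD eq_vecI index_zero_vec)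
    then show ?thesis unfolding nv_def by (intro sum_pos2[of _ i]) auto
  qed
  have "\<mu> * complex_of_real nv = (\<Sum>i<n. cnj (v $ i) * (\<mu> \<cdot>\<^sub>v v) $ i)"
    using v by (simp add: nv_def sum_distrib_left complex_norm_square mult_ac del: of_real_power)
  also have "\<dots> = (\<Sum>i<n. cnj (v $ i) * (mat_adjoint E *\<^sub>v w) $ i)"
    using E adj v by (simp add: ev[symmetric] w_def assoc_mult_mat_vec[of _ n m _ n])
  also have "\<dots> = (\<Sum>i<n. \<Sum>j<m. cnj (v $ i) * (cnj (E $$ (j, i)) * w $ j))"
    using E adj w by (simp add: scalar_prod_def lessThan_atLeast0 sum_distrib_left mat_adjoint_index)
  also have "\<dots> = (\<Sum>j<m. \<Sum>i<n. cnj (v $ i) * (cnj (E $$ (j, i)) * w $ j))"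
    by (rule sum.swap)
  also have "\<dots> = (\<Sum>j<m. cnj (w $ j) * w $ j)"
  proof (rule sum.cong)
    fix j assume "j \<in> {..<m}"
    then have "w $ j = (\<Sum>i<n. E $$ (j, i) * v $ i)"
      using E v by (simp add: w_def scalar_prod_def lessThan_atLeast0)
    then have "cnj (w $ j) = (\<Sum>i<n. cnj (E $$ (j, i)) * cnj (v $ i))" by simp
    then have "cnj (w $ j) * w $ j = (\<Sum>i<n. cnj (E $$ (j, i)) * cnj (v $ i) * w $ j)"
      by (simp only: sum_distrib_right)
    then show "(\<Sum>i<n. cnj (v $ i) * (cnj (E $$ (j, i)) * w $ j)) = cnj (w $ j) * w $ j"
      by (simp add: mult_ac)
  qed simp
  also have "\<dots> = complex_of_real (\<Sum>j<m. (cmod (w $ j))\<^sup>2)"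
    by (simp add: complex_norm_square mult.commute del: of_real_power)
  finally have "\<mu> = complex_of_real ((\<Sum>j<m. (cmod (w $ j))\<^sup>2) / nv)"
    using \<open>nv > 0\<close> by (simp add: field_simps)
  moreover have "(\<Sum>j<m. (cmod (w $ j))\<^sup>2) / nv \<ge> 0"
    using \<open>nv > 0\<close> by (simp add: sum_nonneg)
  ultimately show ?thesis by blast
qed

text \<open>One list serves traces and spectral integrals at once. Its members are recorded as
  eigenvalues so that an upper bound on them can be added later, in the case of projections.\<close>

lemma gram_spectrum:
  fixes E :: "complex mat"
  assumes E: "E \<in> carrier_mat m n"
  shows "\<exists>es :: real list. length es = n \<and>
    (\<forall>k. mtrace ((mat_adjoint E * E) ^\<^sub>m k) = complex_of_real (\<Sum>e\<leftarrow>es. e ^ k)) \<and>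
    (\<forall>f. esd_integral (mat_adjoint E * E) f = (\<Sum>e\<leftarrow>es. f e) / real n) \<and>
    (\<forall>e\<in>set es. e \<ge> 0 \<and> eigenvalue (mat_adjoint E * E) (complex_of_real e))"
proof -
  let ?A = "mat_adjoint E * E"
  have A: "?A \<in> carrier_mat n n" using E mat_adjoint_carrier[OF E] by simp
  obtain as where as: "char_poly ?A = (\<Prod>a\<leftarrow>as. [:- a, 1:])" "length as = n"
    using char_poly_factorized[OF A] by blast
  have ev: "eigenvalue ?A a" if "a \<in> set as" for a
  proof -
    have "poly (\<Prod>e\<leftarrow>as. [:- e, 1:]) a = 0" using that by (induction as) auto
    then show ?thesis using eigenvalue_root_char_poly[OF A, of a] as by simp
  qed
  have nn: "Re a \<ge> 0 \<and> a = complex_of_real (Re a)" if a: "a \<in> set as" for a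
  proof -
    obtain v where "v \<in> carrier_vec n" "v \<noteq> 0\<^sub>v n" "?A *\<^sub>v v = a \<cdot>\<^sub>v v"
      using ev[OF a] A unfolding eigenvalue_def eigenvector_def by auto
    from mat_adjoint_mult_eigenvalue_nonneg[OF E this] show ?thesis by auto
  qed
  show ?thesis
  proof (intro exI[of _ "map Re as"] conjI allI ballI)
    show "length (map Re as) = n" using as by simp
    show "mtrace (?A ^\<^sub>m k) = complex_of_real (\<Sum>e\<leftarrow>map Re as. e ^ k)" for k
    proof -
      have "map (\<lambda>e. e ^ k) as = map (\<lambda>e. complex_of_real (Re e ^ k)) as"
        using nn by (simp add: of_real_power)
      then have "mtrace (?A ^\<^sub>m k) = (\<Sum>e\<leftarrow>as. complex_of_real (Re e ^ k))"
        using mtrace_pow_eigenvalues[OF A as(1), of k] by (simp only:)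
      also have "\<dots> = complex_of_real (\<Sum>e\<leftarrow>as. Re e ^ k)"
        by (induction as) auto
      finally show ?thesis by (simp add: comp_def)
    qed
    show "esd_integral ?A f = (\<Sum>e\<leftarrow>map Re as. f e) / real n" for f
      using esd_integral_eigenvalues[OF as(1), of f] mat_adjoint_carrier[OF E] by (simp add: comp_def)
    fix e assume "e \<in> set (map Re as)"
    then show "e \<ge> 0" "eigenvalue ?A (complex_of_real e)" using nn ev by force+
  qed
qed

section \<open>Compression of a pair of projections\<close>

text \<open>The polynomials \<open>q\<^sub>k\<close> with \<open>A X\<^sup>k A = q\<^sub>k (A H A) A\<close> for \<open>X = (H - b) (A - a)\<close>. The three-term recursion
  comes from \<open>X\<^sup>2 = Z X - d\<close> with \<open>A Z = (A H A - c) A\<close>, where \<open>c = a + b - 2ab\<close> and \<open>d = ab(1-a)(1-b)\<close>.\<close>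

fun compressed_poly :: "real \<Rightarrow> real \<Rightarrow> nat \<Rightarrow> real \<Rightarrow> real" where
  "compressed_poly a b 0 x = 1"
| "compressed_poly a b (Suc 0) x = (1 - a) * (x - b)"
| "compressed_poly a b (Suc (Suc k)) x = (x - (a + b - 2 * a * b)) * compressed_poly a b (Suc k) x
     - a * b * (1 - a) * (1 - b) * compressed_poly a b k x"

text \<open>In the application \<open>A\<close> is the random diagonal matrix, \<open>H\<close> the
  Gram matrix of the columns, and \<open>a\<close>, \<open>b\<close> are the limits of their
  normalised traces. The spectral bound for \<open>cC\<close> is used with both scalars equal to
  0.\<close>

locale projection_pair =
  fixes A H :: "complex mat" and n :: nat and a b :: complex
  assumes A: "A \<in> carrier_mat n n" and H: "H \<in> carrier_mat n n"
    and AA: "A * A = A" and HH: "H * H = H"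
begin

definition "cP = H - b \<cdot>\<^sub>m 1\<^sub>m n"
definition "cB = A - a \<cdot>\<^sub>m 1\<^sub>m n"
definition "cX = cP * cB"
definition "cC = A * H * A"

lemma carriers [simp]: "A \<in> carrier_mat n n" "H \<in> carrier_mat n n" "cP \<in> carrier_mat n n"
  "cB \<in> carrier_mat n n" "cX \<in> carrier_mat n n" "cC \<in> carrier_mat n n"
  "cX ^\<^sub>m k \<in> carrier_mat n n" "cC ^\<^sub>m k \<in> carrier_mat n n"
  using A H by (auto simp: cP_def cB_def cX_def cC_def)

lemma dims [simp]: "dim_row A = n" "dim_col A = n" "dim_row H = n" "dim_col H = n"
  "dim_row cP = n" "dim_col cP = n" "dim_row cB = n" "dim_col cB = n"
  "dim_row cX = n" "dim_col cX = n" "dim_row cC = n" "dim_col cC = n"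
  using carriers by blast+

lemmas [simp] = mult_carrier_mat[of _ n n _ n] left_mult_one_mat[of _ n n] right_mult_one_mat[of _ n n]
  minus_carrier_mat[of _ n n] add_carrier_mat[of _ n n] smult_carrier_mat[of _ n n]
lemmas dist = mult_minus_distrib_mat[of _ n n _ n _] minus_mult_distrib_mat[of _ n n _ _ n]
  mult_smult_distrib[of _ n n _ n] mult_smult_assoc_mat[of _ n n _ n]
  mult_add_distrib_mat[of _ n n _ n _] add_mult_distrib_mat[of _ n n _ _ n]
lemmas assoc = assoc_mult_mat[of _ n n _ n _ n]

lemma cC_mult_A: "cC * A = cC"
  by (simp add: cC_def assoc AA)

lemma A_mult_cC: "A * cC = cC"
  by (simp add: cC_def assoc[symmetric] AA)

lemma A_mult_cB: "A * cB = (1 - a) \<cdot>\<^sub>m A"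
proof -
  have "A * cB = A - a \<cdot>\<^sub>m A" by (simp add: cB_def dist AA)
  also have "\<dots> = (1 - a) \<cdot>\<^sub>m A" using A by (intro eq_matI) (auto simp: algebra_simps)
  finally show ?thesis .
qed

text \<open>A projection shifted by a scalar satisfies a quadratic equation with scalar
  coefficients. This and its twin for \<open>cB\<close> are what closes the recursions
  below.\<close>

lemma cP_mult_cP: "cP * cP = (1 - 2 * b) \<cdot>\<^sub>m cP + (b * (1 - b)) \<cdot>\<^sub>m 1\<^sub>m n"
proof -
  have "cP * cP = H - b \<cdot>\<^sub>m H - b \<cdot>\<^sub>m (H - b \<cdot>\<^sub>m 1\<^sub>m n)"
    by (simp add: cP_def dist HH)
  also have "\<dots> = (1 - 2 * b) \<cdot>\<^sub>m cP + (b * (1 - b)) \<cdot>\<^sub>m 1\<^sub>m n"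
    using H by (intro eq_matI) (auto simp: cP_def algebra_simps)
  finally show ?thesis .
qed

lemma cB_mult_cB: "cB * cB = (1 - 2 * a) \<cdot>\<^sub>m cB + (a * (1 - a)) \<cdot>\<^sub>m 1\<^sub>m n"
proof -
  have "cB * cB = A - a \<cdot>\<^sub>m A - a \<cdot>\<^sub>m (A - a \<cdot>\<^sub>m 1\<^sub>m n)"
    by (simp add: cB_def dist AA)
  also have "\<dots> = (1 - 2 * a) \<cdot>\<^sub>m cB + (a * (1 - a)) \<cdot>\<^sub>m 1\<^sub>m n"
    using A by (intro eq_matI) (auto simp: cB_def algebra_simps)
  finally show ?thesis .
qed

lemma A_cP_A: "A * cP * A = cC - b \<cdot>\<^sub>m A"
  by (simp add: cP_def dist cC_def AA)

text \<open>The case \<open>k = 1\<close>, and the origin of \<open>(1 - a) * (x - b)\<close> in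
  \<open>compressed_poly\<close>.\<close>

lemma A_cX_A: "A * cX * A = (1 - a) \<cdot>\<^sub>m (cC - b \<cdot>\<^sub>m A)"
proof -
  have "cB * A = (1 - a) \<cdot>\<^sub>m A"
  proof -
    have "cB * A = A - a \<cdot>\<^sub>m A" by (simp add: cB_def dist AA)
    also have "\<dots> = (1 - a) \<cdot>\<^sub>m A" using A by (intro eq_matI) (auto simp: algebra_simps)
    finally show ?thesis .
  qed
  then have "A * cX * A = (1 - a) \<cdot>\<^sub>m (A * cP * A)"
    by (simp add: cX_def assoc dist)
  then show ?thesis by (simp add: A_cP_A)
qed

text \<open>Splitting the middle \<open>cB\<close> as \<open>A - a\<close> gives two terms. In one,
  \<open>A * cP * A\<close> appears, which is \<open>cC - b A\<close>; in the other,
  \<open>cP\<close> meets \<open>cP\<close> and its quadratic equation applies. Collecting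
  coefficients yields the constants of the recursion.\<close>

lemma A_cX_cX:
  "A * cX * cX = cC * (A * cX) - (a + b - 2 * a * b) \<cdot>\<^sub>m (A * cX) - (a * b * (1 - a) * (1 - b)) \<cdot>\<^sub>m A"
proof -
  have 1: "cB * cX = A * cX - a \<cdot>\<^sub>m cX"
    by (simp add: cB_def dist)
  have 2: "A * cP * (A * cX) = cC * cX - b \<cdot>\<^sub>m (A * cX)"
    by (simp add: assoc[symmetric] A_cP_A dist)
  have "A * cP * cX = A * (cP * cP) * cB" by (simp add: cX_def assoc)
  also have "\<dots> = (1 - 2 * b) \<cdot>\<^sub>m (A * cX) + (b * (1 - b) * (1 - a)) \<cdot>\<^sub>m A"
    unfolding cP_mult_cP by (simp add: dist assoc cX_def[symmetric] A_mult_cB) (rule eq_matI, auto)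
  finally have 3: "A * cP * cX = (1 - 2 * b) \<cdot>\<^sub>m (A * cX) + (b * (1 - b) * (1 - a)) \<cdot>\<^sub>m A" .
  have 4: "cC * (A * cX) = cC * cX"
    by (simp add: assoc[symmetric] cC_mult_A)
  define T where "T = A * cX"
  define U where "U = cC * cX"
  have [simp]: "T \<in> carrier_mat n n" "U \<in> carrier_mat n n" "dim_row T = n" "dim_col T = n"
      "dim_row U = n" "dim_col U = n" by (auto simp: T_def U_def)
  have "A * cX * cX = A * cP * (cB * cX)" by (simp add: cX_def assoc)
  also have "\<dots> = U - b \<cdot>\<^sub>m T - a \<cdot>\<^sub>m ((1 - 2 * b) \<cdot>\<^sub>m T + (b * (1 - b) * (1 - a)) \<cdot>\<^sub>m A)"
    unfolding 1 by (simp add: dist 2 3 T_def U_def)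
  also have "\<dots> = U - (a + b - 2 * a * b) \<cdot>\<^sub>m T - (a * b * (1 - a) * (1 - b)) \<cdot>\<^sub>m A"
    by (intro eq_matI) (auto simp: algebra_simps)
  finally show ?thesis by (simp add: 4 T_def U_def)
qed

lemma A_cX_pow_rec:
  "A * cX ^\<^sub>m Suc (Suc k) = cC * (A * cX ^\<^sub>m Suc k) - (a + b - 2 * a * b) \<cdot>\<^sub>m (A * cX ^\<^sub>m Suc k)
     - (a * b * (1 - a) * (1 - b)) \<cdot>\<^sub>m (A * cX ^\<^sub>m k)"
proof (induction k)
  case 0
  show ?case using A_cX_cX A by (simp add: assoc)
next
  case (Suc k)
  have "A * cX ^\<^sub>m Suc (Suc (Suc k)) = A * cX ^\<^sub>m Suc (Suc k) * cX" by (simp add: assoc)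
  also have "\<dots> = cC * (A * cX ^\<^sub>m Suc (Suc k)) - (a + b - 2 * a * b) \<cdot>\<^sub>m (A * cX ^\<^sub>m Suc (Suc k))
     - (a * b * (1 - a) * (1 - b)) \<cdot>\<^sub>m (A * cX ^\<^sub>m Suc k)"
    by (subst Suc.IH) (simp add: dist assoc)
  finally show ?case .
qed

text \<open>The extra power of \<open>cC\<close> is there for the induction: the recursion in
  \<open>k\<close> multiplies by \<open>cC\<close>, which only raises \<open>j\<close>.\<close>

definition "crho j k = mtrace (cC ^\<^sub>m j * (A * cX ^\<^sub>m k))"

lemma crho_Suc_Suc:
  "crho j (Suc (Suc k)) = crho (Suc j) (Suc k) - (a + b - 2 * a * b) * crho j (Suc k)
     - a * b * (1 - a) * (1 - b) * crho j k"
proof -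
  have c: "cC ^\<^sub>m j * (A * cX ^\<^sub>m k) \<in> carrier_mat n n" for j k by (simp)
  have 1: "crho (Suc j) (Suc k) = mtrace (cC ^\<^sub>m j * (cC * (A * cX ^\<^sub>m Suc k)))"
    by (simp add: crho_def assoc)
  show ?thesis
    unfolding crho_def[of j] A_cX_pow_rec 1
    by (simp add: dist mtrace_minus[of _ n] mtrace_smult[of _ n] del: pow_mat.simps)
qed

lemma cC_pow_mult_A: "cC ^\<^sub>m Suc j * A = cC ^\<^sub>m Suc j"
  by (simp add: assoc cC_mult_A)

lemma cC_pow_commute_A: "cC ^\<^sub>m j * A = A * cC ^\<^sub>m j"
proof (induction j)
  case 0
  then show ?case using A by (simp add: cC_def)
next
  case (Suc j)
  have "cC ^\<^sub>m Suc j * A = cC ^\<^sub>m j * (A * cC)" by (simp add: assoc cC_mult_A A_mult_cC)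
  also have "\<dots> = A * cC ^\<^sub>m Suc j" using Suc by (simp add: assoc[symmetric])
  finally show ?case .
qed

text \<open>For \<open>j > 0\<close> the factor \<open>A\<close> is absorbed by \<open>cC\<close>;
  at \<open>j = 0\<close> it survives, and this is the source of the correction term in
  \<open>crho_eigenvalues\<close>.\<close>

lemma crho_0: "crho j 0 = (if j = 0 then mtrace A else mtrace (cC ^\<^sub>m j))"
proof -
  show ?thesis
    using A by (cases j) (auto simp: crho_def cC_pow_mult_A simp del: pow_mat.simps(2))
qed

lemma crho_1: "crho j (Suc 0) = (1 - a) * (mtrace (cC ^\<^sub>m Suc j) - b * crho j 0)"
proof -
  \<comment> \<open>\<open>A\<close> is doubled so that one copy can commute past the powers of
    \<open>cC\<close> and go round the trace, producing \<open>A * cX * A\<close>.\<close>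
  have "crho j (Suc 0) = mtrace (cC ^\<^sub>m j * A * (A * cX))"
    using arg_cong[OF AA, of "\<lambda>M. cC ^\<^sub>m j * (M * cX)"] by (simp add: crho_def assoc)
  also have "\<dots> = mtrace (A * (cC ^\<^sub>m j * (A * cX)))"
    by (simp add: cC_pow_commute_A assoc)
  also have "\<dots> = mtrace (cC ^\<^sub>m j * (A * cX) * A)"
    by (rule mtrace_mult_commute[of _ n n]) auto
  also have "cC ^\<^sub>m j * (A * cX) * A = cC ^\<^sub>m j * (A * cX * A)" by (simp add: assoc)
  also have "mtrace \<dots> = (1 - a) * (mtrace (cC ^\<^sub>m Suc j) - b * mtrace (cC ^\<^sub>m j * A))"
    unfolding A_cX_A by (simp add: dist mtrace_minus[of _ n] mtrace_smult[of _ n])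
  finally show ?thesis using A by (simp add: crho_def)
qed

lemma cX_pow_commute: "cX ^\<^sub>m k * cX = cX * cX ^\<^sub>m k"
  by (rule pow_mat_commute[OF carriers(5)])

text \<open>The extra \<open>cB\<close> merges with the last factor of the power. Together with the
  next lemma this alternates between the traces with \<open>cB\<close> and with \<open>cP\<close>,
  lowering the power each time, until a plain trace of \<open>cB\<close> or \<open>cP\<close> is
  left.\<close>

lemma mtrace_cX_pow_cB:
  "mtrace (cX ^\<^sub>m Suc k * cB) = (1 - 2 * a) * mtrace (cX ^\<^sub>m Suc k) + a * (1 - a) * mtrace (cX ^\<^sub>m k * cP)"
proof -
  have "cX ^\<^sub>m Suc k * cB = cX ^\<^sub>m k * (cP * (cB * cB))" by (simp add: cX_def assoc)
  also have "\<dots> = (1 - 2 * a) \<cdot>\<^sub>m (cX ^\<^sub>m Suc k) + (a * (1 - a)) \<cdot>\<^sub>m (cX ^\<^sub>m k * cP)"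
    unfolding cB_mult_cB by (simp add: dist cX_def[symmetric])
  finally show ?thesis by (simp add: mtrace_add[of _ n] mtrace_smult[of _ n] del: pow_mat.simps)
qed

text \<open>Cyclicity moves the extra \<open>cP\<close> to the front, where the power begins with
  \<open>cP\<close>.\<close>

lemma mtrace_cX_pow_cP:
  "mtrace (cX ^\<^sub>m Suc k * cP) = (1 - 2 * b) * mtrace (cX ^\<^sub>m Suc k) + b * (1 - b) * mtrace (cX ^\<^sub>m k * cB)"
proof -
  have "mtrace (cX ^\<^sub>m Suc k * cP) = mtrace (cP * cX ^\<^sub>m Suc k)"
    by (rule mtrace_mult_commute[of _ n n]) auto
  also have "cP * cX ^\<^sub>m Suc k = cP * cP * (cB * cX ^\<^sub>m k)"
    by (simp add: cX_pow_commute) (simp add: cX_def assoc)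
  also have "\<dots> = (1 - 2 * b) \<cdot>\<^sub>m (cX * cX ^\<^sub>m k) + (b * (1 - b)) \<cdot>\<^sub>m (cB * cX ^\<^sub>m k)"
    unfolding cP_mult_cP by (simp add: dist) (simp add: cX_def assoc)
  finally have "mtrace (cX ^\<^sub>m Suc k * cP)
      = (1 - 2 * b) * mtrace (cX * cX ^\<^sub>m k) + b * (1 - b) * mtrace (cB * cX ^\<^sub>m k)"
    by (simp add: mtrace_add[of _ n] mtrace_smult[of _ n])
  also have "mtrace (cB * cX ^\<^sub>m k) = mtrace (cX ^\<^sub>m k * cB)"
    by (rule mtrace_mult_commute[of _ n n]) auto
  finally show ?thesis by (simp add: cX_pow_commute)
qed

lemma mtrace_A_cX_pow: "mtrace (A * cX ^\<^sub>m k) = mtrace (cX ^\<^sub>m k * cB) + a * mtrace (cX ^\<^sub>m k)"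
proof -
  have "mtrace (A * cX ^\<^sub>m k) = mtrace (cX ^\<^sub>m k * A)"
    by (rule mtrace_mult_commute[of _ n n]) auto
  also have "\<dots> = mtrace (cX ^\<^sub>m k * cB) + a * mtrace (cX ^\<^sub>m k)"
    unfolding cB_def by (simp add: dist mtrace_minus[of _ n] mtrace_smult[of _ n])
  finally show ?thesis .
qed

text \<open>The kernel of \<open>A\<close> has dimension \<open>n - mtrace A\<close> and contributes
  that many zeros to \<open>es\<close>, but the factor \<open>A\<close> hides it from the trace.
  Removing those zeros gives the correction; \<open>0 ^ j\<close> is 1 only for
  \<open>j = 0\<close>.\<close>

lemma crho_eigenvalues:
  fixes a' b' :: real
  assumes ab: "a = of_real a'" "b = of_real b'"
    and len: "length es = n" and tr: "\<And>k. mtrace (cC ^\<^sub>m k) = complex_of_real (\<Sum>e\<leftarrow>es. e ^ k)"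
  shows "crho j k = of_real (\<Sum>e\<leftarrow>es. e ^ j * compressed_poly a' b' k e)
     - (of_nat n - mtrace A) * 0 ^ j * of_real (compressed_poly a' b' k 0)"
proof (induction k arbitrary: j rule: induct_nat_012)
  case 0
  then show ?case using tr[of j] len
    unfolding crho_0 by (auto simp: ab sum_list_triv)
next
  case 1
  have eq: "(\<Sum>e\<leftarrow>es. e ^ j * ((1 - a') * (e - b'))) = (1 - a') * ((\<Sum>e\<leftarrow>es. e ^ Suc j) - b' * (\<Sum>e\<leftarrow>es. e ^ j))"
    by (induction es) (auto simp: algebra_simps)
  show ?case
    unfolding crho_1 crho_0 compressed_poly.simps eq tr using len
    by (cases j) (simp_all add: ab sum_list_triv algebra_simps del: pow_mat.simps)
next
  case (ge2 k)
  have eq: "(\<Sum>e\<leftarrow>es. e ^ j * compressed_poly a' b' (Suc (Suc k)) e)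
      = (\<Sum>e\<leftarrow>es. e ^ Suc j * compressed_poly a' b' (Suc k) e)
        - (a' + b' - 2 * a' * b') * (\<Sum>e\<leftarrow>es. e ^ j * compressed_poly a' b' (Suc k) e)
        - a' * b' * (1 - a') * (1 - b') * (\<Sum>e\<leftarrow>es. e ^ j * compressed_poly a' b' k e)"
    by (induction es) (auto simp: algebra_simps)
  show ?case
    unfolding crho_Suc_Suc ge2 eq by (simp add: ab algebra_simps)
qed

end

section \<open>Adjoints, the Gram form of the compressed matrix, and the upper spectral
  bound\<close>

lemma mat_adjoint_mult:
  fixes A B :: "complex mat"
  assumes A: "A \<in> carrier_mat n m" and B: "B \<in> carrier_mat m l"
  shows "mat_adjoint (A * B) = mat_adjoint B * mat_adjoint A"
proof (rule eq_matI)
  note c = mat_adjoint_carrier[OF A] mat_adjoint_carrier[OF B]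
    mat_adjoint_carrier[OF mult_carrier_mat[OF A B]]
  show "dim_row (mat_adjoint (A * B)) = dim_row (mat_adjoint B * mat_adjoint A)"
    "dim_col (mat_adjoint (A * B)) = dim_col (mat_adjoint B * mat_adjoint A)" using c by auto
  fix i j assume "i < dim_row (mat_adjoint B * mat_adjoint A)" "j < dim_col (mat_adjoint B * mat_adjoint A)"
  then have "i < l" "j < n" using c by auto
  then show "mat_adjoint (A * B) $$ (i, j) = (mat_adjoint B * mat_adjoint A) $$ (i, j)"
    using A B c by (simp add: mat_adjoint_index scalar_prod_def mult.commute)
qed

lemma mat_adjoint_adjoint:
  fixes A :: "complex mat"
  shows "mat_adjoint (mat_adjoint A) = A"
proof -
  have A: "A \<in> carrier_mat (dim_row A) (dim_col A)" by simp
  note c = mat_adjoint_carrier[OF A] mat_adjoint_carrier[OF mat_adjoint_carrier[OF A]]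
  show ?thesis using c by (intro eq_matI) (auto simp: mat_adjoint_index)
qed

lemma mat_adjoint_minus:
  fixes A B :: "complex mat"
  assumes A: "A \<in> carrier_mat n m" and B: "B \<in> carrier_mat n m"
  shows "mat_adjoint (A - B) = mat_adjoint A - mat_adjoint B"
proof -
  note c = mat_adjoint_carrier[OF A] mat_adjoint_carrier[OF B] mat_adjoint_carrier[OF minus_carrier_mat[OF B], of A]
  show ?thesis using A B c by (intro eq_matI) (auto simp: mat_adjoint_index)
qed

lemma mat_adjoint_one: "mat_adjoint (1\<^sub>m n :: complex mat) = 1\<^sub>m n"
proof -
  have "mat_adjoint (1\<^sub>m n :: complex mat) \<in> carrier_mat n n" by (rule mat_adjoint_carrier) simp
  then show ?thesis by (intro eq_matI) (auto simp: mat_adjoint_index)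
qed

lemma Vmat_carrier: "Vmat m n v \<in> carrier_mat m n"
  by (simp add: Vmat_def)

lemma Dmat_carrier: "Dmat n x \<in> carrier_mat n n"
  by (simp add: Dmat_def)

lemma mat_adjoint_Dmat: "mat_adjoint (Dmat n x) = Dmat n x"
  using mat_adjoint_carrier[OF Dmat_carrier[of n x]]
  by (intro eq_matI) (auto simp: mat_adjoint_index Dmat_def)

lemma Dmat_idem:
  assumes "\<And>i. i < n \<Longrightarrow> x i \<in> {0, 1}"
  shows "Dmat n x * Dmat n x = Dmat n x"
proof (rule eq_matI)
  fix i j assume "i < dim_row (Dmat n x)" "j < dim_col (Dmat n x)"
  then have ij: "i < n" "j < n" by (auto simp: Dmat_def)
  then have "(Dmat n x * Dmat n x) $$ (i, j)
    = (\<Sum>l<n. (if i = l then complex_of_real (x i) else 0) * (if l = j then complex_of_real (x l) else 0))"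
    by (simp add: Dmat_def scalar_prod_def lessThan_atLeast0)
  also have "\<dots> = (\<Sum>l<n. if l = i then (if l = j then complex_of_real (x i * x i) else 0) else 0)"
    by (rule sum.cong) auto
  also have "\<dots> = Dmat n x $$ (i, j)" using ij assms[of i] by (auto simp: Dmat_def)
  finally show "(Dmat n x * Dmat n x) $$ (i, j) = Dmat n x $$ (i, j)" .
qed (auto simp: Dmat_def)

text \<open>Valid for every real diagonal, so the spectrum is real and nonnegative at every outcome,
  also on the null set where \<open>V\<close> fails to be a coisometry.\<close>

lemma compressed_gram:
  "Dmat n x * mat_adjoint (Vmat m n v) * Vmat m n v * Dmat n x
     = mat_adjoint (Vmat m n v * Dmat n x) * (Vmat m n v * Dmat n x)"
proof -
  note c = Vmat_carrier[of m n v] Dmat_carrier[of n x] mat_adjoint_carrier[OF Vmat_carrier[of m n v]]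
  show ?thesis
    using c by (simp add: mat_adjoint_mult[of _ m n _ n] mat_adjoint_Dmat assoc_mult_mat[of _ n n _ m _ n]
      assoc_mult_mat[of _ n m _ n _ n] assoc_mult_mat[of _ n n _ n _ n])
qed

lemma coisometry_gram_idem:
  assumes V: "V \<in> carrier_mat m n" and VV: "V * mat_adjoint V = 1\<^sub>m m"
  shows "(mat_adjoint V * V) * (mat_adjoint V * V) = mat_adjoint V * (V :: complex mat)"
proof -
  note c = V mat_adjoint_carrier[OF V]
  have "(mat_adjoint V * V) * (mat_adjoint V * V) = mat_adjoint V * (V * mat_adjoint V) * V"
    using c by (simp add: assoc_mult_mat[of _ n m _ n _ n] assoc_mult_mat[of _ m n _ m _ n]
      assoc_mult_mat[of _ n m _ m _ n])
  then show ?thesis using c by (simp add: VV)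
qed

lemma (in projection_pair) cC_eigenvalue_le_1:
  assumes adjA: "mat_adjoint A = A" and adjH: "mat_adjoint H = H"
    and ev: "eigenvalue cC (complex_of_real e)"
  shows "e \<le> 1"
proof (rule ccontr)
  assume "\<not> e \<le> 1"
  \<comment> \<open>\<open>cC - cC\<^sup>2\<close> is the Gram matrix of \<open>(1 - A) H A\<close>, hence positive semidefinite.\<close>
  define E where "E = (1\<^sub>m n - A) * (H * A)"
  have one: "1\<^sub>m n - A \<in> carrier_mat n n" by simp
  have idem: "(1\<^sub>m n - A) * (1\<^sub>m n - A) = 1\<^sub>m n - A"
  proof -
    have "(1\<^sub>m n - A) * (1\<^sub>m n - A) = (1\<^sub>m n - A) - (A - A)" by (simp add: dist AA)
    also have "\<dots> = 1\<^sub>m n - A" by (intro eq_matI) auto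
    finally show ?thesis .
  qed
  have "mat_adjoint E = A * H * (1\<^sub>m n - A)"
    unfolding E_def
    by (simp add: mat_adjoint_mult[of _ n n _ n] mat_adjoint_minus[of _ n n] mat_adjoint_one adjA adjH)
  then have "mat_adjoint E * E = A * H * ((1\<^sub>m n - A) * (1\<^sub>m n - A)) * (H * A)"
    by (simp add: E_def assoc)
  also have "\<dots> = cC - cC * cC"
  proof -
    have 1: "A * H * (H * A) = cC"
      using arg_cong[OF HH, of "\<lambda>M. A * M * A"] by (simp add: cC_def assoc)
    have 2: "A * H * A * (H * A) = cC * cC"
      using arg_cong[OF AA, of "\<lambda>M. A * H * M * (H * A)"] by (simp add: cC_def assoc)
    show ?thesis unfolding idem by (simp add: dist 1 2)
  qed
  finally have EE: "mat_adjoint E * E = cC - cC * cC" .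
  obtain v where v: "v \<in> carrier_vec n" "v \<noteq> 0\<^sub>v n" and cv: "cC *\<^sub>v v = complex_of_real e \<cdot>\<^sub>v v"
    using ev unfolding eigenvalue_def eigenvector_def by auto
  have "(cC - cC * cC) *\<^sub>v v = cC *\<^sub>v v - cC *\<^sub>v (cC *\<^sub>v v)"
    using v by (simp add: minus_mult_distrib_mat_vec[of _ n n] assoc_mult_mat_vec[of _ n n _ n])
  also have "\<dots> = complex_of_real (e - e * e) \<cdot>\<^sub>v v"
    using v by (simp add: cv mult_mat_vec[of _ n n]) (intro eq_vecI, auto simp: cv algebra_simps)
  finally have "(mat_adjoint E * E) *\<^sub>v v = complex_of_real (e - e * e) \<cdot>\<^sub>v v" by (simp add: EE)
  moreover have "E \<in> carrier_mat n n" by (simp add: E_def)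
  ultimately obtain r where "r \<ge> 0" "complex_of_real (e - e * e) = complex_of_real r"
    using mat_adjoint_mult_eigenvalue_nonneg[of E n n v] v by blast
  then have "e - e * e \<ge> 0" by (simp only: of_real_eq_iff)
  then have "e * (1 - e) \<ge> 0" by (simp add: algebra_simps)
  with \<open>\<not> e \<le> 1\<close> show False by (simp add: zero_le_mult_iff)
qed

section \<open>Poisson kernel integrals\<close>

text \<open>The endpoints are left out so that \<open>sin t > 0\<close>: for \<open>|r| = 1\<close>
  a Poisson denominator vanishes at one of them.\<close>

abbreviation angle_measure :: "real measure" where
  "angle_measure \<equiv> restrict_space lborel {0<..<pi}"

lemma finite_angle_measure: "finite_measure angle_measure"
  by (rule finite_measureI) (simp add: emeasure_restrict_space space_restrict_space)

lemma measure_angle_measure: "measure angle_measure (space angle_measure) = pi"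
  by (simp add: measure_restrict_space space_restrict_space)

lemma measure_angle_measure' [simp]: "measure angle_measure {0<..<pi} = pi"
  by (simp add: measure_restrict_space)

lemma angle_integrable_bounded:
  fixes f :: "real \<Rightarrow> real"
  assumes "f \<in> borel_measurable borel" "\<And>t. 0 < t \<Longrightarrow> t < pi \<Longrightarrow> \<bar>f t\<bar> \<le> C"
  shows "integrable angle_measure f"
proof -
  interpret finite_measure angle_measure by (rule finite_angle_measure)
  have "f \<in> borel_measurable angle_measure"
    by (rule measurable_restrict_space1) (use assms(1) in simp)
  then show ?thesis
    using assms(2) by (intro integrable_const_bound[of f C]) (auto simp: space_restrict_space)
qed

lemma angle_integral_bound:
  fixes f :: "real \<Rightarrow> real"
  assumes "f \<in> borel_measurable borel" "\<And>t. 0 < t \<Longrightarrow> t < pi \<Longrightarrow> \<bar>f t\<bar> \<le> C"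
  shows "\<bar>integral\<^sup>L angle_measure f\<bar> \<le> C * pi"
proof -
  interpret finite_measure angle_measure by (rule finite_angle_measure)
  have i: "integrable angle_measure f" by (rule angle_integrable_bounded[OF assms])
  have "\<bar>integral\<^sup>L angle_measure f\<bar> \<le> (\<integral>t. \<bar>f t\<bar> \<partial>angle_measure)" by (rule integral_abs_bound)
  also have "\<dots> \<le> (\<integral>t. C \<partial>angle_measure)"
    using i assms(2) by (intro integral_mono) (auto simp: space_restrict_space)
  also have "\<dots> = C * pi" by (simp add: measure_angle_measure)
  finally show ?thesis .
qed

lemma angle_integral_eq_interval_integral:
  fixes f :: "real \<Rightarrow> real"
  shows "integral\<^sup>L angle_measure f = (LBINT t=0..pi. f t)"
  by (simp add: integral_restrict_space interval_integral_Ioo set_lebesgue_integral_def)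

lemma angle_integral_cos:
  "(\<integral>t. cos (real_of_int m * t) \<partial>angle_measure) = (if m = 0 then pi else 0)"
proof (cases "m = 0")
  case True
  then show ?thesis by (simp add: measure_angle_measure)
next
  case False
  have "(LBINT t=0..pi. cos (real_of_int m * t))
      = sin (real_of_int m * pi) / real_of_int m - sin (real_of_int m * 0) / real_of_int m"
    unfolding zero_ereal_def
  proof (rule interval_integral_FTC_finite)
    show "continuous_on {min 0 pi..max 0 pi} (\<lambda>t. cos (real_of_int m * t))"
      by (intro continuous_intros)
    show "((\<lambda>t. sin (real_of_int m * t) / real_of_int m) has_vector_derivative cos (real_of_int m * t))
        (at t within {min 0 pi..max 0 pi})" for t
      unfolding has_real_derivative_iff_has_vector_derivative[symmetric]
      using False by (auto intro!: derivative_eq_intros)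
  qed
  then show ?thesis
    using False by (simp add: angle_integral_eq_interval_integral sin_times_pi_eq_0)
qed

lemma angle_integral_sin_sin:
  assumes "k \<ge> 1"
  shows "(\<integral>t. sin (real k * t) * sin (real j * t) \<partial>angle_measure) = (if j = k then pi / 2 else 0)"
proof -
  \<comment> \<open>Frequencies are integers because \<open>k - j\<close> may be negative;
    \<open>k >= 1\<close> keeps \<open>k + j\<close> away from 0.\<close>
  have e: "sin (real k * t) * sin (real j * t)
      = cos (real_of_int (int k - int j) * t) / 2 - cos (real_of_int (int k + int j) * t) / 2" for t
    by (simp add: sin_times_sin left_diff_distrib distrib_right diff_divide_distrib)
  have i: "integrable angle_measure (\<lambda>t. cos (real_of_int m * t))" for m
    by (rule angle_integrable_bounded[where C=1]) auto
  have "(\<integral>t. sin (real k * t) * sin (real j * t) \<partial>angle_measure)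
    = (\<integral>t. cos (real_of_int (int k - int j) * t) \<partial>angle_measure) / 2
      - (\<integral>t. cos (real_of_int (int k + int j) * t) \<partial>angle_measure) / 2"
    unfolding e using i[of "int k - int j"] i[of "int k + int j"]
    by (subst Bochner_Integration.integral_diff) (simp_all only: integrable_divide_zero integral_divide_zero)
  then show ?thesis using assms unfolding angle_integral_cos by auto
qed

text \<open>Together with \<open>poisson_denominator_ge_sin\<close> this bounds the Poisson
  integrand by \<open>k\<close> uniformly in \<open>r\<close>, which supplies the dominating
  function for the limit \<open>|r| = 1\<close>.\<close>

lemma abs_sin_mult_le: "\<bar>sin (real k * t)\<bar> \<le> real k * \<bar>sin t\<bar>"
proof (induction k)
  case (Suc k)
  have "\<bar>sin (real (Suc k) * t)\<bar> = \<bar>sin (real k * t) * cos t + cos (real k * t) * sin t\<bar>"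
    by (simp add: sin_add algebra_simps)
  also have "\<dots> \<le> \<bar>sin (real k * t)\<bar> * \<bar>cos t\<bar> + \<bar>cos (real k * t)\<bar> * \<bar>sin t\<bar>"
    by (metis abs_mult abs_triangle_ineq)
  also have "\<dots> \<le> \<bar>sin (real k * t)\<bar> * 1 + 1 * \<bar>sin t\<bar>"
    by (intro add_mono mult_mono) auto
  finally show ?case using Suc by (simp add: algebra_simps)
qed simp

lemma poisson_denominator_ge_sin:
  fixes r t :: real
  shows "1 - 2 * r * cos t + r\<^sup>2 \<ge> (sin t)\<^sup>2"
proof -
  have "1 - 2 * r * cos t + r\<^sup>2 = (sin t)\<^sup>2 + (cos t - r)\<^sup>2"
    using sin_cos_squared_add[of t] by (simp add: power2_eq_square algebra_simps)
  then show ?thesis by simp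
qed

lemma poisson_denominator_ge:
  fixes r t :: real
  assumes "\<bar>r\<bar> \<le> 1"
  shows "1 - 2 * r * cos t + r\<^sup>2 \<ge> (1 - \<bar>r\<bar>)\<^sup>2"
proof -
  have "r * cos t \<le> \<bar>r\<bar> * \<bar>cos t\<bar>" by (simp add: abs_mult[symmetric])
  also have "\<dots> \<le> \<bar>r\<bar> * 1" by (intro mult_left_mono) auto
  finally have "r * cos t \<le> \<bar>r\<bar>" by simp
  then show ?thesis by (simp add: power2_eq_square algebra_simps)
qed

text \<open>The generating function of the Chebyshev polynomials of the second kind, times
  \<open>sin t\<close>, truncated with an exact remainder; the terms telescope by the recursion for
  sines of multiples. Only finite sums then have to be integrated.\<close>

lemma sin_expansion_poisson:
  fixes r t :: real
  shows "sin t = (1 - 2 * r * cos t + r\<^sup>2) * (\<Sum>j<n. r ^ j * sin (real (Suc j) * t))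
     + r ^ n * sin (real (Suc n) * t) - r ^ Suc n * sin (real n * t)"
proof (induction n)
  case (Suc n)
  have "sin (real (Suc (Suc n)) * t) + sin (real n * t) = 2 * cos t * sin (real (Suc n) * t)"
  proof -
    have "real (Suc (Suc n)) * t = real (Suc n) * t + t" "real n * t = real (Suc n) * t - t"
      by (auto simp: algebra_simps)
    then show ?thesis by (simp only: sin_add sin_diff) simp
  qed
  then have *: "sin (real (Suc (Suc n)) * t) = 2 * cos t * sin (real (Suc n) * t) - sin (real n * t)" by simp
  show ?case
    unfolding * using Suc by (simp add: algebra_simps power2_eq_square)
qed simp

text \<open>Orthogonality of the sines leaves the single term \<open>j = k - 1\<close> of the
  truncated expansion; the remainder \<open>R n\<close> is of size \<open>|r| ^ n\<close> and
  disappears in the limit.\<close>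

lemma angle_integral_poisson_less:
  assumes r: "\<bar>r\<bar> < 1" and k: "k \<ge> 1"
  shows "(\<integral>t. sin (real k * t) * sin t / (1 - 2 * r * cos t + r\<^sup>2) \<partial>angle_measure) = pi / 2 * r ^ (k - 1)"
proof -
  define K where "K t = 1 - 2 * r * cos t + r\<^sup>2" for t
  define c where "c = (1 - \<bar>r\<bar>)\<^sup>2"
  have c: "c > 0" using r by (simp add: c_def)
  have K: "K t \<ge> c" for t using poisson_denominator_ge[of r t] r by (simp add: K_def c_def)
  have K0: "K t > 0" for t using K[of t] c by simp
  have [measurable]: "K \<in> borel_measurable borel" unfolding K_def[abs_def] by measurable
  define R where "R n t = sin (real k * t) * (r ^ n * sin (real (Suc n) * t) - r ^ Suc n * sin (real n * t)) / K t" for n t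
  have [measurable]: "R n \<in> borel_measurable borel" for n unfolding R_def[abs_def] by measurable
  have Rb: "\<bar>R n t\<bar> \<le> 2 * \<bar>r\<bar> ^ n / c" for n t
  proof -
    have "\<bar>r ^ n * sin (real (Suc n) * t) - r ^ Suc n * sin (real n * t)\<bar>
        \<le> \<bar>r ^ n * sin (real (Suc n) * t)\<bar> + \<bar>r ^ Suc n * sin (real n * t)\<bar>" by simp
    also have "\<dots> \<le> \<bar>r\<bar> ^ n * 1 + \<bar>r\<bar> ^ Suc n * 1"
      unfolding abs_mult power_abs by (intro add_mono mult_left_mono) auto
    also have "\<dots> \<le> \<bar>r\<bar> ^ n + \<bar>r\<bar> ^ n" using r mult_right_mono[of "\<bar>r\<bar>" 1 "\<bar>r\<bar> ^ n"] by simp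
    finally have "\<bar>sin (real k * t)\<bar> * \<bar>r ^ n * sin (real (Suc n) * t) - r ^ Suc n * sin (real n * t)\<bar>
       \<le> 1 * (2 * \<bar>r\<bar> ^ n)" by (intro mult_mono) auto
    then show ?thesis
      unfolding R_def abs_mult abs_divide using K[of t] K0[of t] c by (intro frac_le) auto
  qed
  have main: "(\<integral>t. sin (real k * t) * sin t / K t \<partial>angle_measure) = pi / 2 * r ^ (k - 1) + integral\<^sup>L angle_measure (R n)"
    if n: "n \<ge> k" for n
  proof -
    have e: "sin (real k * t) * sin t / K t
        = (\<Sum>j<n. r ^ j * (sin (real k * t) * sin (real (Suc j) * t))) + R n t" for t
    proof -
      have "sin (real k * t) * sin t = K t * (\<Sum>j<n. r ^ j * (sin (real k * t) * sin (real (Suc j) * t)))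
         + sin (real k * t) * (r ^ n * sin (real (Suc n) * t) - r ^ Suc n * sin (real n * t))"
      proof -
        define S where "S = (\<Sum>j<n. r ^ j * sin (real (Suc j) * t))"
        have S: "(\<Sum>j<n. r ^ j * (sin (real k * t) * sin (real (Suc j) * t))) = sin (real k * t) * S"
          unfolding S_def sum_distrib_left by (simp add: mult_ac)
        have "sin (real k * t) * sin t
           = sin (real k * t) * (K t * S + r ^ n * sin (real (Suc n) * t) - r ^ Suc n * sin (real n * t))"
          using sin_expansion_poisson[of t r n] unfolding S_def K_def by (simp only:)
        then show ?thesis unfolding S by (simp only: algebra_simps)
      qed
      then show ?thesis using K0[of t] by (simp add: R_def field_simps)
    qed
    have i: "integrable angle_measure (\<lambda>t. sin (real k * t) * sin (real (Suc j) * t))" for j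
      by (rule angle_integrable_bounded[where C=1]) (auto simp: abs_mult intro!: mult_le_one)
    have "(\<integral>t. sin (real k * t) * sin t / K t \<partial>angle_measure)
      = (\<Sum>j<n. r ^ j * (if Suc j = k then pi / 2 else 0)) + integral\<^sup>L angle_measure (R n)"
      unfolding e using i angle_integrable_bounded[of "R n", OF _ Rb] angle_integral_sin_sin[OF k]
      by (subst Bochner_Integration.integral_add) (auto simp del: of_nat_Suc)
    also have "(\<Sum>j<n. r ^ j * (if Suc j = k then pi / 2 else 0)) = (\<Sum>j<n. if j = k - 1 then pi / 2 * r ^ (k - 1) else 0)"
      by (rule sum.cong) (use k in auto)
    also have "\<dots> = pi / 2 * r ^ (k - 1)" using n k by (simp add: sum.delta)
    finally show ?thesis .
  qed
  have "(\<lambda>n. integral\<^sup>L angle_measure (R n)) \<longlonglongrightarrow> 0"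
  proof (rule Lim_null_comparison)
    show "\<forall>\<^sub>F n in sequentially. norm (integral\<^sup>L angle_measure (R n)) \<le> 2 * \<bar>r\<bar> ^ n / c * pi"
      using angle_integral_bound[of "R _", OF _ Rb] by simp
    show "(\<lambda>n. 2 * \<bar>r\<bar> ^ n / c * pi) \<longlonglongrightarrow> 0"
      using r c by (auto intro!: tendsto_eq_intros LIMSEQ_power_zero)
  qed
  then have "(\<lambda>n. pi / 2 * r ^ (k - 1) + integral\<^sup>L angle_measure (R n)) \<longlonglongrightarrow> pi / 2 * r ^ (k - 1) + 0"
    by (intro tendsto_intros)
  moreover have "(\<lambda>n. pi / 2 * r ^ (k - 1) + integral\<^sup>L angle_measure (R n))
      \<longlonglongrightarrow> (\<integral>t. sin (real k * t) * sin t / K t \<partial>angle_measure)"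
    by (intro tendsto_eventually eventually_mono[OF eventually_ge_at_top[of k]] main[symmetric])
  ultimately have "pi / 2 * r ^ (k - 1) + 0 = (\<integral>t. sin (real k * t) * sin t / K t \<partial>angle_measure)"
    by (rule LIMSEQ_unique)
  then show ?thesis unfolding K_def by simp
qed

lemma poisson_kernel_bound:
  assumes "0 < t" "t < pi"
  shows "\<bar>sin (real k * t) * sin t / (1 - 2 * r * cos t + r\<^sup>2)\<bar> \<le> real k"
proof -
  have s: "sin t > 0" using assms by (simp add: sin_gt_zero)
  have "\<bar>sin (real k * t) * sin t\<bar> \<le> real k * (sin t)\<^sup>2"
    using abs_sin_mult_le[of k t] s by (simp add: abs_mult power2_eq_square)
  also have "\<dots> \<le> real k * (1 - 2 * r * cos t + r\<^sup>2)"
    by (intro mult_left_mono poisson_denominator_ge_sin) auto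
  finally have "\<bar>sin (real k * t) * sin t\<bar> \<le> real k * (1 - 2 * r * cos t + r\<^sup>2)" .
  moreover have "1 - 2 * r * cos t + r\<^sup>2 > 0"
    using poisson_denominator_ge_sin[of t r] zero_less_power[OF s, of 2] by linarith
  ultimately show ?thesis by (simp add: abs_divide pos_divide_le_eq)
qed

text \<open>The boundary \<open>|r| = 1\<close> is included because it occurs for
  \<open>a = b\<close> and for \<open>a + b = 1\<close>, where an edge of the support reaches 0 or
  1. It is approached from inside by dominated convergence.\<close>

lemma angle_integral_poisson:
  assumes r: "\<bar>r\<bar> \<le> 1" and k: "k \<ge> 1"
  shows "(\<integral>t. sin (real k * t) * sin t / (1 - 2 * r * cos t + r\<^sup>2) \<partial>angle_measure) = pi / 2 * r ^ (k - 1)"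
proof -
  interpret finite_measure angle_measure by (rule finite_angle_measure)
  define \<rho> where "\<rho> n = r * (1 - 1 / real (n + 2))" for n
  have \<rho>: "\<bar>\<rho> n\<bar> < 1" for n
  proof -
    have "\<bar>\<rho> n\<bar> = \<bar>r\<bar> * (1 - 1 / real (n + 2))" by (simp add: \<rho>_def abs_mult)
    also have "\<dots> \<le> 1 * (1 - 1 / real (n + 2))" using r by (intro mult_right_mono) auto
    finally show ?thesis by (smt (verit) add_gr_0 divide_pos_pos of_nat_0_less_iff zero_less_numeral)
  qed
  have lim: "\<rho> \<longlonglongrightarrow> r"
  proof -
    have "(\<lambda>n. 1 / real (n + 2)) \<longlonglongrightarrow> 0" by (rule LIMSEQ_ignore_initial_segment[OF lim_1_over_n])
    then have "(\<lambda>n. r * (1 - 1 / real (n + 2))) \<longlonglongrightarrow> r * (1 - 0)" by (intro tendsto_intros)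
    then show ?thesis by (simp add: \<rho>_def[abs_def])
  qed
  define F where "F r t = sin (real k * t) * sin t / (1 - 2 * r * cos t + r\<^sup>2)" for r t
  have [measurable]: "F r \<in> borel_measurable angle_measure" for r
    by (rule measurable_restrict_space1) (simp add: F_def[abs_def])
  have "(\<lambda>n. integral\<^sup>L angle_measure (F (\<rho> n))) \<longlonglongrightarrow> integral\<^sup>L angle_measure (F r)"
  proof (rule integral_dominated_convergence[where w="\<lambda>_. real k"])
    show "AE t in angle_measure. (\<lambda>n. F (\<rho> n) t) \<longlonglongrightarrow> F r t"
    proof (rule AE_I2)
      fix t assume "t \<in> space angle_measure"
      then have "sin t > 0" by (auto simp: space_restrict_space sin_gt_zero)
      then have "1 - 2 * r * cos t + r\<^sup>2 > 0"
        using poisson_denominator_ge_sin[of t r] zero_less_power[of "sin t" 2] by linarith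
      then show "(\<lambda>n. F (\<rho> n) t) \<longlonglongrightarrow> F r t"
        unfolding F_def by (intro tendsto_intros lim) auto
    qed
    show "AE t in angle_measure. norm (F (\<rho> n) t) \<le> real k" for n
      using poisson_kernel_bound[of _ k "\<rho> n"] by (auto simp: F_def space_restrict_space intro!: AE_I2)
  qed auto
  moreover have "(\<lambda>n. integral\<^sup>L angle_measure (F (\<rho> n))) \<longlonglongrightarrow> pi / 2 * r ^ (k - 1)"
    unfolding F_def angle_integral_poisson_less[OF \<rho> k] by (intro tendsto_intros lim)
  ultimately show ?thesis unfolding F_def by (rule LIMSEQ_unique)
qed

lemma angle_integral_scaled_poisson:
  assumes X: "X > 0" and s: "\<bar>s\<bar> \<le> X" and k: "k \<ge> 1"
  shows "(\<integral>t. sin (real k * t) * sin t / (X + s\<^sup>2 / X - 2 * s * cos t) \<partial>angle_measure)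
    = pi / 2 * (s / X) ^ (k - 1) / X"
proof -
  have "sin (real k * t) * sin t / (X + s\<^sup>2 / X - 2 * s * cos t)
     = (1 / X) * (sin (real k * t) * sin t / (1 - 2 * (s / X) * cos t + (s / X)\<^sup>2))" for t
  proof -
    have "X + s\<^sup>2 / X - 2 * s * cos t = X * (1 - 2 * (s / X) * cos t + (s / X)\<^sup>2)"
      using X by (simp add: field_simps power2_eq_square)
    then show ?thesis by simp
  qed
  then have "(\<integral>t. sin (real k * t) * sin t / (X + s\<^sup>2 / X - 2 * s * cos t) \<partial>angle_measure)
     = (\<integral>t. (1 / X) * (sin (real k * t) * sin t / (1 - 2 * (s / X) * cos t + (s / X)\<^sup>2)) \<partial>angle_measure)"
    by (simp only:)
  also have "\<dots> = (1 / X) * (pi / 2 * (s / X) ^ (k - 1))"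
  proof -
    have "\<bar>s / X\<bar> \<le> 1" using X s by simp
    from angle_integral_poisson[OF this k] show ?thesis by (simp only: integral_mult_right_zero)
  qed
  finally show ?thesis by simp
qed

lemma scaled_poisson_ge_sin:
  fixes s X t :: real
  assumes X: "X > 0"
  shows "X + s\<^sup>2 / X - 2 * s * cos t \<ge> X * (sin t)\<^sup>2"
proof -
  have "X + s\<^sup>2 / X - 2 * s * cos t = X * (1 - 2 * (s / X) * cos t + (s / X)\<^sup>2)"
    using X by (simp add: field_simps power2_eq_square)
  then show ?thesis using poisson_denominator_ge_sin[of t "s / X"] X by simp
qed

lemma scaled_poisson_bound:
  fixes s X t :: real
  assumes X: "X > 0" and t: "0 < t" "t < pi"
  shows "\<bar>sin (real k * t) * sin t / (X + s\<^sup>2 / X - 2 * s * cos t)\<bar> \<le> real k / X"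
proof -
  have st: "sin t > 0" using t by (simp add: sin_gt_zero)
  have p: "X + s\<^sup>2 / X - 2 * s * cos t > 0"
    using scaled_poisson_ge_sin[OF X, of t s] mult_pos_pos[OF X zero_less_power[OF st, of 2]] by linarith
  have "\<bar>sin (real k * t) * sin t\<bar> \<le> real k * (sin t)\<^sup>2"
    using abs_sin_mult_le[of k t] st by (simp add: abs_mult power2_eq_square)
  also have "\<dots> = real k / X * (X * (sin t)\<^sup>2)" using X by simp
  also have "\<dots> \<le> real k / X * (X + s\<^sup>2 / X - 2 * s * cos t)"
    using X by (intro mult_left_mono scaled_poisson_ge_sin) auto
  finally show ?thesis using p by (simp only: abs_divide abs_of_pos pos_divide_le_eq)
qed

section \<open>Moments of the MANOVA law\<close>

locale manova_params =
  fixes a b :: real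
  assumes a: "0 < a" "a < 1" and b: "0 < b" "b < 1"
begin

text \<open>The support is parametrised by \<open>x = gg t = ctr + 2 ss cos t\<close> with \<open>0 < t < pi\<close>; \<open>wt\<close> is the density times
  \<open>dx/dt\<close>. Both \<open>x\<close> and \<open>1 - x\<close> are Poisson denominators \<open>X (1 - 2 r cos t + r\<^sup>2)\<close>, with \<open>X = X0\<close>, \<open>r = - ss / X0\<close> and
  \<open>X = X1\<close>, \<open>r = ss / X1\<close> respectively, and \<open>X r\<^sup>2 = Y0\<close> or \<open>Y1\<close>. Taking maxima for \<open>X0\<close>, \<open>X1\<close> gives \<open>\<bar>r\<bar> \<le> 1\<close>;
  which argument attains the maximum decides the atoms at \<open>0\<close> and \<open>1\<close>.\<close>

definition "ctr = a + b - 2 * a * b"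
definition "dd = a * b * (1 - a) * (1 - b)"
definition "ss = - sqrt dd"
definition "X0 = max (a * (1 - b)) (b * (1 - a))"
definition "Y0 = min (a * (1 - b)) (b * (1 - a))"
definition "X1 = max (a * b) ((1 - a) * (1 - b))"
definition "Y1 = min (a * b) ((1 - a) * (1 - b))"
definition "gg t = ctr + 2 * ss * cos t"
definition "wt t = 2 * dd * (sin t)\<^sup>2 / (pi * gg t * (1 - gg t))"

lemma dd_pos: "dd > 0" using a b by (simp add: dd_def)
lemma ss_sq: "ss\<^sup>2 = dd" using dd_pos by (simp add: ss_def)
lemma X0_pos: "X0 > 0" using a b by (simp add: X0_def less_max_iff_disj)
lemma X1_pos: "X1 > 0" using a b by (simp add: X1_def less_max_iff_disj)
lemma X0Y0: "X0 * Y0 = dd" by (simp add: X0_def Y0_def dd_def max_def min_def)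
lemma X1Y1: "X1 * Y1 = dd" by (simp add: X1_def Y1_def dd_def max_def min_def)
lemma X0_plus: "X0 + Y0 = ctr" by (simp add: X0_def Y0_def ctr_def max_def min_def algebra_simps)
lemma X1_plus: "X1 + Y1 = 1 - ctr" by (simp add: X1_def Y1_def ctr_def max_def min_def algebra_simps)

lemma abs_ss_le: "\<bar>ss\<bar> \<le> X0" "\<bar>ss\<bar> \<le> X1"
proof -
  have "dd \<le> X0\<^sup>2"
    unfolding X0Y0[symmetric] power2_eq_square
    using X0_pos by (intro mult_left_mono) (auto simp: X0_def Y0_def)
  then have "sqrt dd \<le> X0" using X0_pos by (simp add: real_le_lsqrt)
  then show "\<bar>ss\<bar> \<le> X0" using dd_pos by (simp add: ss_def)
  have "dd \<le> X1\<^sup>2"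
    unfolding X1Y1[symmetric] power2_eq_square
    using X1_pos by (intro mult_left_mono) (auto simp: X1_def Y1_def)
  then have "sqrt dd \<le> X1" using X1_pos by (simp add: real_le_lsqrt)
  then show "\<bar>ss\<bar> \<le> X1" using dd_pos by (simp add: ss_def)
qed

lemma gg_eq: "gg t = X0 + (- ss)\<^sup>2 / X0 - 2 * (- ss) * cos t"
proof -
  have "(- ss)\<^sup>2 / X0 = Y0" using X0Y0 X0_pos by (simp add: ss_sq field_simps)
  then show ?thesis using X0_plus by (simp add: gg_def)
qed

lemma one_minus_gg_eq: "1 - gg t = X1 + ss\<^sup>2 / X1 - 2 * ss * cos t"
proof -
  have "ss\<^sup>2 / X1 = Y1" using X1Y1 X1_pos by (simp add: ss_sq field_simps)
  then show ?thesis using X1_plus by (simp add: gg_def)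
qed

lemma gg_bounds:
  assumes "0 < t" "t < pi"
  shows "0 < gg t" "gg t < 1"
proof -
  have "sin t > 0" using assms by (simp add: sin_gt_zero)
  then have "X0 * (sin t)\<^sup>2 > 0" "X1 * (sin t)\<^sup>2 > 0" using X0_pos X1_pos by auto
  then have "gg t > 0" "1 - gg t > 0"
    using scaled_poisson_ge_sin[OF X0_pos, of t "- ss"] scaled_poisson_ge_sin[OF X1_pos, of t ss]
    unfolding gg_eq[symmetric] one_minus_gg_eq[symmetric] by linarith+
  then show "0 < gg t" "gg t < 1" by auto
qed

text \<open>With \<open>x = gg t\<close>, the identity
  \<open>1 / (x (1 - x)) = 1 / x + 1 / (1 - x)\<close> splits the weight into these two kernels;
  \<open>k\<close> is the frequency brought in by the polynomials.\<close>

definition "K0 k t = sin (real k * t) * sin t / gg t"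
definition "K1 k t = sin (real k * t) * sin t / (1 - gg t)"

lemma gg_measurable [measurable]: "gg \<in> borel_measurable borel"
  unfolding gg_def[abs_def] by measurable

lemma K_measurable [measurable]: "K0 k \<in> borel_measurable borel" "K1 k \<in> borel_measurable borel"
  unfolding K0_def[abs_def] K1_def[abs_def] by measurable

lemma K_bounds:
  assumes "0 < t" "t < pi"
  shows "\<bar>K0 k t\<bar> \<le> real k / X0" "\<bar>K1 k t\<bar> \<le> real k / X1"
  using scaled_poisson_bound[OF X0_pos assms, of k "- ss"] scaled_poisson_bound[OF X1_pos assms, of k ss]
  unfolding gg_eq[symmetric] one_minus_gg_eq[symmetric] by (simp_all only: K0_def K1_def)

lemma K_integrable: "integrable angle_measure (K0 k)" "integrable angle_measure (K1 k)"
  by (rule angle_integrable_bounded[OF _ K_bounds(1)], auto) (rule angle_integrable_bounded[OF _ K_bounds(2)], auto)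

lemma K_integral:
  assumes "k \<ge> 1"
  shows "integral\<^sup>L angle_measure (K0 k) = pi / 2 * (- ss / X0) ^ (k - 1) / X0"
    "integral\<^sup>L angle_measure (K1 k) = pi / 2 * (ss / X1) ^ (k - 1) / X1"
  using angle_integral_scaled_poisson[OF X0_pos _ assms, of "- ss"]
    angle_integral_scaled_poisson[OF X1_pos _ assms, of ss] abs_ss_le
  unfolding K0_def[abs_def] K1_def[abs_def] gg_eq[symmetric] one_minus_gg_eq[symmetric] by auto

lemma wt_eq:
  assumes "0 < t" "t < pi"
  shows "wt t = 2 * dd / pi * (K0 1 t + K1 1 t)"
  using gg_bounds[OF assms] by (simp add: wt_def K0_def K1_def field_simps power2_eq_square)

text \<open>In the angle the recursion reads \<open>u_{k+2} = 2 ss cos t u_{k+1} - ss^2 u_k\<close>.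
  Its solutions are \<open>ss ^ k\<close> times Chebyshev polynomials of the second kind, which the
  factor \<open>sin t\<close> turns into sines. The coefficients are the initial values
  \<open>q_1\<close> and \<open>q_0 = 1\<close>.\<close>

lemma compressed_poly_gg:
  "compressed_poly a b (Suc k) (gg t) * sin t
     = ss ^ k * ((1 - a) * (gg t - b) * sin (real (Suc k) * t) - ss * sin (real k * t))"
proof (induction k rule: induct_nat_012)
  case 0
  then show ?case by simp
next
  case 1
  have "gg t - ctr = 2 * ss * cos t" by (simp add: gg_def)
  then have "compressed_poly a b (Suc 1) (gg t) = 2 * ss * cos t * ((1 - a) * (gg t - b)) - ss\<^sup>2"
    by (simp add: ss_sq dd_def ctr_def)
  moreover have "sin (real (Suc 1) * t) = 2 * sin t * cos t" using sin_double[of t] by simp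
  ultimately have "compressed_poly a b (Suc 1) (gg t) * sin t
      = (2 * ss * cos t * ((1 - a) * (gg t - b)) - ss\<^sup>2) * sin t" by simp
  also have "\<dots> = ss ^ 1 * ((1 - a) * (gg t - b) * (2 * sin t * cos t) - ss * sin (real 1 * t))"
    by (simp add: algebra_simps power2_eq_square)
  finally show ?case using \<open>sin (real (Suc 1) * t) = 2 * sin t * cos t\<close> by (simp only: One_nat_def)
next
  case (ge2 k)
  define q1 where "q1 = (1 - a) * (gg t - b)"
  have g: "gg t - ctr = 2 * ss * cos t" by (simp add: gg_def)
  have tr: "sin (real (Suc (Suc m)) * t) = 2 * cos t * sin (real (Suc m) * t) - sin (real m * t)" for m
  proof -
    have "real (Suc (Suc m)) * t = real (Suc m) * t + t" "real m * t = real (Suc m) * t - t"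
      by (auto simp: algebra_simps)
    then show ?thesis by (simp only: sin_add sin_diff) simp
  qed
  have "compressed_poly a b (Suc (Suc (Suc k))) (gg t) * sin t
      = (gg t - ctr) * (compressed_poly a b (Suc (Suc k)) (gg t) * sin t)
        - dd * (compressed_poly a b (Suc k) (gg t) * sin t)"
    by (simp add: ctr_def dd_def algebra_simps)
  also have "\<dots> = 2 * ss * cos t * (ss ^ Suc k * (q1 * sin (real (Suc (Suc k)) * t) - ss * sin (real (Suc k) * t)))
      - ss\<^sup>2 * (ss ^ k * (q1 * sin (real (Suc k) * t) - ss * sin (real k * t)))"
    unfolding ge2 g ss_sq q1_def ..
  also have "\<dots> = ss ^ Suc (Suc k) * (q1 * (2 * cos t * sin (real (Suc (Suc k)) * t) - sin (real (Suc k) * t))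
      - ss * (2 * cos t * sin (real (Suc k) * t) - sin (real k * t)))"
    by (simp add: algebra_simps power2_eq_square del: of_nat_Suc)
  also have "\<dots> = ss ^ Suc (Suc k) * (q1 * sin (real (Suc (Suc (Suc k))) * t) - ss * sin (real (Suc (Suc k)) * t))"
    unfolding tr[of "Suc k"] tr[of k] ..
  finally show ?case unfolding q1_def .
qed

lemma compressed_poly_wt:
  assumes "0 < t" "t < pi"
  shows "compressed_poly a b (Suc k) (gg t) * wt t = 2 * dd / pi * ss ^ k *
    ((1 - a) * (1 - b) * K1 (Suc k) t - (1 - a) * b * K0 (Suc k) t - ss * K0 k t - ss * K1 k t)"
proof -
  have g: "gg t \<noteq> 0" "1 - gg t \<noteq> 0" using gg_bounds[OF assms] by auto
  define S1 where "S1 = sin (real (Suc k) * t)"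
  define S0 where "S0 = sin (real k * t)"
  have "compressed_poly a b (Suc k) (gg t) * wt t
      = 2 * dd / pi * ((compressed_poly a b (Suc k) (gg t) * sin t) * sin t / (gg t * (1 - gg t)))"
    by (simp add: wt_def power2_eq_square mult_ac)
  also have "\<dots> = 2 * dd / pi * (ss ^ k * (((1 - a) * (gg t - b) * S1 - ss * S0) * sin t / (gg t * (1 - gg t))))"
    unfolding compressed_poly_gg S1_def S0_def by simp
  \<comment> \<open>Partial fractions:
    \<open>(x - b) / (x (1 - x)) = (1 - b) / (1 - x) - b / x\<close> for the part with
    \<open>S1\<close>, and \<open>1 / x + 1 / (1 - x)\<close> for the part with
    \<open>S0\<close>.\<close>
  also have "((1 - a) * (gg t - b) * S1 - ss * S0) * sin t / (gg t * (1 - gg t))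
     = (1 - a) * (1 - b) * (S1 * sin t / (1 - gg t)) - (1 - a) * b * (S1 * sin t / gg t)
       - ss * (S0 * sin t / gg t) - ss * (S0 * sin t / (1 - gg t))"
    using g by (simp add: divide_simps) (simp add: algebra_simps)
  finally show ?thesis by (simp add: K0_def K1_def S1_def S0_def del: of_nat_Suc)
qed

lemma wt_integral: "integral\<^sup>L angle_measure wt = Y0 + Y1"
proof -
  have "integral\<^sup>L angle_measure wt = (\<integral>t. 2 * dd / pi * (K0 1 t + K1 1 t) \<partial>angle_measure)"
    by (rule Bochner_Integration.integral_cong) (auto simp: space_restrict_space wt_eq)
  also have "\<dots> = dd / X0 + dd / X1"
    using K_integral[of 1] K_integrable[of 1] by (simp add: field_simps)
  finally show ?thesis using X0_pos X1_pos by (simp add: X0Y0[symmetric]) (simp add: X0Y0 X1Y1[symmetric])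
qed

lemma wt_integrable: "integrable angle_measure wt"
proof -
  have "integrable angle_measure (\<lambda>t. 2 * dd / pi * (K0 1 t + K1 1 t))"
    using K_integrable[of 1] by simp
  then show ?thesis
    by (rule Bochner_Integration.integrable_cong[THEN iffD1, rotated -1]) (auto simp: space_restrict_space wt_eq)
qed

text \<open>The factor \<open>ss ^ k\<close> combines with the Poisson values through
  \<open>ss * (- ss / X0) = - Y0\<close> and \<open>ss * (ss / X1) = Y1\<close>.\<close>

lemma compressed_poly_wt_integral:
  "(\<integral>t. compressed_poly a b (Suc k) (gg t) * wt t \<partial>angle_measure)
     = (- Y0) ^ k * (dd - (1 - a) * b * Y0) + Y1 ^ k * ((1 - a) * (1 - b) * Y1 - dd)"
proof -
  have "(\<integral>t. compressed_poly a b (Suc k) (gg t) * wt t \<partial>angle_measure)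
    = (\<integral>t. 2 * dd / pi * ss ^ k * ((1 - a) * (1 - b) * K1 (Suc k) t - (1 - a) * b * K0 (Suc k) t
       - ss * K0 k t - ss * K1 k t) \<partial>angle_measure)"
    by (rule Bochner_Integration.integral_cong) (auto simp: space_restrict_space compressed_poly_wt)
  also have "\<dots> = 2 * dd / pi * ss ^ k * ((1 - a) * (1 - b) * integral\<^sup>L angle_measure (K1 (Suc k))
      - (1 - a) * b * integral\<^sup>L angle_measure (K0 (Suc k))
      - ss * integral\<^sup>L angle_measure (K0 k) - ss * integral\<^sup>L angle_measure (K1 k))"
    using K_integrable by simp
  also have "\<dots> = (- Y0) ^ k * (dd - (1 - a) * b * Y0) + Y1 ^ k * ((1 - a) * (1 - b) * Y1 - dd)"
  proof (cases k)
    case 0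
    \<comment> \<open>The kernels of frequency 0 vanish, outside the range of
      \<open>K_integral\<close>; on the right the two \<open>dd\<close> cancel accordingly.\<close>
    have z: "K0 0 = (\<lambda>_. 0)" "K1 0 = (\<lambda>_. 0)" by (auto simp: K0_def K1_def)
    have "dd / X0 = Y0" "dd / X1 = Y1"
      using X0_pos X1_pos X0Y0 X1Y1 by (auto simp: field_simps)
    moreover have "2 * dd / pi * (A * (pi / (2 * X1)) - B * (pi / (2 * X0))) = A * (dd / X1) - B * (dd / X0)" for A B
      using X0_pos X1_pos by (simp add: field_simps)
    ultimately show ?thesis
      using K_integral[of 1] by (simp add: 0 z)
  next
    case (Suc m)
    have y: "Y0 = dd / X0" "Y1 = dd / X1"
      using X0_pos X1_pos X0Y0 X1Y1 by (auto simp: field_simps)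
    have p0: "ss ^ j * (- ss / X0) ^ j = (- Y0) ^ j" for j
      unfolding power_mult_distrib[symmetric] by (simp add: y ss_sq[symmetric] power2_eq_square)
    have p1: "ss ^ j * (ss / X1) ^ j = Y1 ^ j" for j
      unfolding power_mult_distrib[symmetric] by (simp add: y ss_sq[symmetric] power2_eq_square)
    have "2 * dd / pi * ss ^ k * ((1 - a) * (1 - b) * integral\<^sup>L angle_measure (K1 (Suc k))
      - (1 - a) * b * integral\<^sup>L angle_measure (K0 (Suc k))
      - ss * integral\<^sup>L angle_measure (K0 k) - ss * integral\<^sup>L angle_measure (K1 k))
      = (1 - a) * (1 - b) * (ss ^ k * (ss / X1) ^ k) * (dd / X1) - (1 - a) * b * (ss ^ k * (- ss / X0) ^ k) * (dd / X0)
        - ss\<^sup>2 * (ss ^ m * (- ss / X0) ^ m) * (dd / X0) - ss\<^sup>2 * (ss ^ m * (ss / X1) ^ m) * (dd / X1)"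
    proof -
      have alg: "2 * dd / pi * S * (A * (pi / 2 * P1 / X1) - B * (pi / 2 * P0 / X0)
          - ss * (pi / 2 * u0 / X0) - ss * (pi / 2 * u1 / X1))
        = A * (S * P1) * (dd / X1) - B * (S * P0) * (dd / X0)
          - S * ss * u0 * (dd / X0) - S * ss * u1 * (dd / X1)" for S A B P0 P1 u0 u1
        using X0_pos X1_pos by (simp add: right_diff_distrib mult_ac)
      have k1: "k \<ge> 1" "Suc k \<ge> 1" using Suc by auto
      show ?thesis
        unfolding K_integral[OF k1(1)] K_integral[OF k1(2)] alg
        by (simp add: Suc power2_eq_square mult_ac)
    qed
    also have "\<dots> = (- Y0) ^ k * (dd - (1 - a) * b * Y0) + Y1 ^ k * ((1 - a) * (1 - b) * Y1 - dd)"
      unfolding p0 p1 y(1)[symmetric] y(2)[symmetric] ss_sq by (simp add: Suc algebra_simps)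
    finally show ?thesis .
  qed
  finally show ?thesis .
qed

section \<open>Change of variables from the density to the angle\<close>

lemma manova_r_eq: "manova_rminus a b = gg 0" "manova_rplus a b = gg pi"
proof -
  have e: "sqrt (a * (1 - b)) * sqrt (b * (1 - a)) = sqrt dd"
    by (simp add: dd_def real_sqrt_mult[symmetric] mult_ac)
  show "manova_rminus a b = gg 0"
    using a b e by (simp add: manova_rminus_def power2_diff gg_def ss_def ctr_def) (simp add: algebra_simps)
  show "manova_rplus a b = gg pi"
    using a b e by (simp add: manova_rplus_def power2_sum gg_def ss_def ctr_def) (simp add: algebra_simps)
qed

definition "dens x = sqrt ((gg pi - x) * (x - gg 0)) / (2 * pi * x * (1 - x))"

text \<open>The square root and the Jacobian both equal \<open>- 2 * ss * sin t\<close>, so their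
  product is free of roots.\<close>

lemma dens_gg:
  assumes "0 < t" "t < pi"
  shows "dens (gg t) * (- 2 * ss * sin t) = wt t"
proof -
  have s: "sin t > 0" using assms by (simp add: sin_gt_zero)
  have "(gg pi - gg t) * (gg t - gg 0) = (2 * ss)\<^sup>2 * (1 - (cos t)\<^sup>2)"
    by (simp add: gg_def power2_eq_square algebra_simps)
  also have "\<dots> = (- 2 * ss * sin t)\<^sup>2" by (simp add: sin_squared_eq power_mult_distrib)
  finally have "sqrt ((gg pi - gg t) * (gg t - gg 0)) = - 2 * ss * sin t"
    using s dd_pos by (simp add: ss_def abs_mult)
  then have "dens (gg t) * (- 2 * ss * sin t) = (- 2 * ss * sin t)\<^sup>2 / (2 * pi * gg t * (1 - gg t))"
    by (simp add: dens_def power2_eq_square)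
  also have "(- 2 * ss * sin t)\<^sup>2 = 4 * dd * (sin t)\<^sup>2" by (simp add: power_mult_distrib ss_sq)
  finally show ?thesis by (simp add: wt_def)
qed

lemma gg_tendsto:
  "((ereal \<circ> gg \<circ> real_of_ereal) \<longlongrightarrow> ereal (gg 0)) (at_right (ereal 0))"
  "((ereal \<circ> gg \<circ> real_of_ereal) \<longlongrightarrow> ereal (gg pi)) (at_left (ereal pi))"
  unfolding ereal_tendsto_simps gg_def[abs_def] by (auto intro!: tendsto_eq_intros)

lemma gg_deriv: "DERIV gg t :> - 2 * ss * sin t"
  unfolding gg_def[abs_def] by (auto intro!: derivative_eq_intros)

text \<open>The minus sign in \<open>ss\<close> makes \<open>gg\<close> increasing, as the
  substitution rule requires.\<close>

lemma gg_range:
  assumes "0 < t" "t < pi"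
  shows "gg 0 < gg t" "gg t < gg pi"
proof -
  have "cos t < 1" "cos t > - 1"
    using assms cos_monotone_0_pi[of 0 t] cos_monotone_0_pi[of t pi] by auto
  moreover have "ss < 0" using dd_pos by (simp add: ss_def)
  ultimately have "ss * 1 < ss * cos t" "ss * cos t < ss * (- 1)"
    by (simp_all only: mult_strict_left_mono_neg)
  then show "gg 0 < gg t" "gg t < gg pi" by (simp_all add: gg_def mult.commute)
qed

lemma dens_isCont:
  assumes "0 < t" "t < pi"
  shows "isCont dens (gg t)"
  unfolding dens_def[abs_def] using gg_bounds[OF assms] by (intro continuous_intros) auto

lemma angle_set_integrable_iff:
  fixes f :: "real \<Rightarrow> real"
  shows "set_integrable lborel (einterval (ereal 0) (ereal pi)) f \<longleftrightarrow> integrable angle_measure f"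
  by (simp add: set_integrable_def integrable_restrict_space einterval_iff einterval_eq)

text \<open>The density is unbounded near 0 for \<open>a = b\<close> and near 1 for
  \<open>a + b = 1\<close>, so integrability is carried over from \<open>wt\<close>, where it
  follows from the kernel bounds. Multiples of \<open>dens\<close> then dominate
  \<open>f * dens\<close>.\<close>

lemma dens_integrable: "set_integrable lborel (einterval (gg 0) (gg pi)) dens"
proof (rule interval_integral_substitution_nonneg(1)[where a="ereal 0" and b="ereal pi" and g=gg
      and g'="\<lambda>t. - 2 * ss * sin t"])
  show "0 \<le> dens (gg t)" if "ereal 0 < ereal t" "ereal t < ereal pi" for t
    using gg_range[of t] gg_bounds[of t] that by (simp add: dens_def)
  show "0 \<le> - 2 * ss * sin t" if "ereal 0 \<le> ereal t" "ereal t \<le> ereal pi" for t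
    using that dd_pos by (simp add: ss_def sin_ge_zero)
  have "integrable angle_measure (\<lambda>t. dens (gg t) * (- 2 * ss * sin t))"
    using wt_integrable
    by (rule Bochner_Integration.integrable_cong[THEN iffD1, rotated -1])
       (auto simp: space_restrict_space dens_gg[symmetric])
  then show "set_integrable lborel (einterval (ereal 0) (ereal pi)) (\<lambda>t. dens (gg t) * (- 2 * ss * sin t))"
    by (simp only: angle_set_integrable_iff)
qed (use gg_tendsto gg_deriv dens_isCont in \<open>simp_all add: continuous_intros\<close>)

lemma gg_in_unit:
  "t \<in> {0..pi} \<Longrightarrow> gg t \<in> {gg 0..gg pi}" "0 \<le> gg 0" "gg pi \<le> 1"
proof -
  show "0 \<le> gg 0" "gg pi \<le> 1"
    using scaled_poisson_ge_sin[OF X0_pos, of 0 "- ss"] scaled_poisson_ge_sin[OF X1_pos, of pi ss]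
    unfolding gg_eq[symmetric] one_minus_gg_eq[symmetric] by auto
  show "gg t \<in> {gg 0..gg pi}" if "t \<in> {0..pi}"
    using that gg_range[of t] gg_range[of "pi / 2"] by (cases "t = 0"; cases "t = pi") auto
qed

lemma bounded_wt_integrable:
  assumes f: "continuous_on UNIV f"
  shows "integrable angle_measure (\<lambda>t. f (gg t) * wt t)"
proof -
  obtain C where "\<forall>x\<in>{0..1}. \<bar>f x\<bar> \<le> C"
    using compact_imp_bounded[OF compact_continuous_image[OF continuous_on_subset[OF f] compact_Icc[of 0 1]]]
    by (auto simp: bounded_iff)
  then have C: "\<bar>f x\<bar> \<le> C" if "x \<in> {0..1}" for x using that by blast
  have [measurable]: "f \<in> borel_measurable borel" using f by (rule borel_measurable_continuous_onI)
  have [measurable]: "(\<lambda>t. f (gg t)) \<in> borel_measurable angle_measure"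
    by (rule measurable_restrict_space1) simp
  show ?thesis
  proof (rule Bochner_Integration.integrable_bound[of _ "\<lambda>t. C * wt t"])
    show "integrable angle_measure (\<lambda>t. C * wt t)" using wt_integrable by simp
    show "(\<lambda>t. f (gg t) * wt t) \<in> borel_measurable angle_measure"
      using wt_integrable by measurable
    have "\<bar>f (gg t)\<bar> \<le> \<bar>C\<bar>" if "0 < t" "t < pi" for t
      using C[of "gg t"] gg_bounds[OF that] by auto
    then show "AE t in angle_measure. norm (f (gg t) * wt t) \<le> norm (C * wt t)"
      by (intro AE_I2) (auto simp: space_restrict_space abs_mult intro!: mult_right_mono)
  qed
qed

lemma manova_integral_angle:
  assumes f: "continuous_on UNIV f"
  shows "manova_integral a b f
    = (\<integral>t. f (gg t) * wt t \<partial>angle_measure) + (1 - min a b) * f 0 + max (a + b - 1) 0 * f 1"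
proof -
  have [measurable]: "f \<in> borel_measurable borel" using f by (rule borel_measurable_continuous_onI)
  obtain C where "\<forall>x\<in>{0..1}. \<bar>f x\<bar> \<le> C"
    using compact_imp_bounded[OF compact_continuous_image[OF continuous_on_subset[OF f] compact_Icc[of 0 1]]]
    by (auto simp: bounded_iff)
  then have C: "\<bar>f x\<bar> \<le> C" if "x \<in> {0..1}" for x using that by blast
  have int2: "set_integrable lborel (einterval (gg 0) (gg pi)) (\<lambda>x. f x * dens x)"
  proof (rule set_integrable_bound[of _ _ "\<lambda>x. C * dens x"])
    show "set_integrable lborel (einterval (gg 0) (gg pi)) (\<lambda>x. C * dens x)"
      using dens_integrable by simp
    show "set_borel_measurable lborel (einterval (gg 0) (gg pi)) (\<lambda>x. f x * dens x)"
      unfolding set_borel_measurable_def dens_def by measurable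
    show "AE x in lborel. x \<in> einterval (gg 0) (gg pi) \<longrightarrow> norm (f x * dens x) \<le> norm (C * dens x)"
    proof (intro AE_I2 impI)
      fix x assume "x \<in> einterval (gg 0) (gg pi)"
      then have "x \<in> {0..1}" using gg_in_unit by (auto simp: einterval_iff)
      from C[OF this] show "norm (f x * dens x) \<le> norm (C * dens x)"
        by (auto simp: abs_mult intro!: mult_right_mono)
    qed
  qed
  have eq: "- 2 * ss * sin t * (f (gg t) * dens (gg t)) = f (gg t) * wt t" if "0 < t" "t < pi" for t
    using dens_gg[OF that] by (simp add: mult_ac)
  have int1: "integrable angle_measure (\<lambda>t. - 2 * ss * sin t * (f (gg t) * dens (gg t)))"
    using bounded_wt_integrable[OF f]
    by (rule Bochner_Integration.integrable_cong[THEN iffD1, rotated -1])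
       (auto simp only: space_restrict_space eq space_lborel UNIV_I Int_iff greaterThanLessThan_iff)
  have "(LBINT x=gg 0..gg pi. f x * dens x)
      = (LBINT t=ereal 0..ereal pi. (- 2 * ss * sin t) *\<^sub>R (f (gg t) * dens (gg t)))"
  proof (rule interval_integral_substitution_integrable)
    show "set_integrable lborel (einterval (ereal 0) (ereal pi)) (\<lambda>t. (- 2 * ss * sin t) *\<^sub>R (f (gg t) * dens (gg t)))"
      using int1 unfolding angle_set_integrable_iff by simp
    show "0 \<le> - 2 * ss * sin t" if "ereal 0 \<le> ereal t" "ereal t \<le> ereal pi" for t
      using that dd_pos by (simp add: ss_def sin_ge_zero)
    show "isCont (\<lambda>x. f x * dens x) (gg t)" if "ereal 0 < ereal t" "ereal t < ereal pi" for t
      using that f by (intro continuous_intros dens_isCont) (auto simp: continuous_on_eq_continuous_at)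
  qed (use gg_tendsto gg_deriv int2 in \<open>simp_all add: continuous_intros\<close>)
  also have "\<dots> = (\<integral>t. (- 2 * ss * sin t) *\<^sub>R (f (gg t) * dens (gg t)) \<partial>angle_measure)"
    by (simp only: angle_integral_eq_interval_integral zero_ereal_def)
  also have "\<dots> = (\<integral>t. f (gg t) * wt t \<partial>angle_measure)"
    by (rule Bochner_Integration.integral_cong) (use eq in \<open>auto simp: space_restrict_space\<close>)
  finally show ?thesis
    by (simp add: manova_integral_def manova_r_eq dens_def)
qed

section \<open>The law evaluated on the compressed polynomials\<close>

lemma compressed_poly_continuous: "continuous_on S (compressed_poly a b k)"
proof (induction k rule: induct_nat_012)
  case 0
  have "compressed_poly a b 0 = (\<lambda>_. 1)" by auto
  then show ?case by simp
next
  case 1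
  have "compressed_poly a b (Suc 0) = (\<lambda>x. (1 - a) * (x - b))" by auto
  then show ?case by (simp add: continuous_intros)
next
  case (ge2 k)
  have "compressed_poly a b (Suc (Suc k)) = (\<lambda>x. (x - (a + b - 2 * a * b)) * compressed_poly a b (Suc k) x
     - a * b * (1 - a) * (1 - b) * compressed_poly a b k x)" by auto
  then show ?case using ge2 by (simp only:) (intro continuous_intros)
qed

text \<open>At \<open>x = 0\<close> the recursion has the characteristic roots
  \<open>- (1 - a) * b\<close> and \<open>- a * (1 - b)\<close>, at \<open>x = 1\<close> the roots
  \<open>(1 - a) * (1 - b)\<close> and \<open>a * b\<close>. The value of \<open>q_1\<close> is
  itself a root, so the sequence is geometric.\<close>

lemma compressed_poly_at_0_1:
  "compressed_poly a b k 0 = (- ((1 - a) * b)) ^ k \<and> compressed_poly a b k 1 = ((1 - a) * (1 - b)) ^ k"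
proof (induction k rule: induct_nat_012)
  case (ge2 k)
  define u v where "u = - ((1 - a) * b)" and "v = (1 - a) * (1 - b)"
  have "u * u = (0 - (a + b - 2 * a * b)) * u - a * b * (1 - a) * (1 - b)"
    "v * v = (1 - (a + b - 2 * a * b)) * v - a * b * (1 - a) * (1 - b)"
    by (simp_all add: u_def v_def algebra_simps)
  then have "u ^ Suc (Suc k) = (0 - (a + b - 2 * a * b)) * u ^ Suc k - a * b * (1 - a) * (1 - b) * u ^ k"
    "v ^ Suc (Suc k) = (1 - (a + b - 2 * a * b)) * v ^ Suc k - a * b * (1 - a) * (1 - b) * v ^ k"
    by (simp_all add: mult.assoc[symmetric] left_diff_distrib)
  then show ?case
    using ge2 unfolding compressed_poly.simps u_def v_def by (simp only:)
qed auto

lemma wt_mass: "(\<integral>t. wt t \<partial>angle_measure) + (1 - min a b) + max (a + b - 1) 0 = 1"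
proof -
  have "a * (1 - b) = a - a * b" "b * (1 - a) = b - a * b" "(1 - a) * (1 - b) = 1 - a - b + a * b"
    by (simp_all add: algebra_simps)
  then show ?thesis unfolding wt_integral Y0_def Y1_def by (simp add: min_def max_def)
qed

lemma manova_one: "manova_integral a b (\<lambda>_. 1) = 1"
  using wt_mass by (simp add: manova_integral_angle)

text \<open>The absolutely continuous part yields \<open>min a b - a\<close> times the value at 0,
  which corrects the atom \<open>1 - min a b\<close> to \<open>1 - a\<close>, and the negative of
  the contribution of the atom at 1. The case distinctions decide which argument of
  \<open>Y0\<close> and \<open>Y1\<close> is the minimum.\<close>

lemma manova_compressed_poly:
  "manova_integral a b (compressed_poly a b (Suc k)) = (1 - a) * compressed_poly a b (Suc k) 0"
proof -
  have 0: "(- Y0) ^ k * (dd - (1 - a) * b * Y0) = (min a b - a) * (- ((1 - a) * b)) ^ Suc k"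
  proof (cases "a \<le> b")
    case True
    then have "a * (1 - b) \<le> b * (1 - a)" by (simp add: algebra_simps)
    then show ?thesis using True by (simp add: Y0_def dd_def min_def)
  next
    case False
    then have "\<not> a * (1 - b) \<le> b * (1 - a)" by (simp add: algebra_simps)
    then have Y: "Y0 = (1 - a) * b" by (simp add: Y0_def min_def)
    have d: "dd - (1 - a) * b * ((1 - a) * b) = (1 - a) * b * (a - b)" by (simp add: dd_def algebra_simps)
    show ?thesis unfolding Y d using False by (simp add: min_def algebra_simps)
  qed
  have 1: "Y1 ^ k * ((1 - a) * (1 - b) * Y1 - dd) = - max (a + b - 1) 0 * ((1 - a) * (1 - b)) ^ Suc k"
  proof (cases "a + b \<le> 1")
    case True
    then have "a * b \<le> (1 - a) * (1 - b)" by (simp add: algebra_simps)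
    then show ?thesis using True by (simp add: Y1_def dd_def min_def max_def)
  next
    case False
    then have "\<not> a * b \<le> (1 - a) * (1 - b)" by (simp add: algebra_simps)
    then have Y: "Y1 = (1 - a) * (1 - b)" by (simp add: Y1_def min_def)
    have d: "(1 - a) * (1 - b) * ((1 - a) * (1 - b)) - dd = (1 - a) * (1 - b) * (1 - a - b)"
      by (simp add: dd_def algebra_simps)
    show ?thesis unfolding Y d using False by (simp add: max_def algebra_simps)
  qed
  show ?thesis
    unfolding manova_integral_angle[OF compressed_poly_continuous] compressed_poly_wt_integral 0 1
      compressed_poly_at_0_1[THEN conjunct1] compressed_poly_at_0_1[THEN conjunct2]
    by (simp add: algebra_simps)
qed

lemma manova_linear:
  assumes f: "continuous_on UNIV f" and g: "continuous_on UNIV g"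
  shows "manova_integral a b (\<lambda>x. u * f x + v * g x) = u * manova_integral a b f + v * manova_integral a b g"
proof -
  have "continuous_on UNIV (\<lambda>x. u * f x + v * g x)" using f g by (intro continuous_intros)
  then show ?thesis
    using bounded_wt_integrable[OF f] bounded_wt_integrable[OF g] f g
    by (simp add: manova_integral_angle distrib_right mult.assoc) (simp add: algebra_simps)
qed

text \<open>\<open>wt\<close> is nonnegative and has total mass 1 together with the atoms, so the
  functional is a mean over the unit interval.\<close>

lemma manova_bound:
  assumes f: "continuous_on UNIV f" and \<delta>: "\<And>x. x \<in> {0..1} \<Longrightarrow> \<bar>f x\<bar> \<le> \<delta>"
  shows "\<bar>manova_integral a b f\<bar> \<le> \<delta>"
proof -
  have w: "wt t \<ge> 0" if "0 < t" "t < pi" for t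
    using gg_bounds[OF that] dd_pos by (simp add: wt_def)
  have "\<bar>\<integral>t. f (gg t) * wt t \<partial>angle_measure\<bar> \<le> (\<integral>t. \<bar>f (gg t) * wt t\<bar> \<partial>angle_measure)"
    by (rule integral_abs_bound)
  also have "\<dots> \<le> (\<integral>t. \<delta> * wt t \<partial>angle_measure)"
  proof (rule integral_mono)
    fix t assume "t \<in> space angle_measure"
    then have t: "0 < t" "t < pi" by (auto simp: space_restrict_space)
    show "\<bar>f (gg t) * wt t\<bar> \<le> \<delta> * wt t"
      using \<delta>[of "gg t"] gg_bounds[OF t] w[OF t] by (auto simp: abs_mult intro!: mult_right_mono)
  qed (use bounded_wt_integrable[OF f] wt_integrable in auto)
  finally have 1: "\<bar>\<integral>t. f (gg t) * wt t \<partial>angle_measure\<bar> \<le> \<delta> * integral\<^sup>L angle_measure wt" by simp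
  have 2: "\<bar>(1 - min a b) * f 0\<bar> \<le> \<delta> * (1 - min a b)"
    using \<delta>[of 0] a b by (auto simp: abs_mult mult.commute intro!: mult_right_mono)
  have 3: "\<bar>max (a + b - 1) 0 * f 1\<bar> \<le> \<delta> * max (a + b - 1) 0"
    using \<delta>[of 1] by (auto simp: abs_mult mult.commute intro!: mult_right_mono)
  have "\<bar>manova_integral a b f\<bar> \<le> \<delta> * integral\<^sup>L angle_measure wt + \<delta> * (1 - min a b) + \<delta> * max (a + b - 1) 0"
    unfolding manova_integral_angle[OF f] using 1 2 3 by linarith
  also have "\<dots> = \<delta> * (integral\<^sup>L angle_measure wt + (1 - min a b) + max (a + b - 1) 0)" by (simp add: algebra_simps)
  finally show ?thesis by (simp add: wt_mass)
qed

end

section \<open>Second moments of traces of products with an independent diagonal matrix\<close>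

definition index_lists :: "nat \<Rightarrow> nat \<Rightarrow> nat list set" where
  "index_lists n k = {xs. set xs \<subseteq> {..<n} \<and> length xs = k}"

lemma finite_index_lists: "finite (index_lists n k)"
  unfolding index_lists_def by (rule finite_lists_length_eq) simp

lemma card_index_lists: "card (index_lists n k) = n ^ k"
  unfolding index_lists_def by (subst card_lists_length_eq) auto

lemma index_lists_0: "index_lists n 0 = {[]}"
  by (auto simp: index_lists_def)

lemma sum_index_lists_Suc:
  "(\<Sum>xs\<in>index_lists n (Suc k). f xs) = (\<Sum>x<n. \<Sum>xs\<in>index_lists n k. f (x # xs))"
proof -
  have "index_lists n (Suc k) = (\<lambda>(x, xs). x # xs) ` ({..<n} \<times> index_lists n k)"
    by (auto simp: index_lists_def length_Suc_conv image_iff)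
  then have "(\<Sum>xs\<in>index_lists n (Suc k). f xs) = (\<Sum>(x, xs)\<in>{..<n} \<times> index_lists n k. f (x # xs))"
    by (simp add: sum.reindex inj_on_def case_prod_beta)
  then show ?thesis by (simp add: sum.cartesian_product)
qed

text \<open>The list holds the vertices of a walk after its start \<open>i\<close>. Entries of the
  form \<open>p i j * q j\<close> charge \<open>q\<close> at each arrival, so the product of the
  \<open>q\<close> depends on the list alone.\<close>

lemma pow_mat_index_eq_sum_walks:
  fixes X :: "'a::comm_semiring_1 mat"
  assumes X: "X \<in> carrier_mat n n" and e: "\<And>i j. i < n \<Longrightarrow> j < n \<Longrightarrow> X $$ (i, j) = p i j * q j"
    and ij: "i < n" "j < n"
  shows "(X ^\<^sub>m k) $$ (i, j) = (\<Sum>xs\<in>index_lists n k. if last (i # xs) = j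
     then (\<Prod>(x, y)\<leftarrow>zip (i # xs) xs. p x y) * (\<Prod>x\<leftarrow>xs. q x) else 0)"
  using ij(1)
proof (induction k arbitrary: i)
  case 0
  then show ?case using X ij by (simp add: index_lists_0)
next
  case (Suc k)
  have "(X ^\<^sub>m Suc k) $$ (i, j) = (X * X ^\<^sub>m k) $$ (i, j)"
    using pow_mat_commute[OF X, of k] by simp
  also have "\<dots> = (\<Sum>x<n. X $$ (i, x) * (X ^\<^sub>m k) $$ (x, j))"
    using X Suc.prems ij by (simp add: scalar_prod_def lessThan_atLeast0)
  also have "\<dots> = (\<Sum>x<n. \<Sum>xs\<in>index_lists n k. p i x * q x * (if last (x # xs) = j
     then (\<Prod>(x, y)\<leftarrow>zip (x # xs) xs. p x y) * (\<Prod>x\<leftarrow>xs. q x) else 0))"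
    using Suc by (simp add: e sum_distrib_left)
  also have "\<dots> = (\<Sum>x<n. \<Sum>xs\<in>index_lists n k. if last (i # x # xs) = j
     then (\<Prod>(x, y)\<leftarrow>zip (i # x # xs) (x # xs). p x y) * (\<Prod>x\<leftarrow>x # xs. q x) else 0)"
    by (intro sum.cong refl) (simp add: mult_ac)
  finally show ?case unfolding sum_index_lists_Suc .
qed

text \<open>A closed walk starts where it ends, so its list determines the start as
  \<open>last xs\<close>.\<close>

lemma mtrace_pow_eq_sum_cycles:
  fixes X :: "'a::comm_semiring_1 mat"
  assumes X: "X \<in> carrier_mat n n" and e: "\<And>i j. i < n \<Longrightarrow> j < n \<Longrightarrow> X $$ (i, j) = p i j * q j"
    and k: "k \<ge> 1"
  shows "mtrace (X ^\<^sub>m k) = (\<Sum>xs\<in>index_lists n k. (\<Prod>(x, y)\<leftarrow>zip (last xs # xs) xs. p x y) * (\<Prod>x\<leftarrow>xs. q x))"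
proof -
  have "mtrace (X ^\<^sub>m k) = (\<Sum>i<n. \<Sum>xs\<in>index_lists n k. if last (i # xs) = i
     then (\<Prod>(x, y)\<leftarrow>zip (i # xs) xs. p x y) * (\<Prod>x\<leftarrow>xs. q x) else 0)"
    using X by (simp add: mtrace_def pow_mat_index_eq_sum_walks[OF X e])
  also have "\<dots> = (\<Sum>xs\<in>index_lists n k. \<Sum>i<n. if last (i # xs) = i
     then (\<Prod>(x, y)\<leftarrow>zip (i # xs) xs. p x y) * (\<Prod>x\<leftarrow>xs. q x) else 0)"
    by (rule sum.swap)
  also have "\<dots> = (\<Sum>xs\<in>index_lists n k. (\<Prod>(x, y)\<leftarrow>zip (last xs # xs) xs. p x y) * (\<Prod>x\<leftarrow>xs. q x))"
  proof (rule sum.cong[OF refl])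
    fix xs assume xs: "xs \<in> index_lists n k"
    then have ne: "xs \<noteq> []" using k by (auto simp: index_lists_def)
    have l: "last xs < n" using xs last_in_set[OF ne] by (auto simp: index_lists_def)
    have "(\<Sum>i<n. if last (i # xs) = i then (\<Prod>(x, y)\<leftarrow>zip (i # xs) xs. p x y) * (\<Prod>x\<leftarrow>xs. q x) else 0)
      = (\<Sum>i<n. if i = last xs then (\<Prod>(x, y)\<leftarrow>zip (last xs # xs) xs. p x y) * (\<Prod>x\<leftarrow>xs. q x) else 0)"
      using ne by (intro sum.cong) auto
    then show "(\<Sum>i<n. if last (i # xs) = i then (\<Prod>(x, y)\<leftarrow>zip (i # xs) xs. p x y) * (\<Prod>x\<leftarrow>xs. q x) else 0)
      = (\<Prod>(x, y)\<leftarrow>zip (last xs # xs) xs. p x y) * (\<Prod>x\<leftarrow>xs. q x)"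
      using l by simp
  qed
  finally show ?thesis .
qed

section \<open>Counting index lists and bounding products along them\<close>

lemma prod_list_map_eq_prod_count_list:
  fixes g :: "'b \<Rightarrow> 'a::comm_semiring_1"
  shows "(\<Prod>e\<leftarrow>es. g e) = (\<Prod>z\<in>set es. g z ^ count_list es z)"
proof -
  have "(\<Prod>e\<leftarrow>es. g e) = (\<Prod>z\<in>S. g z ^ count_list es z)"
    if "finite S" "set es \<subseteq> S" for S
    using that(2)
  proof (induction es)
    case (Cons e es)
    have "(\<Prod>z\<in>S. g z ^ count_list (e # es) z) = (\<Prod>z\<in>S. (if z = e then g z else 1) * g z ^ count_list es z)"
      by (rule prod.cong) auto
    also have "\<dots> = g e * (\<Prod>z\<in>S. g z ^ count_list es z)"
      using Cons that(1) by (simp add: prod.distrib)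
    finally show ?case using Cons by simp
  qed simp
  then show ?thesis by simp
qed

text \<open>Every value occurs at least twice, so at most \<open>k\<close> values occur. Such a list
  is a table of \<open>k\<close> values read through one of at most \<open>k ^ (2 * k)\<close>
  patterns.\<close>

lemma card_index_lists_no_singletons:
  "card {zs \<in> index_lists n (2 * k). \<forall>z\<in>set zs. count_list zs z \<noteq> 1} \<le> k ^ (2 * k) * n ^ k"
proof -
  let ?Z = "{zs \<in> index_lists n (2 * k). \<forall>z\<in>set zs. count_list zs z \<noteq> 1}"
  let ?F = "\<lambda>(gs, ys). map (\<lambda>g. ys ! g) gs :: nat list"
  have "?Z \<subseteq> ?F ` (index_lists k (2 * k) \<times> index_lists n k)"
  proof
    fix zs assume zs: "zs \<in> ?Z"
    have c2: "count_list zs z \<ge> 2" if "z \<in> set zs" for z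
    proof -
      have "count_list zs z \<noteq> 0" "count_list zs z \<noteq> 1" using that zs by (auto simp: count_list_0_iff)
      then show ?thesis by linarith
    qed
    have "2 * card (set zs) \<le> (\<Sum>z\<in>set zs. count_list zs z)"
      using sum_mono[of "set zs" "\<lambda>_. 2" "count_list zs"] c2 by simp
    also have "\<dots> = length zs" by (rule sum_count_set) auto
    finally have ck: "card (set zs) \<le> k" using zs by (simp add: index_lists_def)
    obtain ds where ds: "set ds = set zs" "distinct ds" using finite_distinct_list[of "set zs"] by auto
    have ld: "length ds \<le> k" using ck distinct_card[OF ds(2)] ds(1) by simp
    \<comment> \<open>Padding to length exactly \<open>k\<close>; \<open>hd zs\<close> merely serves
      as some entry within range.\<close>
    define ys where "ys = ds @ replicate (k - length ds) (hd zs)"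
    have ys: "ys \<in> index_lists n k"
    proof (cases "k = 0")
      case True
      then show ?thesis using ld by (simp add: ys_def index_lists_def)
    next
      case False
      then have "zs \<noteq> []" using zs by (auto simp: index_lists_def)
      then have "hd zs \<in> set zs" by simp
      moreover have "set ys \<subseteq> insert (hd zs) (set ds)" by (auto simp: ys_def)
      ultimately have "set ys \<subseteq> set zs" unfolding ds(1) by blast
      moreover have "set zs \<subseteq> {..<n}" using zs by (auto simp: index_lists_def)
      moreover have "length ys = k" using ld by (simp add: ys_def)
      ultimately show ?thesis unfolding index_lists_def by blast
    qed
    have "\<forall>z\<in>set zs. \<exists>g. g < k \<and> ys ! g = z"
    proof
      fix z assume "z \<in> set zs"
      then have "z \<in> set ds" unfolding ds(1) .
      then obtain g where "g < length ds" "ds ! g = z" by (auto simp: in_set_conv_nth)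
      then show "\<exists>g. g < k \<and> ys ! g = z" using ld by (intro exI[of _ g]) (auto simp: ys_def nth_append)
    qed
    from bchoice[OF this] obtain \<phi> where \<phi>: "\<forall>z\<in>set zs. \<phi> z < k \<and> ys ! \<phi> z = z" ..
    have "zs = ?F (map \<phi> zs, ys)" using \<phi> by (simp add: map_idI)
    moreover have "map \<phi> zs \<in> index_lists k (2 * k)" using \<phi> zs by (auto simp: index_lists_def)
    ultimately show "zs \<in> ?F ` (index_lists k (2 * k) \<times> index_lists n k)" using ys by blast
  qed
  then have "card ?Z \<le> card (?F ` (index_lists k (2 * k) \<times> index_lists n k))"
    by (intro card_mono finite_imageI finite_cartesian_product finite_index_lists)
  also have "\<dots> \<le> card (index_lists k (2 * k) \<times> index_lists n k)"
    by (intro card_image_le finite_cartesian_product finite_index_lists)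
  also have "\<dots> = k ^ (2 * k) * n ^ k" by (simp add: card_cartesian_product card_index_lists)
  finally show ?thesis .
qed

lemma prod_list_le_power:
  fixes rs :: "real list"
  assumes "\<And>r. r \<in> set rs \<Longrightarrow> 0 \<le> r \<and> r \<le> m"
  shows "0 \<le> prod_list rs \<and> prod_list rs \<le> m ^ length rs"
  using assms
proof (induction rs)
  case (Cons r rs)
  then have "0 \<le> prod_list rs" "prod_list rs \<le> m ^ length rs" "0 \<le> r" "r \<le> m" by auto
  then show ?case by (auto intro!: mult_mono)
qed simp

text \<open>A crude form of the inequality of arithmetic and geometric means, through the largest
  factor. It reduces joint moments of the entries to moments of single entries.\<close>

lemma prod_list_le_sum_powers:
  fixes rs :: "real list"
  assumes nn: "\<And>r. r \<in> set rs \<Longrightarrow> 0 \<le> r" and ne: "rs \<noteq> []"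
  shows "prod_list rs \<le> (\<Sum>r\<leftarrow>rs. r ^ length rs)"
proof -
  have m: "Max (set rs) \<in> set rs" using ne by (intro Max_in) auto
  have "prod_list rs \<le> Max (set rs) ^ length rs" using nn by (intro prod_list_le_power[THEN conjunct2]) auto
  also have "\<dots> \<le> (\<Sum>r\<leftarrow>rs. r ^ length rs)"
    using m nn by (intro member_le_sum_list) auto
  finally show ?thesis .
qed

lemma norm_prod_list:
  fixes xs :: "'a::{real_normed_div_algebra} list"
  shows "norm (prod_list xs) = prod_list (map norm xs)"
  by (induction xs) (auto simp: norm_mult)

lemma borel_measurable_cnj:
  "f \<in> borel_measurable N \<Longrightarrow> (\<lambda>x. cnj (f x)) \<in> borel_measurable N"
  by (rule measurable_compose[OF _ borel_measurable_continuous_onI]) (auto intro!: continuous_intros)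

lemma borel_measurable_prod_list:
  fixes f :: "'i \<Rightarrow> 'b \<Rightarrow> 'c::{real_normed_algebra_1, second_countable_topology}"
  assumes "\<And>z. z \<in> set zs \<Longrightarrow> f z \<in> borel_measurable N"
  shows "(\<lambda>u. \<Prod>z\<leftarrow>zs. f z u) \<in> borel_measurable N"
  using assms by (induction zs) (auto intro!: borel_measurable_times)

context prob_space
begin

text \<open>Grouping equal indices makes the factors independent; an index of multiplicity one
  contributes its mean, which is 0.\<close>

lemma expectation_prod_list_singleton:
  fixes B :: "nat \<Rightarrow> 'a \<Rightarrow> real"
  assumes ind: "indep_vars (\<lambda>_. borel) B {..<n}"
    and bd: "\<And>j. j < n \<Longrightarrow> AE \<omega> in M. \<bar>B j \<omega>\<bar> \<le> 1"
    and mean: "\<And>j. j < n \<Longrightarrow> expectation (B j) = 0"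
    and zs: "set zs \<subseteq> {..<n}"
  shows "\<bar>expectation (\<lambda>\<omega>. \<Prod>z\<leftarrow>zs. B z \<omega>)\<bar> \<le> (if \<exists>z\<in>set zs. count_list zs z = 1 then 0 else 1)"
proof -
  have meas: "B j \<in> borel_measurable M" if "j < n" for j
    using ind that by (auto simp: indep_vars_def)
  let ?Y = "\<lambda>z \<omega>. B z \<omega> ^ count_list zs z"
  have bdp: "AE \<omega> in M. \<bar>?Y z \<omega>\<bar> \<le> 1" if "z \<in> set zs" for z
  proof -
    have "z < n" using that zs by auto
    from bd[OF this] show ?thesis by eventually_elim (simp add: power_abs power_le_one)
  qed
  have int: "integrable M (?Y z)" if "z \<in> set zs" for z
    using bdp[OF that] meas that zs by (intro integrable_const_bound[where B=1]) auto
  have "indep_vars (\<lambda>_. borel) ?Y (set zs)"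
    by (rule indep_vars_compose2[OF indep_vars_subset[OF ind zs]]) auto
  then have e: "expectation (\<lambda>\<omega>. \<Prod>z\<leftarrow>zs. B z \<omega>) = (\<Prod>z\<in>set zs. expectation (?Y z))"
    unfolding prod_list_map_eq_prod_count_list
    by (intro indep_vars_lebesgue_integral int) auto
  have le: "\<bar>expectation (?Y z)\<bar> \<le> 1" if "z \<in> set zs" for z
  proof -
    have "\<bar>expectation (?Y z)\<bar> \<le> expectation (\<lambda>\<omega>. \<bar>?Y z \<omega>\<bar>)" by (rule integral_abs_bound)
    also have "\<dots> \<le> expectation (\<lambda>_. 1)"
      using int[OF that] bdp[OF that] by (intro integral_mono_AE) auto
    finally show ?thesis by (simp add: prob_space)
  qed
  show ?thesis
  proof (cases "\<exists>z\<in>set zs. count_list zs z = 1")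
    case True
    then obtain z where "z \<in> set zs" "count_list zs z = 1" by blast
    then have "expectation (?Y z) = 0" using mean[of z] zs by auto
    then have "(\<Prod>z\<in>set zs. expectation (?Y z)) = 0" using \<open>z \<in> set zs\<close> by auto
    then show ?thesis using True e by simp
  next
    case False
    have "\<bar>\<Prod>z\<in>set zs. expectation (?Y z)\<bar> \<le> 1"
      unfolding abs_prod using le by (intro prod_le_1) auto
    then show ?thesis using False e by simp
  qed
qed

text \<open>Converts independence of families of preimages into independence of functions. A
  preimage under the composite is one under \<open>U\<close> or \<open>W\<close>, and stability
  under intersection extends independence to the generated sigma-algebras.\<close>

lemma indep_var_of_indep_set_preimages:
  fixes f :: "'u \<Rightarrow> 'c::topological_space" and g :: "'v \<Rightarrow> 'c"
  assumes U: "U \<in> measurable M S" and W: "W \<in> measurable M T"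
    and ind: "indep_set {U -` A \<inter> space M | A. A \<in> sets S} {W -` B \<inter> space M | B. B \<in> sets T}"
    and f: "f \<in> borel_measurable S" and g: "g \<in> borel_measurable T"
  shows "indep_var borel (\<lambda>\<omega>. f (U \<omega>)) borel (\<lambda>\<omega>. g (W \<omega>))"
proof -
  have pre: "\<exists>B. (\<lambda>\<omega>. h (X \<omega>)) -` A \<inter> space M = X -` B \<inter> space M \<and> B \<in> sets R"
    if X: "X \<in> measurable M R" and h: "h \<in> borel_measurable R" and A: "A \<in> sets borel"
    for X :: "'a \<Rightarrow> 'd" and R and h :: "'d \<Rightarrow> 'c" and A
    using measurable_space[OF X] measurable_sets[OF h A] by (intro exI[of _ "h -` A \<inter> space R"]) auto
  have st: "Int_stable {(\<lambda>\<omega>. h (X \<omega>)) -` A \<inter> space M | A. A \<in> sets (borel :: 'c measure)}"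
    for X :: "'a \<Rightarrow> 'd" and h :: "'d \<Rightarrow> 'c"
  proof (rule Int_stableI)
    fix a b assume "a \<in> {(\<lambda>\<omega>. h (X \<omega>)) -` A \<inter> space M | A. A \<in> sets (borel :: 'c measure)}"
      "b \<in> {(\<lambda>\<omega>. h (X \<omega>)) -` A \<inter> space M | A. A \<in> sets (borel :: 'c measure)}"
    then obtain A B where "a = (\<lambda>\<omega>. h (X \<omega>)) -` A \<inter> space M" "b = (\<lambda>\<omega>. h (X \<omega>)) -` B \<inter> space M"
      "A \<in> sets (borel :: 'c measure)" "B \<in> sets (borel :: 'c measure)" by blast
    then show "a \<inter> b \<in> {(\<lambda>\<omega>. h (X \<omega>)) -` A \<inter> space M | A. A \<in> sets (borel :: 'c measure)}"
      by (intro CollectI exI[of _ "A \<inter> B"]) auto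
  qed
  have "indep_set {(\<lambda>\<omega>. f (U \<omega>)) -` A \<inter> space M | A. A \<in> sets borel}
      {(\<lambda>\<omega>. g (W \<omega>)) -` B \<inter> space M | B. B \<in> sets borel}"
    unfolding indep_sets2_eq
  proof (intro conjI ballI)
    have 1: "{(\<lambda>\<omega>. f (U \<omega>)) -` A \<inter> space M | A. A \<in> sets borel} \<subseteq> {U -` A \<inter> space M | A. A \<in> sets S}"
      using pre[OF U f] by blast
    have 2: "{(\<lambda>\<omega>. g (W \<omega>)) -` B \<inter> space M | B. B \<in> sets borel} \<subseteq> {W -` B \<inter> space M | B. B \<in> sets T}"
      using pre[OF W g] by blast
    note ind' = ind[unfolded indep_sets2_eq]
    show "{(\<lambda>\<omega>. f (U \<omega>)) -` A \<inter> space M | A. A \<in> sets borel} \<subseteq> events"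
      by (rule order_trans[OF 1 conjunct1[OF ind']])
    show "{(\<lambda>\<omega>. g (W \<omega>)) -` B \<inter> space M | B. B \<in> sets borel} \<subseteq> events"
      by (rule order_trans[OF 2 conjunct1[OF conjunct2[OF ind']]])
    fix a b assume "a \<in> {(\<lambda>\<omega>. f (U \<omega>)) -` A \<inter> space M | A. A \<in> sets borel}"
      "b \<in> {(\<lambda>\<omega>. g (W \<omega>)) -` B \<inter> space M | B. B \<in> sets borel}"
    then show "prob (a \<inter> b) = prob a * prob b"
      using bspec[OF bspec[OF conjunct2[OF conjunct2[OF ind']] subsetD[OF 1]] subsetD[OF 2]] by simp
  qed
  from indep_set_sigma_sets[OF this st[of f U] st[of g W]] show ?thesis
    unfolding indep_var_eq using measurable_compose[OF U f] measurable_compose[OF W g] by blast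
qed

text \<open>Expanding the square gives a sum over index lists of length \<open>2k\<close>. Centering kills every list with an index
  that occurs only once, which leaves only \<open>O(n\<^sup>k)\<close> lists.\<close>

lemma second_moment_cycle_sum:
  fixes pp :: "'u \<Rightarrow> nat \<Rightarrow> nat \<Rightarrow> complex" and bb :: "'v \<Rightarrow> nat \<Rightarrow> real"
  assumes U [measurable]: "U \<in> measurable M S" and W [measurable]: "W \<in> measurable M T"
    and ind: "\<And>f g. f \<in> borel_measurable S \<Longrightarrow> g \<in> borel_measurable T \<Longrightarrow>
      indep_var borel (\<lambda>\<omega>. f (U \<omega>) :: complex) borel (\<lambda>\<omega>. g (W \<omega>))"
    and k: "k \<ge> 1"
    and pm: "\<And>i j. i < n \<Longrightarrow> j < n \<Longrightarrow> (\<lambda>u. pp u i j) \<in> borel_measurable S"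
    and bm: "\<And>j. j < n \<Longrightarrow> (\<lambda>w. bb w j) \<in> borel_measurable T"
    and indB: "indep_vars (\<lambda>_. borel) (\<lambda>j \<omega>. bb (W \<omega>) j) {..<n}"
    and bd: "\<And>j. j < n \<Longrightarrow> AE \<omega> in M. \<bar>bb (W \<omega>) j\<bar> \<le> 1"
    and mean: "\<And>j. j < n \<Longrightarrow> expectation (\<lambda>\<omega>. bb (W \<omega>) j) = 0"
    and pbd: "\<And>i j. i < n \<Longrightarrow> j < n \<Longrightarrow> AE \<omega> in M. cmod (pp (U \<omega>) i j) \<le> K"
    and mom: "\<And>i j. i < n \<Longrightarrow> j < n \<Longrightarrow> expectation (\<lambda>\<omega>. cmod (pp (U \<omega>) i j) ^ (2 * k)) \<le> \<mu>"
    and \<mu>: "\<mu> \<ge> 0"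
  defines "Z \<equiv> \<lambda>\<omega>. \<Sum>xs\<in>index_lists n k. (\<Prod>(x, y)\<leftarrow>zip (last xs # xs) xs. pp (U \<omega>) x y) *
      (\<Prod>x\<leftarrow>xs. complex_of_real (bb (W \<omega>) x))"
  shows "integrable M (\<lambda>\<omega>. (cmod (Z \<omega>))\<^sup>2)"
    "expectation (\<lambda>\<omega>. (cmod (Z \<omega>))\<^sup>2) \<le> real (k ^ (2 * k) * n ^ k) * (2 * real k * \<mu>)"
proof -
  define pairs where "pairs xs = zip (last xs # xs) xs" for xs :: "nat list"
  define cy where "cy xs u = (\<Prod>z\<leftarrow>pairs xs. pp u (fst z) (snd z))" for xs u
  define br where "br xs w = (\<Prod>x\<leftarrow>xs. bb w x)" for xs w
  let ?L = "index_lists n k"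
  have pr: "x < n \<and> y < n" if "(x, y) \<in> set (pairs xs)" "xs \<in> ?L" for x y xs
  proof -
    have "xs \<noteq> []" using that(2) k by (auto simp: index_lists_def)
    then have "last xs \<in> set xs" by simp
    moreover have "x \<in> set (last xs # xs)" "y \<in> set xs"
      using that(1) unfolding pairs_def by (auto dest: set_zip_leftD set_zip_rightD)
    ultimately show ?thesis using that(2) by (auto simp: index_lists_def)
  qed
  have lp: "length (pairs xs) = k" if "xs \<in> ?L" for xs
    using that by (simp add: pairs_def index_lists_def)
  have Z: "Z \<omega> = (\<Sum>xs\<in>?L. cy xs (U \<omega>) * complex_of_real (br xs (W \<omega>)))" for \<omega>
  proof -
    have "(\<Prod>x\<leftarrow>xs. complex_of_real (bb (W \<omega>) x)) = complex_of_real (br xs (W \<omega>))" for xs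
      by (induction xs) (auto simp: br_def)
    then show ?thesis by (simp add: Z_def cy_def pairs_def case_prod_unfold)
  qed
  have cym: "cy xs \<in> borel_measurable S" if "xs \<in> ?L" for xs
    unfolding cy_def[abs_def] using pr[OF _ that] pm by (intro borel_measurable_prod_list) auto
  have brm: "br zs \<in> borel_measurable T" if "set zs \<subseteq> {..<n}" for zs
    unfolding br_def[abs_def] using that bm by (intro borel_measurable_prod_list) auto
  \<comment> \<open>In the squared modulus the conjugate matters only for the part in
    \<open>U\<close>; the part in \<open>W\<close> is real, and there the two lists simply
    concatenate.\<close>
  define cc where "cc xs ys u = cy xs u * cnj (cy ys u)" for xs ys u
  have ccm: "cc xs ys \<in> borel_measurable S" if "xs \<in> ?L" "ys \<in> ?L" for xs ys
    unfolding cc_def[abs_def] using cym that by (intro borel_measurable_times borel_measurable_cnj) auto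
  have pint: "integrable M (\<lambda>\<omega>. cmod (pp (U \<omega>) i j) ^ (2 * k))" if "i < n" "j < n" for i j
  proof (rule integrable_const_bound[where B="K ^ (2 * k)"])
    show "AE \<omega> in M. norm (cmod (pp (U \<omega>) i j) ^ (2 * k)) \<le> K ^ (2 * k)"
      using pbd[OF that] by eventually_elim (simp add: power_mono)
    show "(\<lambda>\<omega>. cmod (pp (U \<omega>) i j) ^ (2 * k)) \<in> borel_measurable M"
      using measurable_compose[OF U pm[OF that]] by simp
  qed
  have ccle: "cmod (cc xs ys u) \<le> (\<Sum>z\<leftarrow>pairs xs @ pairs ys. cmod (pp u (fst z) (snd z)) ^ (2 * k))"
    if "xs \<in> ?L" "ys \<in> ?L" for xs ys u
  proof -
    let ?rs = "map (\<lambda>z. cmod (pp u (fst z) (snd z))) (pairs xs @ pairs ys)"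
    have "cmod (cc xs ys u) = prod_list ?rs"
      by (simp add: cc_def cy_def norm_mult norm_prod_list comp_def)
    also have "\<dots> \<le> (\<Sum>r\<leftarrow>?rs. r ^ length ?rs)"
      using lp[OF that(1)] k by (intro prod_list_le_sum_powers) auto
    also have "length ?rs = 2 * k" using lp that by simp
    finally show ?thesis by (simp add: comp_def)
  qed
  have sumint: "integrable M (\<lambda>\<omega>. \<Sum>z\<leftarrow>zs. cmod (pp (U \<omega>) (fst z) (snd z)) ^ (2 * k)) \<and>
      expectation (\<lambda>\<omega>. \<Sum>z\<leftarrow>zs. cmod (pp (U \<omega>) (fst z) (snd z)) ^ (2 * k)) \<le> real (length zs) * \<mu>"
    if "\<And>x y. (x, y) \<in> set zs \<Longrightarrow> x < n \<and> y < n" for zs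
    using that
  proof (induction zs)
    case (Cons z zs)
    have z: "fst z < n" "snd z < n" using Cons.prems[of "fst z" "snd z"] by auto
    have IH: "integrable M (\<lambda>\<omega>. \<Sum>z\<leftarrow>zs. cmod (pp (U \<omega>) (fst z) (snd z)) ^ (2 * k))"
      "expectation (\<lambda>\<omega>. \<Sum>z\<leftarrow>zs. cmod (pp (U \<omega>) (fst z) (snd z)) ^ (2 * k)) \<le> real (length zs) * \<mu>"
      using Cons by auto
    show ?case
      using IH pint[OF z] mom[OF z] by (simp add: algebra_simps)
  qed simp
  have ccint: "integrable M (\<lambda>\<omega>. cc xs ys (U \<omega>))" and cce: "cmod (expectation (\<lambda>\<omega>. cc xs ys (U \<omega>))) \<le> 2 * real k * \<mu>"
    if xy: "xs \<in> ?L" "ys \<in> ?L" for xs ys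
  proof -
    have si: "integrable M (\<lambda>\<omega>. \<Sum>z\<leftarrow>pairs xs @ pairs ys. cmod (pp (U \<omega>) (fst z) (snd z)) ^ (2 * k))"
      "expectation (\<lambda>\<omega>. \<Sum>z\<leftarrow>pairs xs @ pairs ys. cmod (pp (U \<omega>) (fst z) (snd z)) ^ (2 * k)) \<le> 2 * real k * \<mu>"
      using sumint[of "pairs xs @ pairs ys"] pr xy lp by auto
    show i: "integrable M (\<lambda>\<omega>. cc xs ys (U \<omega>))"
    proof (rule Bochner_Integration.integrable_bound[OF si(1)])
      show "(\<lambda>\<omega>. cc xs ys (U \<omega>)) \<in> borel_measurable M"
        by (rule measurable_compose[OF U ccm[OF xy]])
      show "AE \<omega> in M. norm (cc xs ys (U \<omega>)) \<le> norm (\<Sum>z\<leftarrow>pairs xs @ pairs ys. cmod (pp (U \<omega>) (fst z) (snd z)) ^ (2 * k))"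
        by (rule AE_I2) (use ccle[OF xy] in \<open>force intro: order_trans[OF _ abs_ge_self]\<close>)
    qed
    have "cmod (expectation (\<lambda>\<omega>. cc xs ys (U \<omega>))) \<le> expectation (\<lambda>\<omega>. cmod (cc xs ys (U \<omega>)))"
      by (rule integral_norm_bound)
    also have "\<dots> \<le> expectation (\<lambda>\<omega>. \<Sum>z\<leftarrow>pairs xs @ pairs ys. cmod (pp (U \<omega>) (fst z) (snd z)) ^ (2 * k))"
      using si(1) i ccle[OF xy] by (intro integral_mono) auto
    finally show "cmod (expectation (\<lambda>\<omega>. cc xs ys (U \<omega>))) \<le> 2 * real k * \<mu>" using si(2) by linarith
  qed
  have brb: "integrable M (\<lambda>\<omega>. complex_of_real (br zs (W \<omega>)))" if zs: "set zs \<subseteq> {..<n}" for zs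
  proof (rule integrable_const_bound[where B=1])
    have "AE \<omega> in M. \<forall>z\<in>set zs. \<bar>bb (W \<omega>) z\<bar> \<le> 1"
      using bd zs by (intro AE_finite_allI) auto
    then show "AE \<omega> in M. norm (complex_of_real (br zs (W \<omega>))) \<le> 1"
    proof eventually_elim
      case (elim \<omega>)
      have "\<bar>br zs (W \<omega>)\<bar> = prod_list (map (\<lambda>z. \<bar>bb (W \<omega>) z\<bar>) zs)"
        using norm_prod_list[of "map (bb (W \<omega>)) zs"] by (simp add: br_def comp_def)
      also have "\<dots> \<le> 1 ^ length (map (\<lambda>z. \<bar>bb (W \<omega>) z\<bar>) zs)"
        using elim by (intro prod_list_le_power[THEN conjunct2]) auto
      finally show ?case by simp
    qed
    show "(\<lambda>\<omega>. complex_of_real (br zs (W \<omega>))) \<in> borel_measurable M"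
      using measurable_compose[OF W brm[OF zs]] by simp
  qed
  have prods: "integrable M (\<lambda>\<omega>. cc xs ys (U \<omega>) * complex_of_real (br (xs @ ys) (W \<omega>)))"
    "expectation (\<lambda>\<omega>. cc xs ys (U \<omega>) * complex_of_real (br (xs @ ys) (W \<omega>)))
       = expectation (\<lambda>\<omega>. cc xs ys (U \<omega>)) * complex_of_real (expectation (\<lambda>\<omega>. br (xs @ ys) (W \<omega>)))"
    if xy: "xs \<in> ?L" "ys \<in> ?L" for xs ys
  proof -
    have sub: "set (xs @ ys) \<subseteq> {..<n}" using xy by (auto simp: index_lists_def)
    have iv: "indep_var borel (\<lambda>\<omega>. cc xs ys (U \<omega>)) borel (\<lambda>\<omega>. complex_of_real (br (xs @ ys) (W \<omega>)))"
      using ind[OF ccm[OF xy], of "\<lambda>w. complex_of_real (br (xs @ ys) w)"] brm[OF sub] by simp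
    show "integrable M (\<lambda>\<omega>. cc xs ys (U \<omega>) * complex_of_real (br (xs @ ys) (W \<omega>)))"
      by (rule indep_var_integrable[OF iv ccint[OF xy] brb[OF sub]])
    show "expectation (\<lambda>\<omega>. cc xs ys (U \<omega>) * complex_of_real (br (xs @ ys) (W \<omega>)))
       = expectation (\<lambda>\<omega>. cc xs ys (U \<omega>)) * complex_of_real (expectation (\<lambda>\<omega>. br (xs @ ys) (W \<omega>)))"
      by (subst indep_var_lebesgue_integral[OF iv ccint[OF xy] brb[OF sub]]) simp
  qed
  have ZZ: "complex_of_real ((cmod (Z \<omega>))\<^sup>2)
      = (\<Sum>xs\<in>?L. \<Sum>ys\<in>?L. cc xs ys (U \<omega>) * complex_of_real (br (xs @ ys) (W \<omega>)))" for \<omega>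
  proof -
    have "complex_of_real ((cmod (Z \<omega>))\<^sup>2) = Z \<omega> * cnj (Z \<omega>)" by (rule complex_norm_square)
    also have "\<dots> = (\<Sum>xs\<in>?L. \<Sum>ys\<in>?L. (cy xs (U \<omega>) * complex_of_real (br xs (W \<omega>)))
        * cnj (cy ys (U \<omega>) * complex_of_real (br ys (W \<omega>))))"
      unfolding Z cnj_sum sum_product ..
    also have "\<dots> = (\<Sum>xs\<in>?L. \<Sum>ys\<in>?L. cc xs ys (U \<omega>) * complex_of_real (br (xs @ ys) (W \<omega>)))"
      by (intro sum.cong refl) (simp add: cc_def br_def mult_ac)
    finally show ?thesis .
  qed
  have Zint: "integrable M (\<lambda>\<omega>. complex_of_real ((cmod (Z \<omega>))\<^sup>2))"
    unfolding ZZ by (intro Bochner_Integration.integrable_sum prods)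
  then show int: "integrable M (\<lambda>\<omega>. (cmod (Z \<omega>))\<^sup>2)"
    using complex_of_real_integrable_eq by blast
  let ?G = "{zs \<in> index_lists n (2 * k). \<forall>z\<in>set zs. count_list zs z \<noteq> 1}"
  have tb: "cmod (expectation (\<lambda>\<omega>. cc xs ys (U \<omega>)) * complex_of_real (expectation (\<lambda>\<omega>. br (xs @ ys) (W \<omega>))))
      \<le> 2 * real k * \<mu> * (if xs @ ys \<in> ?G then 1 else 0)" if xy: "xs \<in> ?L" "ys \<in> ?L" for xs ys
  proof -
    have sub: "set (xs @ ys) \<subseteq> {..<n}" using xy by (auto simp: index_lists_def)
    have "xs @ ys \<in> index_lists n (2 * k)" using xy by (auto simp: index_lists_def)
    then have "\<bar>expectation (\<lambda>\<omega>. br (xs @ ys) (W \<omega>))\<bar> \<le> (if xs @ ys \<in> ?G then 1 else 0)"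
      using expectation_prod_list_singleton[OF indB bd mean sub] unfolding br_def by (auto split: if_splits)
    then show ?thesis
      unfolding norm_mult norm_of_real using cce[OF xy] \<mu> by (intro mult_mono) auto
  qed
  \<comment> \<open>Appending is injective on pairs of lists of fixed length, so the count for lists
    of length \<open>2 * k\<close> applies.\<close>
  have "card {z \<in> ?L \<times> ?L. fst z @ snd z \<in> ?G} \<le> card ?G"
  proof (rule card_inj_on_le[where f="\<lambda>z. fst z @ snd z"])
    show "inj_on (\<lambda>z. fst z @ snd z) {z \<in> ?L \<times> ?L. fst z @ snd z \<in> ?G}"
      by (auto simp: inj_on_def index_lists_def)
  qed (auto simp: finite_index_lists)
  then have cG: "card {z \<in> ?L \<times> ?L. fst z @ snd z \<in> ?G} \<le> k ^ (2 * k) * n ^ k"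
    using card_index_lists_no_singletons[of n k] by linarith
  \<comment> \<open>The expectation is nonnegative, hence its own modulus; in complex form the
    triangle inequality applies to the expanded sum.\<close>
  have "expectation (\<lambda>\<omega>. (cmod (Z \<omega>))\<^sup>2) = cmod (expectation (\<lambda>\<omega>. complex_of_real ((cmod (Z \<omega>))\<^sup>2)))"
    by (simp add: integral_complex_of_real del: of_real_power)
  also have "expectation (\<lambda>\<omega>. complex_of_real ((cmod (Z \<omega>))\<^sup>2)) = (\<Sum>xs\<in>?L. \<Sum>ys\<in>?L.
      expectation (\<lambda>\<omega>. cc xs ys (U \<omega>)) * complex_of_real (expectation (\<lambda>\<omega>. br (xs @ ys) (W \<omega>))))"
    unfolding ZZ using prods by (simp add: Bochner_Integration.integral_sum Bochner_Integration.integrable_sum)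
  also have "cmod \<dots> \<le> (\<Sum>xs\<in>?L. \<Sum>ys\<in>?L. 2 * real k * \<mu> * (if xs @ ys \<in> ?G then 1 else 0))"
    by (intro sum_norm_le tb)
  also have "\<dots> = 2 * real k * \<mu> * (\<Sum>z\<in>?L \<times> ?L. if fst z @ snd z \<in> ?G then 1 else 0)"
    by (simp only: sum_distrib_left sum.cartesian_product case_prod_unfold)
  also have "(\<Sum>z\<in>?L \<times> ?L. if fst z @ snd z \<in> ?G then 1 else 0)
      = real (card {z \<in> ?L \<times> ?L. fst z @ snd z \<in> ?G})"
    by (subst sum.If_cases) (auto simp: finite_index_lists Int_def intro!: arg_cong[where f=card])
  also have "2 * real k * \<mu> * real (card {z \<in> ?L \<times> ?L. fst z @ snd z \<in> ?G})
      \<le> 2 * real k * \<mu> * real (k ^ (2 * k) * n ^ k)"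
    using \<mu> cG by (intro mult_left_mono) (simp_all only: of_nat_le_iff, simp)
  finally show "expectation (\<lambda>\<omega>. (cmod (Z \<omega>))\<^sup>2) \<le> real (k ^ (2 * k) * n ^ k) * (2 * real k * \<mu>)"
    by (simp only: mult.commute)
qed

end

section \<open>Mean square convergence to zero\<close>

text \<open>Stated with the nonnegative integral so that sums and multiples carry no integrability
  conditions.\<close>

definition L2_null :: "(nat \<Rightarrow> 'w measure) \<Rightarrow> (nat \<Rightarrow> 'w \<Rightarrow> complex) \<Rightarrow> bool" where
  "L2_null P F \<longleftrightarrow> (\<forall>\<iota>. F \<iota> \<in> borel_measurable (P \<iota>)) \<and>
     (\<lambda>\<iota>. \<integral>\<^sup>+\<omega>. ennreal ((cmod (F \<iota> \<omega>))\<^sup>2) \<partial>P \<iota>) \<longlonglongrightarrow> 0"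

lemma tendsto_0_ennreal_le:
  fixes f g :: "nat \<Rightarrow> ennreal"
  assumes "g \<longlonglongrightarrow> 0" "\<And>n. f n \<le> g n"
  shows "f \<longlonglongrightarrow> 0"
  by (rule tendsto_sandwich[OF _ _ tendsto_const assms(1)]) (use assms(2) in auto)

lemma L2_null_add:
  assumes F: "L2_null P F" and G: "L2_null P G"
  shows "L2_null P (\<lambda>\<iota> \<omega>. F \<iota> \<omega> + G \<iota> \<omega>)"
proof -
  have m [measurable]: "F \<iota> \<in> borel_measurable (P \<iota>)" "G \<iota> \<in> borel_measurable (P \<iota>)" for \<iota>
    using F G by (auto simp: L2_null_def)
  have le: "(cmod (x + y))\<^sup>2 \<le> 2 * (cmod x)\<^sup>2 + 2 * (cmod y)\<^sup>2" for x y
  proof -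
    have "(cmod (x + y))\<^sup>2 \<le> (cmod x + cmod y)\<^sup>2"
      by (intro power_mono norm_triangle_ineq) auto
    also have "\<dots> \<le> 2 * (cmod x)\<^sup>2 + 2 * (cmod y)\<^sup>2"
      using sum_squares_bound[of "cmod x" "cmod y"] by (simp add: power2_sum)
    finally show ?thesis .
  qed
  have b: "(\<integral>\<^sup>+\<omega>. ennreal ((cmod (F \<iota> \<omega> + G \<iota> \<omega>))\<^sup>2) \<partial>P \<iota>)
      \<le> 2 * (\<integral>\<^sup>+\<omega>. ennreal ((cmod (F \<iota> \<omega>))\<^sup>2) \<partial>P \<iota>) + 2 * (\<integral>\<^sup>+\<omega>. ennreal ((cmod (G \<iota> \<omega>))\<^sup>2) \<partial>P \<iota>)" for \<iota>
  proof -
    have "(\<integral>\<^sup>+\<omega>. ennreal ((cmod (F \<iota> \<omega> + G \<iota> \<omega>))\<^sup>2) \<partial>P \<iota>)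
      \<le> (\<integral>\<^sup>+\<omega>. 2 * ennreal ((cmod (F \<iota> \<omega>))\<^sup>2) + 2 * ennreal ((cmod (G \<iota> \<omega>))\<^sup>2) \<partial>P \<iota>)"
    proof (rule nn_integral_mono)
      fix \<omega>
      have "ennreal ((cmod (F \<iota> \<omega> + G \<iota> \<omega>))\<^sup>2) \<le> ennreal (2 * (cmod (F \<iota> \<omega>))\<^sup>2 + 2 * (cmod (G \<iota> \<omega>))\<^sup>2)"
        by (rule ennreal_leI[OF le])
      also have "\<dots> = 2 * ennreal ((cmod (F \<iota> \<omega>))\<^sup>2) + 2 * ennreal ((cmod (G \<iota> \<omega>))\<^sup>2)"
        by (simp add: ennreal_plus ennreal_mult)
      finally show "ennreal ((cmod (F \<iota> \<omega> + G \<iota> \<omega>))\<^sup>2)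
        \<le> 2 * ennreal ((cmod (F \<iota> \<omega>))\<^sup>2) + 2 * ennreal ((cmod (G \<iota> \<omega>))\<^sup>2)" .
    qed
    also have "\<dots> = 2 * (\<integral>\<^sup>+\<omega>. ennreal ((cmod (F \<iota> \<omega>))\<^sup>2) \<partial>P \<iota>) + 2 * (\<integral>\<^sup>+\<omega>. ennreal ((cmod (G \<iota> \<omega>))\<^sup>2) \<partial>P \<iota>)"
      by (subst nn_integral_add) (auto simp: nn_integral_cmult)
    finally show ?thesis .
  qed
  have "(\<lambda>\<iota>. 2 * (\<integral>\<^sup>+\<omega>. ennreal ((cmod (F \<iota> \<omega>))\<^sup>2) \<partial>P \<iota>) + 2 * (\<integral>\<^sup>+\<omega>. ennreal ((cmod (G \<iota> \<omega>))\<^sup>2) \<partial>P \<iota>))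
      \<longlonglongrightarrow> 2 * 0 + 2 * 0"
    using F G by (intro tendsto_add ennreal_tendsto_cmult) (auto simp: L2_null_def)
  then show ?thesis
    unfolding L2_null_def using m tendsto_0_ennreal_le[OF _ b] by auto
qed

lemma L2_null_cmult:
  assumes F: "L2_null P F"
  shows "L2_null P (\<lambda>\<iota> \<omega>. c * F \<iota> \<omega>)"
proof -
  have m [measurable]: "F \<iota> \<in> borel_measurable (P \<iota>)" for \<iota>
    using F by (auto simp: L2_null_def)
  have "(\<integral>\<^sup>+\<omega>. ennreal ((cmod (c * F \<iota> \<omega>))\<^sup>2) \<partial>P \<iota>)
     = ennreal ((cmod c)\<^sup>2) * (\<integral>\<^sup>+\<omega>. ennreal ((cmod (F \<iota> \<omega>))\<^sup>2) \<partial>P \<iota>)" for \<iota>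
    by (subst nn_integral_cmult[symmetric]) (auto simp: norm_mult power_mult_distrib ennreal_mult)
  moreover have "(\<lambda>\<iota>. ennreal ((cmod c)\<^sup>2) * (\<integral>\<^sup>+\<omega>. ennreal ((cmod (F \<iota> \<omega>))\<^sup>2) \<partial>P \<iota>)) \<longlonglongrightarrow> ennreal ((cmod c)\<^sup>2) * 0"
    using F by (intro ennreal_tendsto_cmult) (auto simp: L2_null_def)
  ultimately show ?thesis unfolding L2_null_def using m by auto
qed

text \<open>The algebraic identities hold only almost surely and only once
  \<open>N \<iota> > 0\<close>, hence the two relaxations.\<close>

lemma L2_null_AE_cong:
  assumes F: "L2_null P F" and G: "\<And>\<iota>. G \<iota> \<in> borel_measurable (P \<iota>)"
    and eq: "\<forall>\<^sub>F \<iota> in sequentially. AE \<omega> in P \<iota>. F \<iota> \<omega> = G \<iota> \<omega>"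
  shows "L2_null P G"
proof -
  have "\<forall>\<^sub>F \<iota> in sequentially. (\<integral>\<^sup>+\<omega>. ennreal ((cmod (F \<iota> \<omega>))\<^sup>2) \<partial>P \<iota>) = (\<integral>\<^sup>+\<omega>. ennreal ((cmod (G \<iota> \<omega>))\<^sup>2) \<partial>P \<iota>)"
    using eq
  proof eventually_elim
    case (elim \<iota>)
    then show ?case by (intro nn_integral_cong_AE) auto
  qed
  moreover have "(\<lambda>\<iota>. \<integral>\<^sup>+\<omega>. ennreal ((cmod (F \<iota> \<omega>))\<^sup>2) \<partial>P \<iota>) \<longlonglongrightarrow> 0"
    using F by (simp add: L2_null_def)
  ultimately have "(\<lambda>\<iota>. \<integral>\<^sup>+\<omega>. ennreal ((cmod (G \<iota> \<omega>))\<^sup>2) \<partial>P \<iota>) \<longlonglongrightarrow> 0"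
    by (rule Lim_transform_eventually[rotated])
  then show ?thesis using G by (simp add: L2_null_def)
qed

lemma L2_null_zero: "L2_null P (\<lambda>_ _. 0)"
  by (simp add: L2_null_def)

lemma L2_null_const:
  assumes P: "\<And>\<iota>. prob_space (P \<iota>)" and c: "c \<longlonglongrightarrow> 0"
  shows "L2_null P (\<lambda>\<iota> \<omega>. c \<iota>)"
proof -
  have "(\<integral>\<^sup>+\<omega>. ennreal ((cmod (c \<iota>))\<^sup>2) \<partial>P \<iota>) = ennreal ((cmod (c \<iota>))\<^sup>2)" for \<iota>
    using prob_space.emeasure_space_1[OF P] by simp
  moreover have "(\<lambda>\<iota>. ennreal ((cmod (c \<iota>))\<^sup>2)) \<longlonglongrightarrow> ennreal 0"
    by (intro tendsto_ennrealI) (use c in \<open>auto intro!: tendsto_eq_intros\<close>)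
  ultimately show ?thesis by (simp add: L2_null_def)
qed

lemma L2_null_of_second_moment:
  assumes m: "\<And>\<iota>. F \<iota> \<in> borel_measurable (P \<iota>)"
    and int: "\<And>\<iota>. integrable (P \<iota>) (\<lambda>\<omega>. (cmod (F \<iota> \<omega>))\<^sup>2)"
    and b: "\<forall>\<^sub>F \<iota> in sequentially. (\<integral>\<omega>. (cmod (F \<iota> \<omega>))\<^sup>2 \<partial>P \<iota>) \<le> c \<iota>" and c: "c \<longlonglongrightarrow> 0"
  shows "L2_null P F"
proof -
  have "(\<integral>\<^sup>+\<omega>. ennreal ((cmod (F \<iota> \<omega>))\<^sup>2) \<partial>P \<iota>) = ennreal (\<integral>\<omega>. (cmod (F \<iota> \<omega>))\<^sup>2 \<partial>P \<iota>)" for \<iota>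
    by (rule nn_integral_eq_integral[OF int]) auto
  moreover have "(\<lambda>\<iota>. \<integral>\<omega>. (cmod (F \<iota> \<omega>))\<^sup>2 \<partial>P \<iota>) \<longlonglongrightarrow> 0"
    by (rule tendsto_sandwich[OF _ b tendsto_const c]) auto
  then have "(\<lambda>\<iota>. ennreal (\<integral>\<omega>. (cmod (F \<iota> \<omega>))\<^sup>2 \<partial>P \<iota>)) \<longlonglongrightarrow> ennreal 0"
    by (intro tendsto_ennrealI)
  ultimately show ?thesis using m by (simp add: L2_null_def)
qed

text \<open>Chebyshev's inequality, through the pointwise bound of the indicator by
  \<open>|F|^2 / e^2\<close>.\<close>

lemma L2_null_imp_prob_tendsto_0:
  assumes P: "\<And>\<iota>. prob_space (P \<iota>)" and F: "L2_null P F" and e: "e > 0"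
  shows "(\<lambda>\<iota>. measure (P \<iota>) {\<omega> \<in> space (P \<iota>). cmod (F \<iota> \<omega>) > e}) \<longlonglongrightarrow> 0"
proof -
  have [measurable]: "F \<iota> \<in> borel_measurable (P \<iota>)" for \<iota>
    using F by (auto simp: L2_null_def)
  let ?S = "\<lambda>\<iota>. {\<omega> \<in> space (P \<iota>). cmod (F \<iota> \<omega>) > e}"
  have b: "ennreal (measure (P \<iota>) (?S \<iota>)) \<le> ennreal (1 / e\<^sup>2) * (\<integral>\<^sup>+\<omega>. ennreal ((cmod (F \<iota> \<omega>))\<^sup>2) \<partial>P \<iota>)" for \<iota>
  proof -
    interpret prob_space "P \<iota>" by (rule P)
    have "ennreal (measure (P \<iota>) (?S \<iota>)) = (\<integral>\<^sup>+\<omega>. indicator (?S \<iota>) \<omega> \<partial>P \<iota>)"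
      by (simp add: emeasure_eq_measure)
    also have "\<dots> \<le> (\<integral>\<^sup>+\<omega>. ennreal (1 / e\<^sup>2) * ennreal ((cmod (F \<iota> \<omega>))\<^sup>2) \<partial>P \<iota>)"
    proof (rule nn_integral_mono)
      fix \<omega> assume "\<omega> \<in> space (P \<iota>)"
      show "indicator (?S \<iota>) \<omega> \<le> ennreal (1 / e\<^sup>2) * ennreal ((cmod (F \<iota> \<omega>))\<^sup>2)"
      proof (cases "\<omega> \<in> ?S \<iota>")
        case True
        then have "e\<^sup>2 \<le> (cmod (F \<iota> \<omega>))\<^sup>2" using e by (intro power_mono) auto
        then have "1 \<le> 1 / e\<^sup>2 * (cmod (F \<iota> \<omega>))\<^sup>2" using e by (simp add: field_simps)
        then have "ennreal 1 \<le> ennreal (1 / e\<^sup>2 * (cmod (F \<iota> \<omega>))\<^sup>2)" by (rule ennreal_leI)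
        also have "\<dots> = ennreal (1 / e\<^sup>2) * ennreal ((cmod (F \<iota> \<omega>))\<^sup>2)"
          by (rule ennreal_mult) auto
        finally show ?thesis using True by simp
      qed simp
    qed
    finally show ?thesis by (simp add: nn_integral_cmult)
  qed
  have "(\<lambda>\<iota>. ennreal (1 / e\<^sup>2) * (\<integral>\<^sup>+\<omega>. ennreal ((cmod (F \<iota> \<omega>))\<^sup>2) \<partial>P \<iota>)) \<longlonglongrightarrow> ennreal (1 / e\<^sup>2) * 0"
    using F by (intro ennreal_tendsto_cmult) (auto simp: L2_null_def)
  then have "(\<lambda>\<iota>. ennreal (measure (P \<iota>) (?S \<iota>))) \<longlonglongrightarrow> ennreal 0"
    using tendsto_0_ennreal_le[OF _ b] by simp
  then show ?thesis by (subst (asm) tendsto_ennreal_iff) auto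
qed

section \<open>Polynomial approximation and measurability of spectral integrals\<close>

lemma esd_integral_linear:
  "esd_integral H (\<lambda>x. u * f x + v * g x) = u * esd_integral H f + v * esd_integral H g"
proof -
  have "(\<Sum>z\<in>S. r z * (u * f (Re z) + v * g (Re z))) = u * (\<Sum>z\<in>S. r z * f (Re z)) + v * (\<Sum>z\<in>S. r z * g (Re z))"
    for S and r :: "complex \<Rightarrow> real"
    by (simp add: sum_distrib_left sum.distrib algebra_simps)
  then show ?thesis by (simp add: esd_integral_def add_divide_distrib)
qed

lemma real_polynomial_induct:
  fixes Q :: "(real \<Rightarrow> real) \<Rightarrow> bool"
  assumes pow: "\<And>j. Q (\<lambda>x. x ^ j)"
    and lin: "\<And>u v f g. Q f \<Longrightarrow> Q g \<Longrightarrow> Q (\<lambda>x. u * f x + v * g x)"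
    and p: "real_polynomial_function p"
  shows "Q p"
proof -
  obtain c n where pn: "p = (\<lambda>x. \<Sum>i\<le>n. c i * x ^ i)"
    using p unfolding real_polynomial_function_iff_sum by blast
  have "Q (\<lambda>x. \<Sum>i\<le>n. c i * x ^ i)"
  proof (induction n)
    case 0
    show ?case using lin[OF pow[of 0] pow[of 0], of "c 0" 0] by simp
  next
    case (Suc n)
    show ?case using lin[OF Suc pow[of "Suc n"], of 1 "c (Suc n)"] by simp
  qed
  then show ?thesis by (simp add: pn)
qed

lemma borel_measurable_mat_entries_mult:
  fixes X Y :: "'w \<Rightarrow> complex mat"
  assumes X: "\<And>\<omega>. X \<omega> \<in> carrier_mat n m" and Y: "\<And>\<omega>. Y \<omega> \<in> carrier_mat m l"
    and Xm: "\<And>i j. i < n \<Longrightarrow> j < m \<Longrightarrow> (\<lambda>\<omega>. X \<omega> $$ (i, j)) \<in> borel_measurable R"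
    and Ym: "\<And>i j. i < m \<Longrightarrow> j < l \<Longrightarrow> (\<lambda>\<omega>. Y \<omega> $$ (i, j)) \<in> borel_measurable R"
    and ij: "i < n" "j < l"
  shows "(\<lambda>\<omega>. (X \<omega> * Y \<omega>) $$ (i, j)) \<in> borel_measurable R"
proof -
  have "(X \<omega> * Y \<omega>) $$ (i, j) = (\<Sum>r<m. X \<omega> $$ (i, r) * Y \<omega> $$ (r, j))" for \<omega>
    using X[of \<omega>] Y[of \<omega>] ij by (simp add: scalar_prod_def lessThan_atLeast0)
  then show ?thesis
    using Xm Ym ij by (simp add: borel_measurable_sum borel_measurable_times)
qed

lemma borel_measurable_mat_entries_pow:
  fixes X :: "'w \<Rightarrow> complex mat"
  assumes X: "\<And>\<omega>. X \<omega> \<in> carrier_mat n n"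
    and Xm: "\<And>i j. i < n \<Longrightarrow> j < n \<Longrightarrow> (\<lambda>\<omega>. X \<omega> $$ (i, j)) \<in> borel_measurable R"
    and ij: "i < n" "j < n"
  shows "(\<lambda>\<omega>. (X \<omega> ^\<^sub>m k) $$ (i, j)) \<in> borel_measurable R"
  using ij
proof (induction k arbitrary: i j)
  case 0
  have "(X \<omega> ^\<^sub>m 0) $$ (i, j) = (if i = j then 1 else 0)" for \<omega> using X[of \<omega>] 0 by simp
  then show ?case by simp
next
  case (Suc k)
  have "X \<omega> ^\<^sub>m k \<in> carrier_mat n n" for \<omega> using X[of \<omega>] by simp
  then show ?case
    unfolding pow_mat.simps
    by (rule borel_measurable_mat_entries_mult[OF _ X Suc.IH Xm Suc.prems])
qed

text \<open>The spectrum of one matrix is finite, so approximations on growing intervals eventually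
  reach all of it. The intervals grow because the bound 1 on the spectrum holds only almost surely,
  whereas measurability is needed at all outcomes.\<close>

lemma esd_integral_gram_tendsto:
  assumes E: "E \<in> carrier_mat m n" and p: "\<And>r x. \<bar>x\<bar> \<le> real r \<Longrightarrow> \<bar>f x - p r x\<bar> \<le> 1 / real (Suc r)"
  shows "(\<lambda>r. esd_integral (mat_adjoint E * E) (p r)) \<longlonglongrightarrow> esd_integral (mat_adjoint E * E) f"
proof -
  obtain es :: "real list" where es: "\<forall>f. esd_integral (mat_adjoint E * E) f = (\<Sum>e\<leftarrow>es. f e) / real n"
    using gram_spectrum[OF E] by blast
  have pt: "(\<lambda>r. p r e) \<longlonglongrightarrow> f e" for e
  proof (rule Lim_transform[OF tendsto_const])
    show "(\<lambda>r. p r e - f e) \<longlonglongrightarrow> 0"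
    proof (rule Lim_null_comparison)
      show "\<forall>\<^sub>F r in sequentially. norm (p r e - f e) \<le> 1 / real (Suc r)"
        using eventually_ge_at_top[of "nat \<lceil>\<bar>e\<bar>\<rceil>"] 
      proof eventually_elim
        case (elim r)
        have "\<bar>e\<bar> \<le> real (nat \<lceil>\<bar>e\<bar>\<rceil>)" by (rule real_nat_ceiling_ge)
        also have "\<dots> \<le> real r" using elim by (simp only: of_nat_le_iff)
        finally show ?case using p by (simp add: abs_minus_commute)
      qed
      show "(\<lambda>r. 1 / real (Suc r)) \<longlonglongrightarrow> 0" by (rule LIMSEQ_Suc[OF lim_1_over_n])
    qed
  qed
  have "(\<lambda>r. \<Sum>e\<leftarrow>es. p r e) \<longlonglongrightarrow> (\<Sum>e\<leftarrow>es. f e)"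
    by (induction es) (auto intro!: tendsto_intros pt)
  then show ?thesis unfolding es[rule_format] divide_inverse by (intro tendsto_mult tendsto_const)
qed

section \<open>The random matrix model\<close>

locale manova_model =
  fixes P :: "nat \<Rightarrow> 'w measure"
    and M N :: "nat \<Rightarrow> nat"
    and V :: "nat \<Rightarrow> 'w \<Rightarrow> nat \<Rightarrow> nat \<Rightarrow> complex"
    and A :: "nat \<Rightarrow> 'w \<Rightarrow> nat \<Rightarrow> real"
    and \<alpha> \<beta> :: real
  assumes prob: "\<And>\<iota>. prob_space (P \<iota>)"
    and N_inc: "strict_mono N"
    and ratio: "(\<lambda>\<iota>. real (M \<iota>) / real (N \<iota>)) \<longlonglongrightarrow> \<beta>"
    and beta: "0 < \<beta>" "\<beta> < 1"
    and alpha: "0 < \<alpha>" "\<alpha> < 1"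
    and V_meas: "\<And>\<iota> i j. i < M \<iota> \<Longrightarrow> j < N \<iota> \<Longrightarrow>
                   (\<lambda>\<omega>. V \<iota> \<omega> i j) \<in> borel_measurable (P \<iota>)"
    and V_coisom: "\<And>\<iota>. AE \<omega> in P \<iota>.
        Vmat (M \<iota>) (N \<iota>) (V \<iota> \<omega>) * mat_adjoint (Vmat (M \<iota>) (N \<iota>) (V \<iota> \<omega>)) = 1\<^sub>m (M \<iota>)"
    and moments: "\<exists>C>0. \<forall>k::nat. k \<ge> 1 \<longrightarrow>
        limsup (\<lambda>\<iota>. ereal (real (N \<iota>) powr (real k / 2 - C) *
          Max {(\<integral>\<omega>. cmod (col_inner (M \<iota>) (V \<iota> \<omega>) i j
                        - (if i = j then complex_of_real \<beta> else 0)) ^ k \<partial>P \<iota>)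
               | i j. i < N \<iota> \<and> j < N \<iota>})) = 0"
    and A_meas: "\<And>\<iota> j. j < N \<iota> \<Longrightarrow> (\<lambda>\<omega>. A \<iota> \<omega> j) \<in> borel_measurable (P \<iota>)"
    and A_01: "\<And>\<iota> j. j < N \<iota> \<Longrightarrow> AE \<omega> in P \<iota>. A \<iota> \<omega> j \<in> {0, 1}"
    and A_ber: "\<And>\<iota> j. j < N \<iota> \<Longrightarrow> measure (P \<iota>) {\<omega> \<in> space (P \<iota>). A \<iota> \<omega> j = 1} = \<alpha>"
    and A_indep: "\<And>\<iota>. prob_space.indep_vars (P \<iota>) (\<lambda>_. borel) (\<lambda>j \<omega>. A \<iota> \<omega> j) {..<N \<iota>}"
    and AV_indep: "\<And>\<iota>. prob_space.indep_set (P \<iota>)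
        {(\<lambda>\<omega>. restrict (\<lambda>(i, j). V \<iota> \<omega> i j) ({..<M \<iota>} \<times> {..<N \<iota>})) -` S \<inter> space (P \<iota>)
          | S. S \<in> sets (PiM ({..<M \<iota>} \<times> {..<N \<iota>}) (\<lambda>_. (borel :: complex measure)))}
        {(\<lambda>\<omega>. restrict (A \<iota> \<omega>) {..<N \<iota>}) -` T \<inter> space (P \<iota>)
          | T. T \<in> sets (PiM {..<N \<iota>} (\<lambda>_. (borel :: real measure)))}"
begin

definition "VV \<iota> \<omega> = Vmat (M \<iota>) (N \<iota>) (V \<iota> \<omega>)"
definition "DD \<iota> \<omega> = Dmat (N \<iota>) (A \<iota> \<omega>)"
definition "HH \<iota> \<omega> = mat_adjoint (VV \<iota> \<omega>) * VV \<iota> \<omega>"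
definition "CC \<iota> \<omega> = DD \<iota> \<omega> * mat_adjoint (VV \<iota> \<omega>) * VV \<iota> \<omega> * DD \<iota> \<omega>"
definition "psi \<iota> \<omega> i j = col_inner (M \<iota>) (V \<iota> \<omega>) i j - (if i = j then complex_of_real \<beta> else 0)"
definition "bern \<iota> \<omega> j = A \<iota> \<omega> j - \<alpha>"
definition "cyc k \<iota> \<omega> = (\<Sum>xs\<in>index_lists (N \<iota>) k. (\<Prod>(x, y)\<leftarrow>zip (last xs # xs) xs. psi \<iota> \<omega> x y) *
      (\<Prod>x\<leftarrow>xs. complex_of_real (bern \<iota> \<omega> x)))"

lemma VV_carrier: "VV \<iota> \<omega> \<in> carrier_mat (M \<iota>) (N \<iota>)"
  by (simp add: VV_def Vmat_carrier)

lemma DD_carrier: "DD \<iota> \<omega> \<in> carrier_mat (N \<iota>) (N \<iota>)"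
  by (simp add: DD_def Dmat_carrier)

lemma adj_VV_carrier: "mat_adjoint (VV \<iota> \<omega>) \<in> carrier_mat (N \<iota>) (M \<iota>)"
  by (rule mat_adjoint_carrier[OF VV_carrier])

lemma HH_carrier: "HH \<iota> \<omega> \<in> carrier_mat (N \<iota>) (N \<iota>)"
  using adj_VV_carrier VV_carrier unfolding HH_def by (rule mult_carrier_mat)

lemma HH_index: "i < N \<iota> \<Longrightarrow> j < N \<iota> \<Longrightarrow> HH \<iota> \<omega> $$ (i, j) = col_inner (M \<iota>) (V \<iota> \<omega>) i j"
  using VV_carrier[of \<iota> \<omega>] adj_VV_carrier[of \<iota> \<omega>]
  by (simp add: HH_def scalar_prod_def col_inner_def lessThan_atLeast0 mat_adjoint_index)
     (simp add: VV_def Vmat_def)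

lemma CC_eq_compress: "CC \<iota> \<omega> = DD \<iota> \<omega> * HH \<iota> \<omega> * DD \<iota> \<omega>"
  using VV_carrier[of \<iota> \<omega>] adj_VV_carrier[of \<iota> \<omega>] DD_carrier[of \<iota> \<omega>]
  by (simp add: CC_def HH_def assoc_mult_mat[of _ "N \<iota>" "N \<iota>" _ "M \<iota>" _ "N \<iota>"])

lemma CC_gram: "CC \<iota> \<omega> = mat_adjoint (VV \<iota> \<omega> * DD \<iota> \<omega>) * (VV \<iota> \<omega> * DD \<iota> \<omega>)"
  unfolding CC_def VV_def DD_def by (rule compressed_gram)

lemma VD_carrier: "VV \<iota> \<omega> * DD \<iota> \<omega> \<in> carrier_mat (M \<iota>) (N \<iota>)"
  using VV_carrier DD_carrier by (rule mult_carrier_mat)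

lemma CC_carrier: "CC \<iota> \<omega> \<in> carrier_mat (N \<iota>) (N \<iota>)"
  unfolding CC_gram by (rule mult_carrier_mat[OF mat_adjoint_carrier[OF VD_carrier] VD_carrier])

lemma CC_index_measurable:
  assumes ij: "i < N \<iota>" "j < N \<iota>"
  shows "(\<lambda>\<omega>. CC \<iota> \<omega> $$ (i, j)) \<in> borel_measurable (P \<iota>)"
proof -
  have V: "(\<lambda>\<omega>. VV \<iota> \<omega> $$ (i, j)) \<in> borel_measurable (P \<iota>)" if "i < M \<iota>" "j < N \<iota>" for i j
    using V_meas[OF that] that by (simp add: VV_def Vmat_def)
  have aV: "(\<lambda>\<omega>. mat_adjoint (VV \<iota> \<omega>) $$ (i, j)) \<in> borel_measurable (P \<iota>)" if "i < N \<iota>" "j < M \<iota>" for i j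
  proof -
    have "mat_adjoint (VV \<iota> \<omega>) $$ (i, j) = cnj (VV \<iota> \<omega> $$ (j, i))" for \<omega>
      using VV_carrier[of \<iota> \<omega>] that by (simp add: mat_adjoint_index)
    then show ?thesis using V[OF that(2,1)]
      by (simp add: borel_measurable_cnj)
  qed
  have D: "(\<lambda>\<omega>. DD \<iota> \<omega> $$ (i, j)) \<in> borel_measurable (P \<iota>)" if "i < N \<iota>" "j < N \<iota>" for i j
    using A_meas that by (cases "i = j") (auto simp: DD_def Dmat_def)
  note c = VV_carrier adj_VV_carrier DD_carrier
  note DaV = borel_measurable_mat_entries_mult[OF c(3) c(2) D aV]
  note DaVV = borel_measurable_mat_entries_mult[OF mult_carrier_mat[OF c(3) c(2)] c(1) DaV V]
  show ?thesis
    unfolding CC_def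
    by (rule borel_measurable_mat_entries_mult[OF mult_carrier_mat[OF mult_carrier_mat[OF c(3) c(2)] c(1)] c(3) DaVV D ij])
qed

lemma esd_power: "complex_of_real (esd_integral (CC \<iota> \<omega>) (\<lambda>x. x ^ k)) = mtrace (CC \<iota> \<omega> ^\<^sub>m k) / of_nat (N \<iota>)"
  using gram_spectrum[OF VD_carrier[of \<iota> \<omega>]] unfolding CC_gram[symmetric] by auto

text \<open>Eigenvalues are not visibly measurable in the outcome, but traces of powers are
  polynomials in the entries. This settles polynomial test functions, and continuous ones follow as
  pointwise limits.\<close>

lemma esd_measurable:
  assumes f: "continuous_on UNIV f"
  shows "(\<lambda>\<omega>. esd_integral (CC \<iota> \<omega>) f) \<in> borel_measurable (P \<iota>)"
proof -
  have pow: "(\<lambda>\<omega>. esd_integral (CC \<iota> \<omega>) (\<lambda>x. x ^ k)) \<in> borel_measurable (P \<iota>)" for k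
  proof -
    have "(\<lambda>\<omega>. mtrace (CC \<iota> \<omega> ^\<^sub>m k)) \<in> borel_measurable (P \<iota>)"
    proof -
      have "mtrace (CC \<iota> \<omega> ^\<^sub>m k) = (\<Sum>i<N \<iota>. (CC \<iota> \<omega> ^\<^sub>m k) $$ (i, i))" for \<omega>
        using CC_carrier[of \<iota> \<omega>] by (simp add: mtrace_def)
      then show ?thesis
        using borel_measurable_mat_entries_pow[OF CC_carrier CC_index_measurable]
        by (auto intro!: borel_measurable_sum)
    qed
    moreover have "esd_integral (CC \<iota> \<omega>) (\<lambda>x. x ^ k) = Re (mtrace (CC \<iota> \<omega> ^\<^sub>m k) / of_nat (N \<iota>))" for \<omega>
      using arg_cong[OF esd_power[of \<iota> \<omega> k], of Re] by simp
    ultimately show ?thesis by simp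
  qed
  have poly: "(\<lambda>\<omega>. esd_integral (CC \<iota> \<omega>) p) \<in> borel_measurable (P \<iota>)" if "real_polynomial_function p" for p
    using pow _ that by (rule real_polynomial_induct) (simp add: esd_integral_linear)
  have "\<exists>p. real_polynomial_function p \<and> (\<forall>x. \<bar>x\<bar> \<le> real r \<longrightarrow> \<bar>f x - p x\<bar> \<le> 1 / real (Suc r))" for r
  proof -
    obtain p where "real_polynomial_function p" "\<And>x. x \<in> {- real r..real r} \<Longrightarrow> \<bar>f x - p x\<bar> < 1 / real (Suc r)"
      using Stone_Weierstrass_real_polynomial_function[of "{- real r..real r}" f "1 / real (Suc r)"]
        continuous_on_subset[OF f] by (auto simp del: of_nat_Suc)
    then show ?thesis by (intro exI[of _ p] conjI allI impI less_imp_le) (auto simp: abs_le_iff)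
  qed
  then obtain p where p: "\<And>r. real_polynomial_function (p r)"
    "\<And>r x. \<bar>x\<bar> \<le> real r \<Longrightarrow> \<bar>f x - p r x\<bar> \<le> 1 / real (Suc r)" by metis
  show ?thesis
  proof (rule borel_measurable_LIMSEQ_real)
    show "(\<lambda>\<omega>. esd_integral (CC \<iota> \<omega>) (p r)) \<in> borel_measurable (P \<iota>)" for r by (rule poly[OF p(1)])
    show "(\<lambda>r. esd_integral (CC \<iota> \<omega>) (p r)) \<longlonglongrightarrow> esd_integral (CC \<iota> \<omega>) f" for \<omega>
      unfolding CC_gram by (rule esd_integral_gram_tendsto[OF VD_carrier p(2)])
  qed
qed

text \<open>The almost sure hypotheses made pointwise: on these outcomes the deterministic algebra
  of \<open>projection_pair\<close> applies.\<close>

definition "good \<iota> \<omega> \<longleftrightarrow> VV \<iota> \<omega> * mat_adjoint (VV \<iota> \<omega>) = 1\<^sub>m (M \<iota>) \<and> (\<forall>j<N \<iota>. A \<iota> \<omega> j \<in> {0, 1})"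

lemma AE_good: "AE \<omega> in P \<iota>. good \<iota> \<omega>"
proof -
  have "AE \<omega> in P \<iota>. \<forall>j\<in>{..<N \<iota>}. A \<iota> \<omega> j \<in> {0, 1}"
    using A_01 by (intro AE_finite_allI) auto
  then show ?thesis using V_coisom[of \<iota>] unfolding good_def VV_def by eventually_elim auto
qed

lemma good_projection_pair:
  assumes g: "good \<iota> \<omega>"
  shows "projection_pair (DD \<iota> \<omega>) (HH \<iota> \<omega>) (N \<iota>)"
proof
  show "DD \<iota> \<omega> * DD \<iota> \<omega> = DD \<iota> \<omega>" using g unfolding DD_def good_def by (intro Dmat_idem) auto
  show "HH \<iota> \<omega> * HH \<iota> \<omega> = HH \<iota> \<omega>"
    using g unfolding HH_def good_def by (intro coisometry_gram_idem[OF VV_carrier]) auto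
qed (rule DD_carrier HH_carrier)+

lemma HH_adjoint: "mat_adjoint (HH \<iota> \<omega>) = HH \<iota> \<omega>"
  unfolding HH_def
  by (simp add: mat_adjoint_mult[OF adj_VV_carrier VV_carrier] mat_adjoint_adjoint)

lemma good_trace_HH:
  assumes g: "good \<iota> \<omega>"
  shows "mtrace (HH \<iota> \<omega>) = of_nat (M \<iota>)"
proof -
  have "mtrace (HH \<iota> \<omega>) = mtrace (VV \<iota> \<omega> * mat_adjoint (VV \<iota> \<omega>))"
    unfolding HH_def by (rule mtrace_mult_commute[OF adj_VV_carrier VV_carrier])
  then show ?thesis using g by (simp add: good_def mtrace_one)
qed

lemma good_spectrum:
  assumes g: "good \<iota> \<omega>"
  shows "\<exists>es :: real list. length es = N \<iota> \<and>
    (\<forall>k. mtrace (CC \<iota> \<omega> ^\<^sub>m k) = complex_of_real (\<Sum>e\<leftarrow>es. e ^ k)) \<and>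
    (\<forall>f. esd_integral (CC \<iota> \<omega>) f = (\<Sum>e\<leftarrow>es. f e) / real (N \<iota>)) \<and>
    (\<forall>e\<in>set es. e \<in> {0..1})"
proof -
  interpret projection_pair "DD \<iota> \<omega>" "HH \<iota> \<omega>" "N \<iota>" 0 0 by (rule good_projection_pair[OF g])
  have C: "cC = CC \<iota> \<omega>" by (simp add: cC_def CC_eq_compress)
  have D: "mat_adjoint (DD \<iota> \<omega>) = DD \<iota> \<omega>" by (simp add: DD_def mat_adjoint_Dmat)
  have "e \<le> 1" if "eigenvalue (CC \<iota> \<omega>) (complex_of_real e)" for e
    using cC_eigenvalue_le_1[OF D HH_adjoint] that unfolding C .
  then show ?thesis
    using gram_spectrum[OF VD_carrier[of \<iota> \<omega>]] unfolding CC_gram[symmetric] by auto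
qed

text \<open>The rows of \<open>V\<close> are unit vectors, so its entries are at most 1 in modulus.
  The bound grows with \<open>M \<iota>\<close> and serves only integrability at fixed
  \<iota>.\<close>

lemma good_psi_bound:
  assumes g: "good \<iota> \<omega>" and ij: "i < N \<iota>" "j < N \<iota>"
  shows "cmod (psi \<iota> \<omega> i j) \<le> real (M \<iota>) + 1"
proof -
  have V1: "cmod (V \<iota> \<omega> l j) \<le> 1" if "l < M \<iota>" "j < N \<iota>" for l j
  proof -
    have "(VV \<iota> \<omega> * mat_adjoint (VV \<iota> \<omega>)) $$ (l, l) = (\<Sum>r<N \<iota>. V \<iota> \<omega> l r * cnj (V \<iota> \<omega> l r))"
      using VV_carrier[of \<iota> \<omega>] adj_VV_carrier[of \<iota> \<omega>] that
      by (simp add: scalar_prod_def lessThan_atLeast0 mat_adjoint_index) (simp add: VV_def Vmat_def)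
    also have "\<dots> = complex_of_real (\<Sum>r<N \<iota>. (cmod (V \<iota> \<omega> l r))\<^sup>2)"
      by (simp add: complex_norm_square del: of_real_power)
    finally have "complex_of_real (\<Sum>r<N \<iota>. (cmod (V \<iota> \<omega> l r))\<^sup>2) = complex_of_real 1"
      using g that by (simp add: good_def)
    then have "(\<Sum>r<N \<iota>. (cmod (V \<iota> \<omega> l r))\<^sup>2) = 1" by (simp only: of_real_eq_iff)
    moreover have "(cmod (V \<iota> \<omega> l j))\<^sup>2 \<le> (\<Sum>r<N \<iota>. (cmod (V \<iota> \<omega> l r))\<^sup>2)"
      using that by (intro member_le_sum) auto
    ultimately have "(cmod (V \<iota> \<omega> l j))\<^sup>2 \<le> 1\<^sup>2" by simp
    then show ?thesis by (rule power2_le_imp_le) simp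
  qed
  have "cmod (col_inner (M \<iota>) (V \<iota> \<omega>) i j) \<le> (\<Sum>l<M \<iota>. 1)"
    unfolding col_inner_def using V1 ij by (intro sum_norm_le) (auto simp: norm_mult intro!: mult_le_one)
  moreover have "cmod (if i = j then complex_of_real \<beta> else 0) \<le> 1" using beta by auto
  ultimately show ?thesis
    unfolding psi_def using norm_triangle_ineq4[of "col_inner (M \<iota>) (V \<iota> \<omega>) i j" "if i = j then complex_of_real \<beta> else 0"]
    by simp
qed

section \<open>Moments of the entries of the centered matrices\<close>

lemma psi_measurable:
  assumes "i < N \<iota>" "j < N \<iota>"
  shows "(\<lambda>\<omega>. psi \<iota> \<omega> i j) \<in> borel_measurable (P \<iota>)"
  unfolding psi_def col_inner_def
  using V_meas assms by (intro borel_measurable_diff borel_measurable_sum borel_measurable_times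
      borel_measurable_cnj) auto

lemma AE_psi_bound:
  assumes "i < N \<iota>" "j < N \<iota>"
  shows "AE \<omega> in P \<iota>. cmod (psi \<iota> \<omega> i j) \<le> real (M \<iota>) + 1"
  using AE_good[of \<iota>] by eventually_elim (rule good_psi_bound[OF _ assms])

lemma psi_power_integrable:
  assumes "i < N \<iota>" "j < N \<iota>"
  shows "integrable (P \<iota>) (\<lambda>\<omega>. cmod (psi \<iota> \<omega> i j) ^ k)"
proof -
  interpret prob_space "P \<iota>" by (rule prob)
  show ?thesis
  proof (rule integrable_const_bound[where B="(real (M \<iota>) + 1) ^ k"])
    show "AE \<omega> in P \<iota>. norm (cmod (psi \<iota> \<omega> i j) ^ k) \<le> (real (M \<iota>) + 1) ^ k"
      using AE_psi_bound[OF assms] by eventually_elim (simp add: power_mono)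
  qed (use psi_measurable[OF assms] in simp)
qed

lemma N_ge: "\<iota> \<le> N \<iota>"
  using N_inc by (rule strict_mono_imp_increasing)

lemma N_inverse_tendsto: "(\<lambda>\<iota>. c / real (N \<iota>)) \<longlonglongrightarrow> 0"
proof -
  have "filterlim N at_top sequentially" using N_inc by (rule filterlim_subseq)
  then have "filterlim (\<lambda>\<iota>. real (N \<iota>)) at_top sequentially"
    by (rule filterlim_compose[OF filterlim_real_sequentially])
  then show ?thesis
    by (rule tendsto_divide_0[OF tendsto_const filterlim_at_top_imp_at_infinity])
qed

text \<open>The loss \<open>N powr C\<close> in the hypothesis is removed by trading a moment of order \<open>2k\<close> for one of order
  \<open>2km\<close> with \<open>m \<ge> C\<close>, through \<open>y \<le> T + y\<^sup>m / T\<^bsup>m-1\<^esup>\<close> at \<open>T = N powr (1 - k)\<close>.\<close>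

lemma psi_moment_bound:
  assumes k: "k \<ge> 1"
  shows "\<forall>\<^sub>F \<iota> in sequentially. \<forall>i<N \<iota>. \<forall>j<N \<iota>.
    (\<integral>\<omega>. cmod (psi \<iota> \<omega> i j) ^ (2 * k) \<partial>P \<iota>) \<le> 2 * real (N \<iota>) powr (1 - real k)"
proof -
  obtain C where C: "C > 0" and lim: "\<And>k::nat. k \<ge> 1 \<Longrightarrow>
        limsup (\<lambda>\<iota>. ereal (real (N \<iota>) powr (real k / 2 - C) *
          Max {(\<integral>\<omega>. cmod (psi \<iota> \<omega> i j) ^ k \<partial>P \<iota>) | i j. i < N \<iota> \<and> j < N \<iota>})) = 0"
    using moments unfolding psi_def by blast
  define m where "m = nat \<lceil>C\<rceil>"
  have mC: "C \<le> real m" unfolding m_def by (rule real_nat_ceiling_ge)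
  have m1: "m \<ge> 1" using C mC by (cases m) auto
  \<comment> \<open>From the vanishing limsup only an eventual bound by 1 is extracted.\<close>
  have "limsup (\<lambda>\<iota>. ereal (real (N \<iota>) powr (real (2 * k * m) / 2 - C) *
          Max {(\<integral>\<omega>. cmod (psi \<iota> \<omega> i j) ^ (2 * k * m) \<partial>P \<iota>) | i j. i < N \<iota> \<and> j < N \<iota>})) < 1"
    using lim[of "2 * k * m"] k m1 by simp
  from Limsup_lessD[OF this] eventually_ge_at_top[of 1] show ?thesis
  proof eventually_elim
    case (elim \<iota>)
    have N1: "real (N \<iota>) \<ge> 1" using N_ge[of \<iota>] elim by linarith
    show ?case
    proof (intro allI impI)
      fix i j assume ij: "i < N \<iota>" "j < N \<iota>"
      interpret prob_space "P \<iota>" by (rule prob)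
      let ?n = "real (N \<iota>)"
      define T where "T = ?n powr (1 - real k)"
      have T: "T > 0" using N1 by (simp add: T_def)
      let ?S = "{(\<integral>\<omega>. cmod (psi \<iota> \<omega> i j) ^ (2 * k * m) \<partial>P \<iota>) | i j. i < N \<iota> \<and> j < N \<iota>}"
      have "?S = (\<lambda>(i, j). \<integral>\<omega>. cmod (psi \<iota> \<omega> i j) ^ (2 * k * m) \<partial>P \<iota>) ` ({..<N \<iota>} \<times> {..<N \<iota>})" by auto
      then have "finite ?S" by simp
      then have le: "expectation (\<lambda>\<omega>. cmod (psi \<iota> \<omega> i j) ^ (2 * k * m)) \<le> Max ?S"
        using ij by (intro Max_ge) auto
      have "?n powr (real (2 * k * m) / 2 - C) * Max ?S < 1" using elim by (simp add: one_ereal_def)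
      moreover have "?n powr (real (2 * k * m) / 2 - C) * expectation (\<lambda>\<omega>. cmod (psi \<iota> \<omega> i j) ^ (2 * k * m))
          \<le> ?n powr (real (2 * k * m) / 2 - C) * Max ?S"
        using le by (intro mult_left_mono) auto
      ultimately have "?n powr (real k * real m - C) * expectation (\<lambda>\<omega>. cmod (psi \<iota> \<omega> i j) ^ (2 * k * m)) \<le> 1"
        by simp
      moreover have "?n powr (real k * real m - C) > 0" using N1 by simp
      ultimately have "expectation (\<lambda>\<omega>. cmod (psi \<iota> \<omega> i j) ^ (2 * k * m)) \<le> 1 / ?n powr (real k * real m - C)"
        by (simp add: pos_le_divide_eq mult.commute)
      also have "\<dots> = ?n powr (C - real k * real m)" by (simp add: powr_minus_divide[symmetric])
      finally have E: "expectation (\<lambda>\<omega>. cmod (psi \<iota> \<omega> i j) ^ (2 * k * m)) \<le> ?n powr (C - real k * real m)" .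
      have pt: "y \<le> T + y ^ m / T ^ (m - 1)" if "y \<ge> 0" for y :: real
      proof (cases "y \<le> T")
        case True
        then show ?thesis using that T by (simp add: add_increasing2)
      next
        case False
        have "y * T ^ (m - 1) \<le> y * y ^ (m - 1)" using False T that by (intro mult_left_mono power_mono) auto
        also have "\<dots> = y ^ m" using m1 by (simp add: power_Suc[symmetric] del: power_Suc)
        finally have "y \<le> y ^ m / T ^ (m - 1)" using T by (simp add: pos_le_divide_eq)
        then show ?thesis using T by simp
      qed
      have "expectation (\<lambda>\<omega>. cmod (psi \<iota> \<omega> i j) ^ (2 * k))
          \<le> expectation (\<lambda>\<omega>. T + cmod (psi \<iota> \<omega> i j) ^ (2 * k * m) / T ^ (m - 1))"
      proof (rule integral_mono)
        show "cmod (psi \<iota> \<omega> i j) ^ (2 * k) \<le> T + cmod (psi \<iota> \<omega> i j) ^ (2 * k * m) / T ^ (m - 1)" for \<omega>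
          using pt[of "cmod (psi \<iota> \<omega> i j) ^ (2 * k)"] by (simp add: power_mult)
      qed (use psi_power_integrable[OF ij] in auto)
      also have "\<dots> = T + expectation (\<lambda>\<omega>. cmod (psi \<iota> \<omega> i j) ^ (2 * k * m)) / T ^ (m - 1)"
        using psi_power_integrable[OF ij] by (simp add: prob_space)
      also have "\<dots> \<le> T + ?n powr (C - real k * real m) / T ^ (m - 1)"
        using E T by (intro add_left_mono divide_right_mono) auto
      \<comment> \<open>The exponent adds up to \<open>C - m + 1 - k\<close>, which is at most
        \<open>1 - k\<close> by the choice of \<open>m\<close>.\<close>
      also have "?n powr (C - real k * real m) / T ^ (m - 1) \<le> T"
      proof -
        have "T ^ (m - 1) = ?n powr ((1 - real k) * (real m - 1))"
          using N1 m1 by (simp add: T_def powr_realpow[symmetric] powr_powr of_nat_diff)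
        then have "?n powr (C - real k * real m) / T ^ (m - 1)
            = ?n powr (C - real k * real m - (1 - real k) * (real m - 1))"
          by (simp add: powr_diff)
        also have "\<dots> \<le> T" unfolding T_def
          using N1 mC by (intro powr_mono) (auto simp: algebra_simps)
        finally show ?thesis .
      qed
      finally show "expectation (\<lambda>\<omega>. cmod (psi \<iota> \<omega> i j) ^ (2 * k)) \<le> 2 * ?n powr (1 - real k)"
        by (simp add: T_def)
    qed
  qed
qed

lemma bern_bound:
  assumes "j < N \<iota>"
  shows "AE \<omega> in P \<iota>. \<bar>bern \<iota> \<omega> j\<bar> \<le> 1"
  using A_01[OF assms] by eventually_elim (use alpha in \<open>auto simp: bern_def\<close>)

lemma bern_mean:
  assumes j: "j < N \<iota>"
  shows "(\<integral>\<omega>. bern \<iota> \<omega> j \<partial>P \<iota>) = 0"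
proof -
  interpret prob_space "P \<iota>" by (rule prob)
  note A_meas[OF j, measurable]
  let ?S = "{\<omega> \<in> space (P \<iota>). A \<iota> \<omega> j = 1}"
  have "(\<integral>\<omega>. bern \<iota> \<omega> j \<partial>P \<iota>) = (\<integral>\<omega>. indicator ?S \<omega> - \<alpha> \<partial>P \<iota>)"
  proof (rule integral_cong_AE)
    show "AE \<omega> in P \<iota>. bern \<iota> \<omega> j = indicator ?S \<omega> - \<alpha>"
      using A_01[OF j] by (rule AE_mp) (auto intro!: AE_I2 simp: bern_def indicator_def)
  qed (auto simp: bern_def)
  also have "\<dots> = measure (P \<iota>) ?S - \<alpha>"
    by (subst Bochner_Integration.integral_diff) (auto simp: prob_space emeasure_eq_measure intro!: integrable_real_indicator)
  finally show ?thesis using A_ber[OF j] by simp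
qed

section \<open>The two matrices as independent random variables\<close>

definition "Vspace \<iota> = PiM ({..<M \<iota>} \<times> {..<N \<iota>}) (\<lambda>_. (borel :: complex measure))"
definition "Aspace \<iota> = PiM {..<N \<iota>} (\<lambda>_. (borel :: real measure))"
definition "Vvar \<iota> \<omega> = restrict (\<lambda>(i, j). V \<iota> \<omega> i j) ({..<M \<iota>} \<times> {..<N \<iota>})"
definition "Avar \<iota> \<omega> = restrict (A \<iota> \<omega>) {..<N \<iota>}"
text \<open>Independence is available for measurable functions of \<open>Vvar\<close> and
  \<open>Avar\<close>, so \<open>psi\<close> is rewritten as such a function.\<close>

definition "psiV \<iota> u i j = (\<Sum>l<M \<iota>. cnj (u (l, i)) * u (l, j)) - (if i = j then complex_of_real \<beta> else 0)"

lemma Vvar_measurable: "Vvar \<iota> \<in> measurable (P \<iota>) (Vspace \<iota>)"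
  unfolding Vvar_def[abs_def] Vspace_def by (rule measurable_restrict) (auto simp: V_meas)

lemma Avar_measurable: "Avar \<iota> \<in> measurable (P \<iota>) (Aspace \<iota>)"
  unfolding Avar_def[abs_def] Aspace_def by (rule measurable_restrict) (auto simp: A_meas)

lemma VA_indep:
  fixes f g :: "_ \<Rightarrow> complex"
  assumes "f \<in> borel_measurable (Vspace \<iota>)" "g \<in> borel_measurable (Aspace \<iota>)"
  shows "prob_space.indep_var (P \<iota>) borel (\<lambda>\<omega>. f (Vvar \<iota> \<omega>)) borel (\<lambda>\<omega>. g (Avar \<iota> \<omega>))"
  using prob_space.indep_var_of_indep_set_preimages[OF prob Vvar_measurable Avar_measurable _ assms] AV_indep[of \<iota>]
  unfolding Vvar_def Avar_def Vspace_def Aspace_def by blast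

lemma psiV_Vvar: "i < N \<iota> \<Longrightarrow> j < N \<iota> \<Longrightarrow> psiV \<iota> (Vvar \<iota> \<omega>) i j = psi \<iota> \<omega> i j"
  by (simp add: psiV_def psi_def Vvar_def col_inner_def)

lemma bern_Avar: "j < N \<iota> \<Longrightarrow> Avar \<iota> \<omega> j - \<alpha> = bern \<iota> \<omega> j"
  by (simp add: Avar_def bern_def)

lemma psiV_measurable:
  assumes "i < N \<iota>" "j < N \<iota>"
  shows "(\<lambda>u. psiV \<iota> u i j) \<in> borel_measurable (Vspace \<iota>)"
  unfolding psiV_def Vspace_def using assms
  by (intro borel_measurable_diff borel_measurable_sum borel_measurable_times
      borel_measurable_cnj
      measurable_component_singleton) auto

lemma bern_indep: "prob_space.indep_vars (P \<iota>) (\<lambda>_. borel) (\<lambda>j \<omega>. Avar \<iota> \<omega> j - \<alpha>) {..<N \<iota>}"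
proof -
  interpret prob_space "P \<iota>" by (rule prob)
  have "indep_vars (\<lambda>_. borel) (\<lambda>j \<omega>. A \<iota> \<omega> j - \<alpha>) {..<N \<iota>}"
    by (rule indep_vars_compose2[OF A_indep]) auto
  then show ?thesis by (rule indep_vars_cong[THEN iffD1, rotated -1]) (auto simp: Avar_def)
qed

text \<open>\<open>pp\<close> is kept general: it is the centered Gram entry for the traces of
  powers, and constantly 1 for the law of large numbers.\<close>

lemma second_moment_model:
  assumes k: "k \<ge> 1"
    and pm: "\<And>i j. i < N \<iota> \<Longrightarrow> j < N \<iota> \<Longrightarrow> (\<lambda>u. pp u i j) \<in> borel_measurable (Vspace \<iota>)"
    and pbd: "\<And>i j. i < N \<iota> \<Longrightarrow> j < N \<iota> \<Longrightarrow> AE \<omega> in P \<iota>. cmod (pp (Vvar \<iota> \<omega>) i j) \<le> K"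
    and mom: "\<And>i j. i < N \<iota> \<Longrightarrow> j < N \<iota> \<Longrightarrow> (\<integral>\<omega>. cmod (pp (Vvar \<iota> \<omega>) i j) ^ (2 * k) \<partial>P \<iota>) \<le> \<mu>"
    and \<mu>: "\<mu> \<ge> 0"
  defines "Z \<equiv> \<lambda>\<omega>. \<Sum>xs\<in>index_lists (N \<iota>) k. (\<Prod>(x, y)\<leftarrow>zip (last xs # xs) xs. pp (Vvar \<iota> \<omega>) x y) *
      (\<Prod>x\<leftarrow>xs. complex_of_real (Avar \<iota> \<omega> x - \<alpha>))"
  shows "integrable (P \<iota>) (\<lambda>\<omega>. (cmod (Z \<omega>))\<^sup>2)"
    "(\<integral>\<omega>. (cmod (Z \<omega>))\<^sup>2 \<partial>P \<iota>) \<le> real (k ^ (2 * k) * N \<iota> ^ k) * (2 * real k * \<mu>)"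
proof -
  interpret prob_space "P \<iota>" by (rule prob)
  have bm: "(\<lambda>w. w j - \<alpha>) \<in> borel_measurable (Aspace \<iota>)" if "j < N \<iota>" for j
    unfolding Aspace_def using that by (intro borel_measurable_diff measurable_component_singleton) auto
  have bd: "AE \<omega> in P \<iota>. \<bar>Avar \<iota> \<omega> j - \<alpha>\<bar> \<le> 1" if "j < N \<iota>" for j
    using bern_bound[OF that] by (simp add: bern_Avar[OF that])
  have mean: "expectation (\<lambda>\<omega>. Avar \<iota> \<omega> j - \<alpha>) = 0" if "j < N \<iota>" for j
    using bern_mean[OF that] by (simp add: bern_Avar[OF that])
  note sm = second_moment_cycle_sum[where pp=pp and bb="\<lambda>w j. w j - \<alpha>",
    OF Vvar_measurable Avar_measurable VA_indep k pm bm bern_indep bd mean pbd mom \<mu>]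
  show "integrable (P \<iota>) (\<lambda>\<omega>. (cmod (Z \<omega>))\<^sup>2)"
    unfolding Z_def by (rule sm(1))
  show "(\<integral>\<omega>. (cmod (Z \<omega>))\<^sup>2 \<partial>P \<iota>) \<le> real (k ^ (2 * k) * N \<iota> ^ k) * (2 * real k * \<mu>)"
    unfolding Z_def by (rule sm(2))
qed

end

section \<open>Mean square limits of the normalised traces\<close>

context manova_model
begin

lemma cyc_eq_model_sum:
  assumes "k \<ge> 1"
  shows "cyc k \<iota> \<omega> = (\<Sum>xs\<in>index_lists (N \<iota>) k. (\<Prod>(x, y)\<leftarrow>zip (last xs # xs) xs. psiV \<iota> (Vvar \<iota> \<omega>) x y) *
      (\<Prod>x\<leftarrow>xs. complex_of_real (Avar \<iota> \<omega> x - \<alpha>)))"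
  unfolding cyc_def
proof (rule sum.cong[OF refl])
  fix xs assume xs: "xs \<in> index_lists (N \<iota>) k"
  then have ne: "xs \<noteq> []" using assms by (auto simp: index_lists_def)
  have sub: "x < N \<iota>" if "x \<in> set xs" for x using xs that by (auto simp: index_lists_def)
  have "map (\<lambda>(x, y). psi \<iota> \<omega> x y) (zip (last xs # xs) xs) = map (\<lambda>(x, y). psiV \<iota> (Vvar \<iota> \<omega>) x y) (zip (last xs # xs) xs)"
  proof (rule map_cong[OF refl], clarify)
    fix x y assume "(x, y) \<in> set (zip (last xs # xs) xs)"
    then have "x \<in> set (last xs # xs)" "y \<in> set xs" by (blast dest: set_zip_leftD set_zip_rightD)+
    then show "psi \<iota> \<omega> x y = psiV \<iota> (Vvar \<iota> \<omega>) x y"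
      using sub last_in_set[OF ne] by (auto simp: psiV_Vvar)
  qed
  moreover have "map (\<lambda>x. complex_of_real (bern \<iota> \<omega> x)) xs = map (\<lambda>x. complex_of_real (Avar \<iota> \<omega> x - \<alpha>)) xs"
    using sub by (intro map_cong refl) (simp only: bern_Avar)
  ultimately show "(\<Prod>(x, y)\<leftarrow>zip (last xs # xs) xs. psi \<iota> \<omega> x y) * (\<Prod>x\<leftarrow>xs. complex_of_real (bern \<iota> \<omega> x)) =
    (\<Prod>(x, y)\<leftarrow>zip (last xs # xs) xs. psiV \<iota> (Vvar \<iota> \<omega>) x y) * (\<Prod>x\<leftarrow>xs. complex_of_real (Avar \<iota> \<omega> x - \<alpha>))"
    by (simp only:)
qed

lemma bern_measurable: "j < N \<iota> \<Longrightarrow> (\<lambda>\<omega>. complex_of_real (bern \<iota> \<omega> j)) \<in> borel_measurable (P \<iota>)"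
  using A_meas by (simp add: bern_def)

lemma cyc_measurable:
  assumes "k \<ge> 1"
  shows "cyc k \<iota> \<in> borel_measurable (P \<iota>)"
  unfolding cyc_def[abs_def] case_prod_unfold
proof (intro borel_measurable_sum borel_measurable_times borel_measurable_prod_list)
  fix xs assume xs: "xs \<in> index_lists (N \<iota>) k"
  then have ne: "xs \<noteq> []" using assms by (auto simp: index_lists_def)
  have sub: "x < N \<iota>" if "x \<in> set xs" for x using xs that by (auto simp: index_lists_def)
  show "(\<lambda>\<omega>. psi \<iota> \<omega> (fst z) (snd z)) \<in> borel_measurable (P \<iota>)" if "z \<in> set (zip (last xs # xs) xs)" for z
  proof -
    obtain x y where z: "z = (x, y)" by (cases z)
    have "x \<in> set (last xs # xs)" "y \<in> set xs" using that unfolding z by (blast dest: set_zip_leftD set_zip_rightD)+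
    then show ?thesis using sub last_in_set[OF ne] unfolding z by (auto intro!: psi_measurable)
  qed
  show "(\<lambda>\<omega>. complex_of_real (bern \<iota> \<omega> z)) \<in> borel_measurable (P \<iota>)" if "z \<in> set xs" for z
    using sub[OF that] by (rule bern_measurable)
qed

text \<open>Of the \<open>N ^ (2 * k)\<close> terms in the square, O(N^k) survive, each of size
  O(N^(1-k)); the resulting factor \<open>N\<close> is beaten by the \<open>N^2\<close> of the
  normalisation.\<close>

lemma L2_null_cyc:
  assumes k: "k \<ge> 1"
  shows "L2_null P (\<lambda>\<iota> \<omega>. cyc k \<iota> \<omega> / of_nat (N \<iota>))"
proof (rule L2_null_of_second_moment)
  show "(\<lambda>\<omega>. cyc k \<iota> \<omega> / of_nat (N \<iota>)) \<in> borel_measurable (P \<iota>)" for \<iota>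
    using cyc_measurable[OF k, of \<iota>] by simp
  have pbd: "AE \<omega> in P \<iota>. cmod (psiV \<iota> (Vvar \<iota> \<omega>) i j) \<le> real (M \<iota>) + 1" if "i < N \<iota>" "j < N \<iota>" for \<iota> i j
    using AE_psi_bound[OF that] by (simp add: psiV_Vvar that)
  \<comment> \<open>Integrability is needed for every \<iota>, but the moment bound holds only for
    large ones, so the crude bound on \<open>psi\<close> is used here.\<close>
  have int: "integrable (P \<iota>) (\<lambda>\<omega>. (cmod (cyc k \<iota> \<omega>))\<^sup>2)" for \<iota>
  proof -
    interpret prob_space "P \<iota>" by (rule prob)
    have "expectation (\<lambda>\<omega>. cmod (psiV \<iota> (Vvar \<iota> \<omega>) i j) ^ (2 * k)) \<le> (real (M \<iota>) + 1) ^ (2 * k)"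
      if ij: "i < N \<iota>" "j < N \<iota>" for i j
    proof -
      have "expectation (\<lambda>\<omega>. cmod (psi \<iota> \<omega> i j) ^ (2 * k)) \<le> expectation (\<lambda>_. (real (M \<iota>) + 1) ^ (2 * k))"
      proof (rule integral_mono_AE)
        show "AE \<omega> in P \<iota>. cmod (psi \<iota> \<omega> i j) ^ (2 * k) \<le> (real (M \<iota>) + 1) ^ (2 * k)"
          using AE_psi_bound[OF ij] by eventually_elim (simp add: power_mono)
      qed (use psi_power_integrable[OF ij] in auto)
      then show ?thesis by (simp add: psiV_Vvar[OF ij] prob_space)
    qed
    from second_moment_model(1)[OF k psiV_measurable pbd this]
    show ?thesis unfolding cyc_eq_model_sum[OF k] by simp
  qed
  show "integrable (P \<iota>) (\<lambda>\<omega>. (cmod (cyc k \<iota> \<omega> / of_nat (N \<iota>)))\<^sup>2)" for \<iota>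
    using int[of \<iota>] by (simp add: norm_divide power_divide)
  show "\<forall>\<^sub>F \<iota> in sequentially. (\<integral>\<omega>. (cmod (cyc k \<iota> \<omega> / of_nat (N \<iota>)))\<^sup>2 \<partial>P \<iota>) \<le> real (k ^ (2 * k)) * (4 * real k) / real (N \<iota>)"
    using psi_moment_bound[OF k] eventually_ge_at_top[of 1]
  proof eventually_elim
    case (elim \<iota>)
    let ?n = "real (N \<iota>)"
    have n: "?n > 0" using N_ge[of \<iota>] elim by linarith
    have "(\<integral>\<omega>. cmod (psiV \<iota> (Vvar \<iota> \<omega>) i j) ^ (2 * k) \<partial>P \<iota>) \<le> 2 * ?n powr (1 - real k)"
      if "i < N \<iota>" "j < N \<iota>" for i j
      using elim that by (simp add: psiV_Vvar that)
    from second_moment_model(2)[OF k psiV_measurable pbd this]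
    have "(\<integral>\<omega>. (cmod (cyc k \<iota> \<omega>))\<^sup>2 \<partial>P \<iota>) \<le> real (k ^ (2 * k) * N \<iota> ^ k) * (2 * real k * (2 * ?n powr (1 - real k)))"
      unfolding cyc_eq_model_sum[OF k] by simp
    also have "\<dots> = real (k ^ (2 * k)) * (4 * real k) * (?n ^ k * ?n powr (1 - real k))" by simp
    also have "?n ^ k * ?n powr (1 - real k) = ?n"
      using n by (simp add: powr_realpow[symmetric] powr_add[symmetric])
    finally have "(\<integral>\<omega>. (cmod (cyc k \<iota> \<omega>))\<^sup>2 \<partial>P \<iota>) / ?n\<^sup>2 \<le> real (k ^ (2 * k)) * (4 * real k) * ?n / ?n\<^sup>2"
      by (rule divide_right_mono) simp
    also have "\<dots> = real (k ^ (2 * k)) * (4 * real k) / ?n" using n by (simp add: power2_eq_square)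
    finally show ?case by (simp add: norm_divide power_divide)
  qed
  show "(\<lambda>\<iota>. real (k ^ (2 * k)) * (4 * real k) / real (N \<iota>)) \<longlonglongrightarrow> 0" by (rule N_inverse_tendsto)
qed

definition "bsum \<iota> \<omega> = (\<Sum>j<N \<iota>. complex_of_real (bern \<iota> \<omega> j))"

text \<open>The weak law of large numbers for the diagonal, read off from the cycle sum with
  \<open>k = 1\<close> and all edge weights 1.\<close>

lemma L2_null_bsum: "L2_null P (\<lambda>\<iota> \<omega>. bsum \<iota> \<omega> / of_nat (N \<iota>))"
proof (rule L2_null_of_second_moment)
  show "(\<lambda>\<omega>. bsum \<iota> \<omega> / of_nat (N \<iota>)) \<in> borel_measurable (P \<iota>)" for \<iota>
    unfolding bsum_def using bern_measurable by (intro borel_measurable_divide borel_measurable_sum) auto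
  have e: "(\<Sum>xs\<in>index_lists (N \<iota>) 1. (\<Prod>(x, y)\<leftarrow>zip (last xs # xs) xs. 1) *
      (\<Prod>x\<leftarrow>xs. complex_of_real (Avar \<iota> \<omega> x - \<alpha>))) = bsum \<iota> \<omega>" for \<iota> \<omega>
    unfolding bsum_def One_nat_def sum_index_lists_Suc index_lists_0
    by (intro sum.cong) (auto simp: bern_Avar[symmetric])
  have sm: "integrable (P \<iota>) (\<lambda>\<omega>. (cmod (bsum \<iota> \<omega>))\<^sup>2)"
    "(\<integral>\<omega>. (cmod (bsum \<iota> \<omega>))\<^sup>2 \<partial>P \<iota>) \<le> real (1 ^ (2 * 1) * N \<iota> ^ 1) * (2 * real 1 * 1)" for \<iota>
    using second_moment_model[of 1 \<iota> "\<lambda>_ _ _. 1" 1 1] prob_space.prob_space[OF prob] unfolding e by simp_all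
  show "integrable (P \<iota>) (\<lambda>\<omega>. (cmod (bsum \<iota> \<omega> / of_nat (N \<iota>)))\<^sup>2)" for \<iota>
    using sm(1)[of \<iota>] by (simp add: norm_divide power_divide)
  show "\<forall>\<^sub>F \<iota> in sequentially. (\<integral>\<omega>. (cmod (bsum \<iota> \<omega> / of_nat (N \<iota>)))\<^sup>2 \<partial>P \<iota>) \<le> 2 / real (N \<iota>)"
    using eventually_ge_at_top[of 1]
  proof eventually_elim
    case (elim \<iota>)
    have n: "real (N \<iota>) > 0" using N_ge[of \<iota>] elim by linarith
    have "(\<integral>\<omega>. (cmod (bsum \<iota> \<omega>))\<^sup>2 \<partial>P \<iota>) / (real (N \<iota>))\<^sup>2 \<le> real (N \<iota>) * 2 / (real (N \<iota>))\<^sup>2"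
      using sm(2)[of \<iota>] by (intro divide_right_mono) auto
    also have "\<dots> = 2 / real (N \<iota>)" using n by (simp add: power2_eq_square)
    finally show ?case by (simp add: norm_divide power_divide)
  qed
  show "(\<lambda>\<iota>. 2 / real (N \<iota>)) \<longlonglongrightarrow> 0" by (rule N_inverse_tendsto)
qed

text \<open>\<open>trB k\<close> and \<open>trP k\<close> are the traces of \<open>X\<^sup>k (A - \<alpha>)\<close> and \<open>X\<^sup>k (V\<^sup>* V - \<beta>)\<close> where
  \<open>X = (V\<^sup>* V - \<beta>) (A - \<alpha>)\<close>; \<open>cyc k\<close> is the trace of \<open>X\<^sup>k\<close>.\<close>

fun trB trP :: "nat \<Rightarrow> nat \<Rightarrow> 'w \<Rightarrow> complex" where
  "trB 0 \<iota> \<omega> = bsum \<iota> \<omega>"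
| "trP 0 \<iota> \<omega> = of_nat (M \<iota>) - of_real \<beta> * of_nat (N \<iota>)"
| "trB (Suc k) \<iota> \<omega> = (1 - 2 * of_real \<alpha>) * cyc (Suc k) \<iota> \<omega> + of_real \<alpha> * (1 - of_real \<alpha>) * trP k \<iota> \<omega>"
| "trP (Suc k) \<iota> \<omega> = (1 - 2 * of_real \<beta>) * cyc (Suc k) \<iota> \<omega> + of_real \<beta> * (1 - of_real \<beta>) * trB k \<iota> \<omega>"

text \<open>The recursion ends in \<open>trB 0\<close>, covered by the law of large numbers, or in
  \<open>trP 0\<close>, which is deterministic and small against \<open>N\<close> because
  \<open>M / N\<close> tends to \<beta>.\<close>

lemma L2_null_trB_trP:
  "L2_null P (\<lambda>\<iota> \<omega>. trB k \<iota> \<omega> / of_nat (N \<iota>)) \<and> L2_null P (\<lambda>\<iota> \<omega>. trP k \<iota> \<omega> / of_nat (N \<iota>))"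
proof (induction k)
  case 0
  have "(\<lambda>\<iota>. complex_of_real (real (M \<iota>) / real (N \<iota>) - \<beta>)) \<longlonglongrightarrow> of_real (\<beta> - \<beta>)"
    by (intro tendsto_intros ratio)
  then have "L2_null P (\<lambda>\<iota> \<omega>. complex_of_real (real (M \<iota>) / real (N \<iota>) - \<beta>))"
    by (intro L2_null_const prob) simp
  then have "L2_null P (\<lambda>\<iota> \<omega>. trP 0 \<iota> \<omega> / of_nat (N \<iota>))"
  proof (rule L2_null_AE_cong)
    show "\<forall>\<^sub>F \<iota> in sequentially. AE \<omega> in P \<iota>. complex_of_real (real (M \<iota>) / real (N \<iota>) - \<beta>) = trP 0 \<iota> \<omega> / of_nat (N \<iota>)"
      using eventually_ge_at_top[of 1]
    proof eventually_elim
      case (elim \<iota>)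
      \<comment> \<open>If \<open>N \<iota>\<close> were 0, the two sides would be
        \<open>- \<beta>\<close> and 0 by the convention for division.\<close>
      then have "N \<iota> \<noteq> 0" using N_ge[of \<iota>] by linarith
      then show ?case by (simp add: field_simps)
    qed
  qed simp
  then show ?case using L2_null_bsum by simp
next
  case (Suc k)
  have c: "L2_null P (\<lambda>\<iota> \<omega>. cyc (Suc k) \<iota> \<omega> / of_nat (N \<iota>))" by (rule L2_null_cyc) simp
  have IH: "L2_null P (\<lambda>\<iota> \<omega>. trB k \<iota> \<omega> / of_nat (N \<iota>))" "L2_null P (\<lambda>\<iota> \<omega>. trP k \<iota> \<omega> / of_nat (N \<iota>))"
    using Suc by auto
  show ?case
    using L2_null_add[OF L2_null_cmult[OF c] L2_null_cmult[OF IH(2)], of "1 - 2 * of_real \<alpha>" "of_real \<alpha> * (1 - of_real \<alpha>)"]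
      L2_null_add[OF L2_null_cmult[OF c] L2_null_cmult[OF IH(1)], of "1 - 2 * of_real \<beta>" "of_real \<beta> * (1 - of_real \<beta>)"]
    by (simp add: add_divide_distrib)
qed

lemma good_traces:
  assumes g: "good \<iota> \<omega>"
  defines "X \<equiv> (HH \<iota> \<omega> - of_real \<beta> \<cdot>\<^sub>m 1\<^sub>m (N \<iota>)) * (DD \<iota> \<omega> - of_real \<alpha> \<cdot>\<^sub>m 1\<^sub>m (N \<iota>))"
  shows "mtrace (DD \<iota> \<omega> * X ^\<^sub>m Suc k) = trB (Suc k) \<iota> \<omega> + of_real \<alpha> * cyc (Suc k) \<iota> \<omega>"
proof -
  interpret projection_pair "DD \<iota> \<omega>" "HH \<iota> \<omega>" "N \<iota>" "of_real \<alpha>" "of_real \<beta>" by (rule good_projection_pair[OF g])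
  have X: "X = cX" by (simp add: X_def cX_def cP_def cB_def)
  have cP: "cP $$ (i, j) = psi \<iota> \<omega> i j" if "i < N \<iota>" "j < N \<iota>" for i j
    using that HH_carrier[of \<iota> \<omega>] by (simp add: cP_def HH_index psi_def)
  have cB: "cB $$ (i, j) = (if i = j then complex_of_real (bern \<iota> \<omega> j) else 0)" if "i < N \<iota>" "j < N \<iota>" for i j
  proof -
    have "DD \<iota> \<omega> $$ (i, j) = (if i = j then complex_of_real (A \<iota> \<omega> j) else 0)"
      using that by (simp add: DD_def Dmat_def)
    then show ?thesis using that by (simp add: cB_def bern_def)
  qed
  have e: "cX $$ (i, j) = psi \<iota> \<omega> i j * complex_of_real (bern \<iota> \<omega> j)" if ij: "i < N \<iota>" "j < N \<iota>" for i j
  proof -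
    have "cX $$ (i, j) = (\<Sum>l<N \<iota>. cP $$ (i, l) * cB $$ (l, j))"
      using ij by (simp add: cX_def scalar_prod_def lessThan_atLeast0)
    also have "\<dots> = (\<Sum>l<N \<iota>. if l = j then psi \<iota> \<omega> i j * complex_of_real (bern \<iota> \<omega> j) else 0)"
      using ij by (intro sum.cong) (auto simp: cP cB)
    finally show ?thesis using ij by simp
  qed
  have u: "mtrace (cX ^\<^sub>m Suc k) = cyc (Suc k) \<iota> \<omega>" for k
    unfolding cyc_def by (rule mtrace_pow_eq_sum_cycles[OF carriers(5) e]) auto
  \<comment> \<open>Both traces share one induction, since each recursion refers to the
    other.\<close>
  have "mtrace (cX ^\<^sub>m k * cB) = trB k \<iota> \<omega> \<and> mtrace (cX ^\<^sub>m k * cP) = trP k \<iota> \<omega>" for k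
  proof (induction k)
    case 0
    have "mtrace cB = bsum \<iota> \<omega>" by (simp add: mtrace_def cB bsum_def)
    moreover have "mtrace cP = of_nat (M \<iota>) - of_real \<beta> * of_nat (N \<iota>)"
      unfolding cP_def using HH_carrier[of \<iota> \<omega>]
      by (simp add: mtrace_minus[of _ "N \<iota>"] mtrace_smult[of _ "N \<iota>"] mtrace_one good_trace_HH[OF g])
    ultimately show ?case by simp
  next
    case (Suc k)
    then show ?case by (simp only: mtrace_cX_pow_cB mtrace_cX_pow_cP u trB.simps trP.simps)
  qed
  then show ?thesis unfolding X mtrace_A_cX_pow u by (simp del: pow_mat.simps trB.simps)
qed

text \<open>An exact error formula. The spectral sum is a trace plus
  \<open>(N - tr A) * q 0\<close>, and \<open>tr A = bsum + \<alpha> * N\<close>. The main part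
  \<open>(1 - \<alpha>) * q 0\<close> is the integral against the law; the remaining terms are known
  to vanish in mean square.\<close>

lemma good_esd_compressed_poly:
  assumes g: "good \<iota> \<omega>" and N: "N \<iota> > 0"
  shows "complex_of_real (esd_integral (CC \<iota> \<omega>) (compressed_poly \<alpha> \<beta> (Suc k)) - manova_integral \<alpha> \<beta> (compressed_poly \<alpha> \<beta> (Suc k)))
    = trB (Suc k) \<iota> \<omega> / of_nat (N \<iota>) + of_real \<alpha> * (cyc (Suc k) \<iota> \<omega> / of_nat (N \<iota>))
      + (- of_real (compressed_poly \<alpha> \<beta> (Suc k) 0)) * (bsum \<iota> \<omega> / of_nat (N \<iota>))"
proof -
  interpret manova_params \<alpha> \<beta> by unfold_locales (rule alpha beta)+
  interpret projection_pair "DD \<iota> \<omega>" "HH \<iota> \<omega>" "N \<iota>" "of_real \<alpha>" "of_real \<beta>" by (rule good_projection_pair[OF g])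
  obtain es :: "real list" where es: "length es = N \<iota>"
    "\<forall>k. mtrace (CC \<iota> \<omega> ^\<^sub>m k) = complex_of_real (\<Sum>e\<leftarrow>es. e ^ k)"
    "\<forall>f. esd_integral (CC \<iota> \<omega>) f = (\<Sum>e\<leftarrow>es. f e) / real (N \<iota>)"
    using good_spectrum[OF g] by blast
  have C: "cC = CC \<iota> \<omega>" by (simp add: cC_def CC_eq_compress)
  have tD: "mtrace (DD \<iota> \<omega>) = bsum \<iota> \<omega> + of_real \<alpha> * of_nat (N \<iota>)"
    by (simp add: mtrace_def DD_def Dmat_def bsum_def bern_def sum.distrib sum_subtractf)
  let ?q = "compressed_poly \<alpha> \<beta> (Suc k)"
  have tr: "mtrace (cC ^\<^sub>m k) = complex_of_real (\<Sum>e\<leftarrow>es. e ^ k)" for k using es(2) unfolding C by blast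
  have "crho 0 (Suc k) = of_real (\<Sum>e\<leftarrow>es. ?q e) - (of_nat (N \<iota>) - mtrace (DD \<iota> \<omega>)) * of_real (?q 0)"
    using crho_eigenvalues[OF refl refl es(1) tr, of 0 "Suc k"] by simp
  moreover have "crho 0 (Suc k) = trB (Suc k) \<iota> \<omega> + of_real \<alpha> * cyc (Suc k) \<iota> \<omega>"
  proof -
    have "crho 0 (Suc k) = mtrace (DD \<iota> \<omega> * cX ^\<^sub>m Suc k)"
      unfolding crho_def by (simp del: pow_mat.simps(2))
    then show ?thesis using good_traces[OF g, of k] by (simp add: cX_def cP_def cB_def)
  qed
  ultimately have "complex_of_real (\<Sum>e\<leftarrow>es. ?q e) = trB (Suc k) \<iota> \<omega> + of_real \<alpha> * cyc (Suc k) \<iota> \<omega>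
      + (of_nat (N \<iota>) - mtrace (DD \<iota> \<omega>)) * of_real (?q 0)" by (simp del: trB.simps)
  then have "complex_of_real (esd_integral (CC \<iota> \<omega>) ?q) = (trB (Suc k) \<iota> \<omega> + of_real \<alpha> * cyc (Suc k) \<iota> \<omega>
      + (of_nat (N \<iota>) - mtrace (DD \<iota> \<omega>)) * of_real (?q 0)) / of_nat (N \<iota>)"
    by (simp add: es(3) del: trB.simps compressed_poly.simps)
  also have "\<dots> = trB (Suc k) \<iota> \<omega> / of_nat (N \<iota>) + of_real \<alpha> * (cyc (Suc k) \<iota> \<omega> / of_nat (N \<iota>))
      + (- of_real (?q 0)) * (bsum \<iota> \<omega> / of_nat (N \<iota>)) + of_real ((1 - \<alpha>) * ?q 0)"
    unfolding tD using N by (simp add: field_simps del: trB.simps compressed_poly.simps)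
  finally show ?thesis unfolding manova_compressed_poly of_real_diff by (simp del: trB.simps compressed_poly.simps)
qed

section \<open>From compressed polynomials to continuous test functions\<close>

definition "dev f \<iota> \<omega> = esd_integral (CC \<iota> \<omega>) f - manova_integral \<alpha> \<beta> f"

text \<open>Continuity is included because linearity of the limit functional is proved for
  continuous functions.\<close>

definition "conv f \<longleftrightarrow> continuous_on UNIV f \<and> L2_null P (\<lambda>\<iota> \<omega>. complex_of_real (dev f \<iota> \<omega>))"

lemma dev_measurable: "continuous_on UNIV f \<Longrightarrow> dev f \<iota> \<in> borel_measurable (P \<iota>)"
  unfolding dev_def[abs_def] using esd_measurable by simp

lemma conv_linear:
  assumes f: "conv f" and g: "conv g"
  shows "conv (\<lambda>x. u * f x + v * g x)"
proof -
  interpret manova_params \<alpha> \<beta> by unfold_locales (rule alpha beta)+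
  have c: "continuous_on UNIV f" "continuous_on UNIV g" using f g by (auto simp: conv_def)
  have "complex_of_real (dev (\<lambda>x. u * f x + v * g x) \<iota> \<omega>)
      = of_real u * complex_of_real (dev f \<iota> \<omega>) + of_real v * complex_of_real (dev g \<iota> \<omega>)" for \<iota> \<omega>
    by (simp add: dev_def esd_integral_linear manova_linear[OF c] algebra_simps)
  moreover have "L2_null P (\<lambda>\<iota> \<omega>. of_real u * complex_of_real (dev f \<iota> \<omega>) + of_real v * complex_of_real (dev g \<iota> \<omega>))"
    using f g by (intro L2_null_add L2_null_cmult) (auto simp: conv_def)
  ultimately show ?thesis using c by (simp add: conv_def continuous_intros)
qed

lemma conv_compressed_poly: "conv (compressed_poly \<alpha> \<beta> k)"
proof -
  interpret manova_params \<alpha> \<beta> by unfold_locales (rule alpha beta)+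
  have cont: "continuous_on UNIV (compressed_poly \<alpha> \<beta> k)" by (rule compressed_poly_continuous)
  have m: "(\<lambda>\<omega>. complex_of_real (dev (compressed_poly \<alpha> \<beta> k) \<iota> \<omega>)) \<in> borel_measurable (P \<iota>)" for \<iota>
    using dev_measurable[OF cont] by simp
  have N1: "\<forall>\<^sub>F \<iota> in sequentially. N \<iota> > 0"
    using eventually_ge_at_top[of 1] by eventually_elim (use N_ge in \<open>metis less_le_trans less_one not_le\<close>)
  show ?thesis
  proof (cases k)
    case 0
    have q: "compressed_poly \<alpha> \<beta> 0 = (\<lambda>_. 1)" by auto
    have "\<forall>\<^sub>F \<iota> in sequentially. AE \<omega> in P \<iota>. 0 = complex_of_real (dev (compressed_poly \<alpha> \<beta> k) \<iota> \<omega>)"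
      using N1
    proof eventually_elim
      case (elim \<iota>)
      show ?case
      proof (rule AE_mp[OF AE_good], rule AE_I2, rule impI)
        fix \<omega> assume "good \<iota> \<omega>"
        then obtain es :: "real list" where es: "length es = N \<iota>" "\<forall>f. esd_integral (CC \<iota> \<omega>) f = (\<Sum>e\<leftarrow>es. f e) / real (N \<iota>)"
          using good_spectrum by blast
        \<comment> \<open>Division by \<open>N \<iota> = 0\<close> would give 0 here, hence the
          restriction to large \<iota>.\<close>
        have "esd_integral (CC \<iota> \<omega>) (\<lambda>_. 1) = 1" using es elim by (simp add: sum_list_triv)
        then show "0 = complex_of_real (dev (compressed_poly \<alpha> \<beta> k) \<iota> \<omega>)"
          unfolding dev_def 0 q manova_one by simp
      qed
    qed
    then show ?thesis using L2_null_AE_cong[OF L2_null_zero m] cont by (simp add: conv_def)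
  next
    case (Suc l)
    have "L2_null P (\<lambda>\<iota> \<omega>. trB (Suc l) \<iota> \<omega> / of_nat (N \<iota>) + of_real \<alpha> * (cyc (Suc l) \<iota> \<omega> / of_nat (N \<iota>))
      + (- of_real (compressed_poly \<alpha> \<beta> (Suc l) 0)) * (bsum \<iota> \<omega> / of_nat (N \<iota>)))"
      using L2_null_trB_trP[of "Suc l"] L2_null_cyc[of "Suc l"] L2_null_bsum
      by (intro L2_null_add L2_null_cmult) auto
    then have "L2_null P (\<lambda>\<iota> \<omega>. complex_of_real (dev (compressed_poly \<alpha> \<beta> k) \<iota> \<omega>))"
    proof (rule L2_null_AE_cong[OF _ m])
      show "\<forall>\<^sub>F \<iota> in sequentially. AE \<omega> in P \<iota>. trB (Suc l) \<iota> \<omega> / of_nat (N \<iota>) + of_real \<alpha> * (cyc (Suc l) \<iota> \<omega> / of_nat (N \<iota>))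
        + (- of_real (compressed_poly \<alpha> \<beta> (Suc l) 0)) * (bsum \<iota> \<omega> / of_nat (N \<iota>)) = complex_of_real (dev (compressed_poly \<alpha> \<beta> k) \<iota> \<omega>)"
        using N1
      proof eventually_elim
        case (elim \<iota>)
        show ?case
          using AE_good[of \<iota>] by eventually_elim (simp only: dev_def Suc good_esd_compressed_poly[OF _ elim])
      qed
    qed
    then show ?thesis using cont by (simp add: conv_def)
  qed
qed

text \<open>Read backwards, the recursion expresses \<open>x * q_k\<close> by
  \<open>q_{k+1}\<close>, \<open>q_k\<close> and \<open>q_{k-1}\<close>, and \<open>x * q_0\<close>
  by \<open>q_1\<close> and \<open>q_0\<close>, dividing by \<open>1 - \<alpha>\<close>. A power of
  \<open>x\<close> is thus traded for a shift in \<open>k\<close>, so the induction on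
  \<open>j\<close> runs over all \<open>k\<close> at once.\<close>

lemma conv_power: "conv (\<lambda>x. x ^ j)"
proof -
  have "conv (\<lambda>x. x ^ j * compressed_poly \<alpha> \<beta> k x)" for k
  proof (induction j arbitrary: k)
    case 0
    then show ?case using conv_compressed_poly by simp
  next
    case (Suc j)
    show ?case
    proof (cases k)
      case 0
      have "(\<lambda>x. x ^ Suc j * compressed_poly \<alpha> \<beta> k x)
          = (\<lambda>x. 1 / (1 - \<alpha>) * (x ^ j * compressed_poly \<alpha> \<beta> (Suc 0) x) + \<beta> * (x ^ j * compressed_poly \<alpha> \<beta> 0 x))"
        using alpha by (auto simp: 0 field_simps)
      then show ?thesis using conv_linear[OF Suc[of "Suc 0"] Suc[of 0], of "1 / (1 - \<alpha>)" \<beta>] by (simp only:)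
    next
      case k: (Suc l)
      have "(\<lambda>x. x ^ Suc j * compressed_poly \<alpha> \<beta> k x)
          = (\<lambda>x. 1 * (1 * (x ^ j * compressed_poly \<alpha> \<beta> (Suc (Suc l)) x) + (\<alpha> + \<beta> - 2 * \<alpha> * \<beta>) * (x ^ j * compressed_poly \<alpha> \<beta> (Suc l) x))
              + \<alpha> * \<beta> * (1 - \<alpha>) * (1 - \<beta>) * (x ^ j * compressed_poly \<alpha> \<beta> l x))"
        unfolding k by (rule ext) (simp add: algebra_simps)
      then show ?thesis
        using conv_linear[OF conv_linear[OF Suc[of "Suc (Suc l)"] Suc[of "Suc l"], of 1 "\<alpha> + \<beta> - 2 * \<alpha> * \<beta>"] Suc[of l],
            of 1 "\<alpha> * \<beta> * (1 - \<alpha>) * (1 - \<beta>)"] by (simp only:)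
    qed
  qed
  from this[of 0] show ?thesis by simp
qed

lemma dev_prob_tendsto_0:
  assumes f: "continuous_on UNIV f" and e: "\<epsilon> > 0"
  shows "(\<lambda>\<iota>. measure (P \<iota>) {\<omega> \<in> space (P \<iota>). \<bar>dev f \<iota> \<omega>\<bar> > \<epsilon>}) \<longlonglongrightarrow> 0"
proof -
  interpret manova_params \<alpha> \<beta> by unfold_locales (rule alpha beta)+
  \<comment> \<open>The unit interval carries both the law and, on good outcomes, the spectrum. An
    error \<open>\<epsilon> / 4\<close> for each leaves \<open>\<epsilon> / 2\<close> for the
    polynomial.\<close>
  obtain p where pp: "real_polynomial_function p" "\<And>x. x \<in> {0..1} \<Longrightarrow> \<bar>f x - p x\<bar> < \<epsilon> / 4"
    using Stone_Weierstrass_real_polynomial_function[of "{0..1}" f "\<epsilon> / 4"] continuous_on_subset[OF f] e by auto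
  have "conv p" using conv_power conv_linear pp(1) by (rule real_polynomial_induct)
  then have pc: "continuous_on UNIV p" and pn: "L2_null P (\<lambda>\<iota> \<omega>. complex_of_real (dev p \<iota> \<omega>))" by (auto simp: conv_def)
  have fpc: "continuous_on UNIV (\<lambda>x. 1 * f x + (- 1) * p x)" using f pc by (intro continuous_intros)
  have mb: "\<bar>manova_integral \<alpha> \<beta> f - manova_integral \<alpha> \<beta> p\<bar> \<le> \<epsilon> / 4"
    using manova_bound[OF fpc, of "\<epsilon> / 4"] pp(2) manova_linear[OF f pc, of 1 "- 1"] by (auto intro: less_imp_le)
  have le: "measure (P \<iota>) {\<omega> \<in> space (P \<iota>). \<bar>dev f \<iota> \<omega>\<bar> > \<epsilon>} \<le> measure (P \<iota>) {\<omega> \<in> space (P \<iota>). cmod (complex_of_real (dev p \<iota> \<omega>)) > \<epsilon> / 2}"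
    for \<iota>
  proof -
    interpret prob_space "P \<iota>" by (rule prob)
    note dev_measurable[OF f, of \<iota>, measurable] dev_measurable[OF pc, of \<iota>, measurable]
    show ?thesis
    proof (rule finite_measure_mono_AE)
      show "AE \<omega> in P \<iota>. \<omega> \<in> {\<omega> \<in> space (P \<iota>). \<bar>dev f \<iota> \<omega>\<bar> > \<epsilon>} \<longrightarrow> \<omega> \<in> {\<omega> \<in> space (P \<iota>). cmod (complex_of_real (dev p \<iota> \<omega>)) > \<epsilon> / 2}"
        using AE_good[of \<iota>]
      proof eventually_elim
        case (elim \<omega>)
        obtain es :: "real list" where es: "length es = N \<iota>" "\<forall>f. esd_integral (CC \<iota> \<omega>) f = (\<Sum>e\<leftarrow>es. f e) / real (N \<iota>)"
          "\<forall>e\<in>set es. e \<in> {0..1}" using good_spectrum[OF elim] by blast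
        have "\<bar>\<Sum>e\<leftarrow>es. f e - p e\<bar> \<le> (\<Sum>e\<leftarrow>es. \<bar>f e - p e\<bar>)"
          using sum_list_abs[of "map (\<lambda>e. f e - p e) es"] by (simp add: comp_def)
        also have "\<dots> \<le> (\<Sum>e\<leftarrow>es. \<epsilon> / 4)"
          using es(3) pp(2) by (intro sum_list_mono) (auto intro: less_imp_le)
        finally have "\<bar>\<Sum>e\<leftarrow>es. f e - p e\<bar> \<le> real (N \<iota>) * (\<epsilon> / 4)" using es(1) by (simp add: sum_list_triv)
        then have "\<bar>(\<Sum>e\<leftarrow>es. f e - p e) / real (N \<iota>)\<bar> \<le> \<epsilon> / 4"
          using e by (cases "N \<iota> = 0") (auto simp: abs_divide pos_divide_le_eq mult.commute)
        moreover have "esd_integral (CC \<iota> \<omega>) f - esd_integral (CC \<iota> \<omega>) p = (\<Sum>e\<leftarrow>es. f e - p e) / real (N \<iota>)"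
          using es(2) by (simp add: sum_list_subtractf diff_divide_distrib)
        ultimately have "\<bar>esd_integral (CC \<iota> \<omega>) f - esd_integral (CC \<iota> \<omega>) p\<bar> \<le> \<epsilon> / 4"
          by (simp only:)
        then have "\<bar>dev f \<iota> \<omega>\<bar> \<le> \<bar>dev p \<iota> \<omega>\<bar> + \<epsilon> / 2" using mb unfolding dev_def by linarith
        then show ?case by auto
      qed
    qed measurable
  qed
  show ?thesis
    by (rule tendsto_sandwich[OF _ _ tendsto_const L2_null_imp_prob_tendsto_0[OF prob pn, of "\<epsilon> / 2"]])
       (use le e in auto)
qed

end

theorem theorem1p9:
  fixes P :: "nat \<Rightarrow> 'w measure"
    and M N :: "nat \<Rightarrow> nat"
    and V :: "nat \<Rightarrow> 'w \<Rightarrow> nat \<Rightarrow> nat \<Rightarrow> complex"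
    and A :: "nat \<Rightarrow> 'w \<Rightarrow> nat \<Rightarrow> real"
    and \<alpha> \<beta> :: real
  assumes prob: "\<And>\<iota>. prob_space (P \<iota>)"
    and M_inc: "strict_mono M" and N_inc: "strict_mono N"
    and ratio: "(\<lambda>\<iota>. real (M \<iota>) / real (N \<iota>)) \<longlonglongrightarrow> \<beta>"
    and beta: "0 < \<beta>" "\<beta> < 1"
    and alpha: "0 < \<alpha>" "\<alpha> < 1"
    and V_meas: "\<And>\<iota> i j. i < M \<iota> \<Longrightarrow> j < N \<iota> \<Longrightarrow>
                   (\<lambda>\<omega>. V \<iota> \<omega> i j) \<in> borel_measurable (P \<iota>)"
    and V_coisom: "\<And>\<iota>. AE \<omega> in P \<iota>.
        Vmat (M \<iota>) (N \<iota>) (V \<iota> \<omega>) * mat_adjoint (Vmat (M \<iota>) (N \<iota>) (V \<iota> \<omega>)) = 1\<^sub>m (M \<iota>)"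
    and moments: "\<exists>C>0. \<forall>k::nat. k \<ge> 1 \<longrightarrow>
        limsup (\<lambda>\<iota>. ereal (real (N \<iota>) powr (real k / 2 - C) *
          Max {(\<integral>\<omega>. cmod (col_inner (M \<iota>) (V \<iota> \<omega>) i j
                        - (if i = j then complex_of_real \<beta> else 0)) ^ k \<partial>P \<iota>)
               | i j. i < N \<iota> \<and> j < N \<iota>})) = 0"
    and A_meas: "\<And>\<iota> j. j < N \<iota> \<Longrightarrow> (\<lambda>\<omega>. A \<iota> \<omega> j) \<in> borel_measurable (P \<iota>)"
    and A_01: "\<And>\<iota> j. j < N \<iota> \<Longrightarrow> AE \<omega> in P \<iota>. A \<iota> \<omega> j \<in> {0, 1}"
    and A_ber: "\<And>\<iota> j. j < N \<iota> \<Longrightarrow> measure (P \<iota>) {\<omega> \<in> space (P \<iota>). A \<iota> \<omega> j = 1} = \<alpha>"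
    and A_indep: "\<And>\<iota>. prob_space.indep_vars (P \<iota>) (\<lambda>_. borel) (\<lambda>j \<omega>. A \<iota> \<omega> j) {..<N \<iota>}"
    and AV_indep: "\<And>\<iota>. prob_space.indep_set (P \<iota>)
        {(\<lambda>\<omega>. restrict (\<lambda>(i, j). V \<iota> \<omega> i j) ({..<M \<iota>} \<times> {..<N \<iota>})) -` S \<inter> space (P \<iota>)
          | S. S \<in> sets (PiM ({..<M \<iota>} \<times> {..<N \<iota>}) (\<lambda>_. (borel :: complex measure)))}
        {(\<lambda>\<omega>. restrict (A \<iota> \<omega>) {..<N \<iota>}) -` T \<inter> space (P \<iota>)
          | T. T \<in> sets (PiM {..<N \<iota>} (\<lambda>_. (borel :: real measure)))}"
  shows "\<forall>f :: real \<Rightarrow> real. continuous_on UNIV f \<and> compact (closure {x. f x \<noteq> 0}) \<longrightarrow>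
          (\<forall>\<epsilon>>0.
            let E = (\<lambda>\<iota>. {\<omega> \<in> space (P \<iota>).
                      \<bar>esd_integral (Dmat (N \<iota>) (A \<iota> \<omega>) * mat_adjoint (Vmat (M \<iota>) (N \<iota>) (V \<iota> \<omega>))
                                       * Vmat (M \<iota>) (N \<iota>) (V \<iota> \<omega>) * Dmat (N \<iota>) (A \<iota> \<omega>)) f
                       - manova_integral \<alpha> \<beta> f\<bar> > \<epsilon>})
            in (\<forall>\<iota>. E \<iota> \<in> sets (P \<iota>)) \<and> (\<lambda>\<iota>. measure (P \<iota>) (E \<iota>)) \<longlonglongrightarrow> 0)"
proof -
  interpret manova_model P M N V A \<alpha> \<beta>
    by (rule manova_model.intro[OF prob N_inc ratio beta alpha V_meas V_coisom moments A_meas A_01 A_ber A_indep AV_indep])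
  have eq: "\<bar>esd_integral (Dmat (N \<iota>) (A \<iota> \<omega>) * mat_adjoint (Vmat (M \<iota>) (N \<iota>) (V \<iota> \<omega>))
        * Vmat (M \<iota>) (N \<iota>) (V \<iota> \<omega>) * Dmat (N \<iota>) (A \<iota> \<omega>)) f - manova_integral \<alpha> \<beta> f\<bar> = \<bar>dev f \<iota> \<omega>\<bar>"
    for f \<iota> \<omega>
    by (simp add: dev_def CC_def VV_def DD_def)
  show ?thesis
    unfolding Let_def eq
  proof (intro allI impI conjI)
    fix f :: "real \<Rightarrow> real" and \<epsilon> :: real and \<iota>
    assume "continuous_on UNIV f \<and> compact (closure {x. f x \<noteq> 0})" and e: "\<epsilon> > 0"
    then have f: "continuous_on UNIV f" by blast
    show "{\<omega> \<in> space (P \<iota>). \<epsilon> < \<bar>dev f \<iota> \<omega>\<bar>} \<in> sets (P \<iota>)"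
      using dev_measurable[OF f, of \<iota>] by measurable
    show "(\<lambda>\<iota>. measure (P \<iota>) {\<omega> \<in> space (P \<iota>). \<epsilon> < \<bar>dev f \<iota> \<omega>\<bar>}) \<longlonglongrightarrow> 0"
      by (rule dev_prob_tendsto_0[OF f e])
  qed
qed

end
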